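(* Let $\psi_1=\frac{1+\sqrt{3}}{2}=1.366\ldots$. For every fixed $k\in\mathbb{N}$, $k\ge1$, and all positive reals $\lambda_1,\dots,\lambda_k$, we have $$\chi\big(\mathbb{R}_1^n,\mathcal{B}(\lambda_1,\dots,\lambda_k)\big)\ge\big(\psi_1^{1/k}+o(1)\big)^n \quad\text{and}\quad \chi\big(\mathbb{R}_1^n,\triangle^k\big)\ge\big(\psi_1^{1/(k+1)}+o(1)\big)^n$$ as $n\to\infty$. In particular, $\chi(\mathbb{R}_1^n,\triangle^2)\ge(1.1095\ldots+o(1))^n$ and $\chi(\mathbb{R}_1^n,\triangle^3)\ge(1.0810\ldots+o(1))^n$, where $1.1095\ldots=\psi_1^{1/3}$ and $1.0810\ldots=\psi_1^{1/4}$. In fact, the bound with base $1.1095\ldots=\psi_1^{1/3}$ holds not only for the regular triangle $\triangle^2$ but also for all triangles: $\chi(\mathbb{R}_1^n,\mathcal{T})\ge(\psi_1^{1/3}+o(1))^n$ for the vertex set $\mathcal{T}\subset\mathbb{R}^d$ of any triangle.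
   Context: $\mathbb{R}_1^n$ denotes $\mathbb{R}^n$ equipped with the Manhattan norm $\|\mathbf{x}\|_1=\sum_{i=1}^n|x_i|$. For $\mathcal{M}\subset\mathbb{R}^d$, a subset $\mathcal{M}'\subset\mathbb{R}^n$ is an $\ell_1$-isometric copy of $\mathcal{M}$ if there is a bijection $f:\mathcal{M}\to\mathcal{M}'$ with $\|\mathbf{x}-\mathbf{y}\|_1=\|f(\mathbf{x})-f(\mathbf{y})\|_1$ for all $\mathbf{x},\mathbf{y}\in\mathcal{M}$. The chromatic number $\chi(\mathbb{R}_1^n,\mathcal{M})$ is the smallest $r$ such that there is a coloring of $\mathbb{R}^n$ with $r$ colors and with no monochromatic $\ell_1$-isometric copy of $\mathcal{M}$. The baton $\mathcal{B}(\lambda_1,\dots,\lambda_k)$ is the one-dimensional set $\{0,\lambda_1,\lambda_1+\lambda_2,\dots,\sum_{i=1}^k\lambda_i\}\subset\mathbb{R}$. In this setting $\triangle^k$ is the vertex set of a regular unit $k$-dimensional simplex with respect to the $\ell_1$-distance, i.e. a set of $k+1$ points with all pairwise $\ell_1$-distances equal to $1$. The $o(1)$ terms are with respect to $n\to\infty$, all other parameters being fixed. *)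

theory Defs
  imports
    Complex_Main
    "HOL-Library.FuncSet"
    "HOL-Library.Extended_Real"
    "HOL-Library.Landau_Symbols"
begin

text \<open>
  Since the dimension tends to infinity, it cannot be a type: the space \<open>\<real>\<^sup>n\<close> is the set of
  functions \<open>{0,\<dots>,n-1} \<rightarrow> \<real>\<close>, represented as extensional functions on \<open>nat\<close>.
\<close>

definition Rn :: "nat \<Rightarrow> (nat \<Rightarrow> real) set" where
  "Rn n = ({..<n} \<rightarrow>\<^sub>E (UNIV :: real set))"

definition l1_dist :: "nat \<Rightarrow> (nat \<Rightarrow> real) \<Rightarrow> (nat \<Rightarrow> real) \<Rightarrow> real" where
  "l1_dist n x y = (\<Sum>i<n. \<bar>x i - y i\<bar>)"

definition l1_isometric_copy ::
  "nat \<Rightarrow> (nat \<Rightarrow> real) set \<Rightarrow> nat \<Rightarrow> (nat \<Rightarrow> real) set \<Rightarrow> bool" where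
  "l1_isometric_copy d M n M' \<longleftrightarrow>
     M \<subseteq> Rn d \<and> M' \<subseteq> Rn n \<and>
     (\<exists>f. bij_betw f M M' \<and> (\<forall>x\<in>M. \<forall>y\<in>M. l1_dist d x y = l1_dist n (f x) (f y)))"

definition good_coloring ::
  "nat \<Rightarrow> nat \<Rightarrow> (nat \<Rightarrow> real) set \<Rightarrow> nat \<Rightarrow> ((nat \<Rightarrow> real) \<Rightarrow> nat) \<Rightarrow> bool" where
  "good_coloring n d M r c \<longleftrightarrow>
     c \<in> Rn n \<rightarrow> {..<r} \<and>
     \<not> (\<exists>M'. l1_isometric_copy d M n M' \<and> (\<exists>j. \<forall>x\<in>M'. c x = j))"

text \<open>
  The chromatic number of \<open>\<real>\<^sup>n\<close> with respect to a set \<open>M \<subseteq> \<real>\<^sup>d\<close>.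
  It is \<open>\<infinity>\<close> if no finite number of colors suffices.
\<close>

definition chi :: "nat \<Rightarrow> nat \<Rightarrow> (nat \<Rightarrow> real) set \<Rightarrow> enat" where
  "chi n d M = Inf {enat r | r. \<exists>c. good_coloring n d M r c}"

text \<open>The baton with steps \<open>lam 1, \<dots>, lam k\<close>, as a subset of \<open>\<real>\<^sup>1\<close>.\<close>

definition baton :: "nat \<Rightarrow> (nat \<Rightarrow> real) \<Rightarrow> (nat \<Rightarrow> real) set" where
  "baton k lam = (\<lambda>j. \<lambda>i\<in>{..<1}. \<Sum>m=1..j. lam m) ` {0..k}"

definition unit_simplex :: "nat \<Rightarrow> nat \<Rightarrow> (nat \<Rightarrow> real) set \<Rightarrow> bool" where
  "unit_simplex d k S \<longleftrightarrow>
     S \<subseteq> Rn d \<and> card S = k + 1 \<and> (\<forall>x\<in>S. \<forall>y\<in>S. x \<noteq> y \<longrightarrow> l1_dist d x y = 1)"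

lemma ex_unit_simplex: "\<exists>S. unit_simplex (k + 1) k S"
proof -
  define e :: "nat \<Rightarrow> nat \<Rightarrow> real"
    where "e j = (\<lambda>i\<in>{..<k+1}. if i = j then 1/2 else 0)" for j
  have inj: "inj_on e {..<k+1}"
  proof (rule inj_onI)
    fix a b assume ab: "a \<in> {..<k+1}" "b \<in> {..<k+1}" "e a = e b"
    then have "e a a = e b a" by simp
    moreover have "e a a = 1/2" "e b a = (if a = b then 1/2 else 0)"
      using ab(1) by (auto simp: e_def)
    ultimately show "a = b" by (auto split: if_splits)
  qed
  have dist: "l1_dist (k+1) (e a) (e b) = 1" if "a < k+1" "b < k+1" "a \<noteq> b" for a b
  proof -
    have "l1_dist (k+1) (e a) (e b) =
        (\<Sum>i<k+1. (if i = a then 1/2 else 0) + (if i = b then 1/2 else 0))"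
      unfolding l1_dist_def using that by (intro sum.cong) (auto simp: e_def)
    also have "\<dots> = 1"
      using that by (simp add: sum.distrib del: sum.lessThan_Suc)
    finally show ?thesis .
  qed
  have "e j \<in> Rn (k + 1)" for j
    unfolding Rn_def e_def by (simp add: restrict_PiE_iff)
  moreover have "card (e ` {..<k+1}) = k + 1"
    using inj by (simp add: card_image)
  ultimately have "unit_simplex (k + 1) k (e ` {..<k+1})"
    unfolding unit_simplex_def using dist by auto
  then show ?thesis by blast
qed

definition collinear_pts :: "nat \<Rightarrow> (nat \<Rightarrow> real) set \<Rightarrow> bool" where
  "collinear_pts d S \<longleftrightarrow>
     (\<exists>u. \<forall>x\<in>S. \<forall>y\<in>S. \<exists>c. \<forall>i<d. x i - y i = c * u i)"

definition triangle_vertices :: "nat \<Rightarrow> (nat \<Rightarrow> real) set \<Rightarrow> bool" where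
  "triangle_vertices d T \<longleftrightarrow> T \<subseteq> Rn d \<and> card T = 3 \<and> \<not> collinear_pts d T"

definition psi1 :: real where
  "psi1 = (1 + sqrt 3) / 2"

text \<open>The bound \<open>X n \<ge> (b + o(1))\<^sup>n\<close> as \<open>n \<rightarrow> \<infinity>\<close>.\<close>

definition exp_lower_bound :: "(nat \<Rightarrow> enat) \<Rightarrow> real \<Rightarrow> bool" where
  "exp_lower_bound X b \<longleftrightarrow>
     (\<exists>err :: nat \<Rightarrow> real. err \<in> o(\<lambda>_. 1) \<and>
        (\<forall>n\<ge>1. ereal ((b + err n) ^ n) \<le> ereal_of_enat (X n)))"

end

theory Submission
  imports
    Defs
    "HOL-Complex_Analysis.Complex_Analysis"
    "HOL-Number_Theory.Prime_Powers"
    "HOL-Real_Asymp.Real_Asymp"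
begin

text \<open>
  For a prime power \<open>q\<close>, consider the vectors in \<open>{-1,0,1}\<^sup>m\<close> with exactly \<open>2q - 1\<close> nonzero coordinates.
  Two of them are at \<open>\<ell>\<^sub>1\<close>-distance \<open>2q\<close> iff they agree in exactly \<open>q - 1\<close> nonzero coordinates. The matrix
  \<open>C(t(v,w), q - 1)\<close>, where \<open>t(v,w)\<close> counts these agreements, factors through the vectors with
  \<open>q - 1\<close> nonzero coordinates, and modulo \<open>p\<close> it is diagonal on a set that avoids the distance \<open>2q\<close>
  (Frankl--Wilson). For \<open>2q/m\<close> near the optimum, such a set has density at most
  \<open>\<psi>\<^sub>1\<^bsup>-m\<^esup>\<close> up to a factor \<open>m + 1\<close>.

  Now split \<open>n\<close> coordinates into \<open>K\<close> blocks, each carrying a scaled copy of this configuration. In a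
  dense colour class one can move along the critical distance one block after another (batons, \<open>K = k\<close>),
  or from a common centre independently in each block (simplices, \<open>K = k + 1\<close>). Every three-point
  metric is a star with three arms (some possibly \<open>0\<close>), which gives all triangles with \<open>K = 3\<close>.

  To treat all \<open>n\<close> one needs a prime power in \<open>(x, (1+\<epsilon>)x]\<close> for all large \<open>x\<close>. This follows from the
  nonvanishing of the zeta function on \<open>Re s = 1\<close> by a Wiener--Ikehara argument: tested against a
  Fejer kernel centred at \<open>log x\<close>, the von Mangoldt function and the constant \<open>1\<close> have the same
  asymptotic mass, and a gap would leave only the small mass in the tails of the kernel.
\<close>

section \<open>The zeta function on the line \<open>Re s = 1\<close>\<close>

text \<open>Agreement counts lie between 0 and 2q-1, and there C(t, q-1) is nonzero modulo p only at
  t = q-1 and t = 2q-1; hence the support size 2q-1 and the degree q-1. The set sizes are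
  coefficients of powers: C(m,2q-1) 2^(2q-1) over C(m,q-1) 2^(q-1) is compared with (1+2y)^m /
  (1+2y^2)^m at nearly the same power of y, and maximising over y gives \<open>psi1\<close>. With K
  blocks each has about n/K coordinates, whence the exponent 1/K. The obstacle is arithmetic. The
  optimum ties m to q by a fixed ratio; zero padding covers the n in between, but a factor 1+eps
  between usable prime powers costs about the same factor in the exponent. A Bertrand-type factor 2
  would spoil the base, while arbitrarily small eps suffices for o(1). The Fejer kernel fits because
  it is nonnegative and its transform has compact support: only a segment of the line Re s = 1
  matters, and bounds on a compact set replace growth estimates for zeta.\<close>

text \<open>Since \<open>0 powr z = 0\<close>, the term at \<open>n = 0\<close> of every Dirichlet series below vanishes.\<close>

abbreviation npow :: "nat \<Rightarrow> complex \<Rightarrow> complex" where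
  "npow n s \<equiv> of_nat n powr (- s)"

lemma norm_npow: "norm (npow n s) = real n powr (- Re s)"
  by (simp add: norm_powr_real_powr)

lemma npow_mult: "npow (m * n) s = npow m s * npow n s"
  by (simp add: powr_times_real)

lemma npow_eq_exp: "n > 0 \<Longrightarrow> npow n s = exp (- s * of_real (ln (real n)))"
  by (simp add: powr_def Ln_of_nat)

lemma npow_has_derivative:
  "((\<lambda>s. npow n s) has_field_derivative - of_real (ln (real n)) * npow n s) (at s)"
proof (cases "n = 0")
  case False
  show ?thesis
    by (rule DERIV_cong, rule has_field_derivative_transform_within_open
          [where f = "\<lambda>s. exp (- s * of_real (ln (real n)))" and S = UNIV])
       (use False in \<open>auto intro!: derivative_eq_intros simp: npow_eq_exp\<close>)
qed auto

lemma summable_npow: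
  assumes "Re s > 1"
  shows "summable (\<lambda>n. norm (npow n s))"
  using assms by (simp add: norm_npow summable_real_powr_iff del: minus_complex.sel)

lemma summable_ln_npow:
  assumes "Re s > 1"
  shows "summable (\<lambda>n. ln (real n) * norm (npow n s))"
proof -
  define d where "d = (Re s - 1) / 2"
  have d: "d > 0" using assms by (simp add: d_def)
  have "summable (\<lambda>n. (1 / d) * real n powr (d - Re s))"
    by (intro summable_mult) (use assms in \<open>simp add: summable_real_powr_iff d_def field_simps\<close>)
  then show ?thesis
  proof (rule summable_comparison_test')
    fix n :: nat assume "n \<ge> 0"
    show "norm (ln (real n) * norm (npow n s)) \<le> (1 / d) * real n powr (d - Re s)"
    proof (cases "n = 0")
      case False
      then have "ln (real n) \<le> real n powr d / d"
        using d by (intro ln_powr_bound) auto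
      then have "ln (real n) * real n powr (- Re s) \<le> real n powr d / d * real n powr (- Re s)"
        by (intro mult_right_mono) auto
      with False show ?thesis
        unfolding norm_npow by (simp add: powr_diff powr_minus field_simps)
    qed simp
  qed
qed

lemma mangoldt_le_ln: "mangoldt n \<le> ln (real n)"
  by (cases "n = 0") (auto simp: mangoldt_le)

lemma summable_mangoldt_npow:
  assumes "Re s > 1"
  shows "summable (\<lambda>n. norm (mangoldt n * npow n s))"
  by (rule summable_comparison_test'[OF summable_ln_npow[OF assms], of 0])
     (auto simp: norm_mult abs_mult mangoldt_nonneg intro!: mult_right_mono mangoldt_le_ln)

section \<open>Dirichlet series of the constant 1 and of the von Mangoldt function\<close>

definition zeta_series :: "complex \<Rightarrow> complex" where
  "zeta_series s = (\<Sum>n. npow n s)"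

definition mangoldt_series :: "complex \<Rightarrow> complex" where
  "mangoldt_series s = (\<Sum>n. mangoldt n * npow n s)"

text \<open>In analytic terms (-zeta'/zeta) zeta = -zeta'. The coefficients match because
  \<open>mangoldt\<close> summed over the divisors of n is ln n; absolute convergence permits
  collecting the pairs (d, e) by their product.\<close>

lemma mangoldt_series_times_zeta_series:
  assumes "Re s > 1"
  shows "(\<lambda>n. of_real (ln (real n)) * npow n s) sums (mangoldt_series s * zeta_series s)"
proof -
  define f where "f = (\<lambda>n. mangoldt n * npow n s)"
  define g where "g = (\<lambda>n. npow n s)"
  have f0: "f 0 = 0" and g0: "g 0 = 0" by (auto simp: f_def g_def)
  have sf: "summable (\<lambda>n. norm (f n))" and sg: "summable (\<lambda>n. norm (g n))"
    unfolding f_def g_def using summable_mangoldt_npow[OF assms] summable_npow[OF assms] by auto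
  have "(f has_sum mangoldt_series s) UNIV"
    unfolding mangoldt_series_def f_def[symmetric]
    by (auto intro!: norm_summable_imp_has_sum sf summable_sums summable_norm_cancel)
  \<comment> \<open>Index 0 is removed, as pairs correspond bijectively to (product, factor) only
    for positive integers.\<close>
  then have hf: "(f has_sum mangoldt_series s) {0<..}"
    by (rule has_sum_cong_neutral[THEN iffD1, rotated -1]) (auto simp: f0)
  have "(g has_sum zeta_series s) UNIV"
    unfolding zeta_series_def g_def[symmetric]
    by (auto intro!: norm_summable_imp_has_sum sg summable_sums summable_norm_cancel)
  then have hg: "(g has_sum zeta_series s) {0<..}"
    by (rule has_sum_cong_neutral[THEN iffD1, rotated -1]) (auto simp: g0)
  have af: "(\<lambda>n. norm (f n)) summable_on {0<..}" and ag: "(\<lambda>n. norm (g n)) summable_on {0<..}"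
    using norm_summable_imp_summable_on[of "\<lambda>n. norm (f n)"] norm_summable_imp_summable_on[of "\<lambda>n. norm (g n)"] sf sg
    by (auto intro: summable_on_subset_banach)
  have "(\<lambda>p. norm ((\<lambda>(x, y). f x * g y) p)) summable_on {0<..} \<times> {0<..}"
    unfolding Infinite_Sum.abs_summable_on_Sigma_iff
  proof (intro conjI ballI)
    fix x :: nat
    show "(\<lambda>y. norm (case (x, y) of (x, y) \<Rightarrow> f x * g y)) summable_on {0<..}"
      using ag by (auto simp: norm_mult intro: summable_on_cmult_right)
  next
    have "(\<lambda>x. norm (f x) * (\<Sum>\<^sub>\<infinity>y\<in>{0<..}. norm (g y))) summable_on {0<..}"
      by (intro summable_on_cmult_left af)
    moreover have "(\<Sum>\<^sub>\<infinity>y\<in>{0<..}. norm (f x * g y)) = norm (f x) * (\<Sum>\<^sub>\<infinity>y\<in>{0<..}. norm (g y))" for x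
      by (simp add: norm_mult infsum_cmult_right')
    moreover have "(\<Sum>\<^sub>\<infinity>y\<in>{0<..}. norm (g y)) \<ge> 0"
      by (intro infsum_nonneg) auto
    ultimately show "(\<lambda>x. norm (\<Sum>\<^sub>\<infinity>y\<in>{0<..}. norm (case (x, y) of (x, y) \<Rightarrow> f x * g y))) summable_on {0<..}"
      by (simp add: abs_mult)
  qed
  then have sfg: "(\<lambda>(x, y). f x * g y) summable_on {0<..} \<times> {0<..}"
    by (rule abs_summable_summable)
  have hfg: "((\<lambda>(x, y). f x * g y) has_sum (mangoldt_series s * zeta_series s)) ({0<..} \<times> {0<..})"
    by (rule has_sum_SigmaI[where g = "\<lambda>x. f x * zeta_series s"])
       (use sfg in \<open>auto intro!: has_sum_cmult_right has_sum_cmult_left hf hg\<close>)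
  have bij: "((\<lambda>(x, y). f x * g y) has_sum (mangoldt_series s * zeta_series s)) ({0<..} \<times> {0<..})
        \<longleftrightarrow> ((\<lambda>(n, d). f d * g (n div d)) has_sum (mangoldt_series s * zeta_series s))
              (Sigma {0<..} (\<lambda>n. {d. d dvd n}))"
    by (rule has_sum_reindex_bij_witness[where i = "\<lambda>(n, d). (d, n div d)" and j = "\<lambda>(d, e). (d * e, d)"])
       (auto elim!: dvdE intro: Nat.gr0I)
  have "((\<lambda>n. of_real (ln (real n)) * npow n s) has_sum (mangoldt_series s * zeta_series s)) {0<..}"
  proof (rule has_sum_SigmaD[OF hfg[unfolded bij]])
    fix n :: nat assume n: "n \<in> {0<..}"
    have "((\<lambda>d. f d * g (n div d)) has_sum (\<Sum>d | d dvd n. f d * g (n div d))) {d. d dvd n}"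
      using n by (intro has_sum_finite) auto
    also have "(\<Sum>d | d dvd n. f d * g (n div d)) = (\<Sum>d | d dvd n. mangoldt d * npow n s)"
    proof (rule sum.cong)
      fix d assume "d \<in> {d. d dvd n}"
      then have "npow n s = npow d s * npow (n div d) s"
        by (simp flip: npow_mult)
      then show "f d * g (n div d) = mangoldt d * npow n s"
        by (simp add: f_def g_def)
    qed simp
    also have "\<dots> = of_real (ln (real n)) * npow n s"
      using n by (simp add: sum_distrib_right[symmetric] mangoldt_sum)
    finally show "((\<lambda>d. case (n, d) of (n, d) \<Rightarrow> f d * g (n div d)) has_sum
        of_real (ln (real n)) * npow n s) {d. d dvd n}" by simp
  qed
  then have "((\<lambda>n. of_real (ln (real n)) * npow n s) has_sum (mangoldt_series s * zeta_series s)) UNIV"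
    by (rule has_sum_cong_neutral[THEN iffD1, rotated -1]) auto
  then show ?thesis by (rule has_sum_imp_sums)
qed

section \<open>Analytic continuation of (s-1) zeta(s) to Re s > 0\<close>

text \<open>As N times \<open>npow N s\<close> is N^(1-s), the last two summands telescope. Their
  total, -1 for Re s > 1, is compensated by the 1 in \<open>zeta_reg\<close>, and they make the
  terms small enough to converge for Re s > 0.\<close>

definition zeta_reg_term :: "nat \<Rightarrow> complex \<Rightarrow> complex" where
  "zeta_reg_term n s = (s - 1) * npow (Suc n) s - of_nat (Suc n) * npow (Suc n) s
     + of_nat (Suc (Suc n)) * npow (Suc (Suc n)) s"

definition zeta_reg :: "complex \<Rightarrow> complex" where
  "zeta_reg s = 1 + (\<Sum>n. zeta_reg_term n s)"

text \<open>The term is the second-order Taylor remainder of \<open>w \<mapsto> w\<^bsup>1-s\<^esup>\<close> between two consecutive integers.\<close>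

lemma norm_zeta_reg_term:
  assumes "Re s > 0"
  shows "norm (zeta_reg_term n s) \<le> norm (s - 1) * norm s * real (Suc n) powr (- Re s - 1)"
proof -
  define N where "N = Suc n"
  define f where "f i w = (if i = 0 then w powr (1 - s) else if i = 1 then (1 - s) * w powr (- s)
      else (1 - s) * (- s) * w powr (- s - 1))" for i :: nat and w :: complex
  let ?S = "complex_of_real ` {real N..real N + 1}"
  have "norm (f 0 (of_nat N + 1) - (\<Sum>i\<le>1. f i (of_nat N) * (of_nat N + 1 - of_nat N) ^ i / fact i))
      \<le> (norm (s - 1) * norm s * real N powr (- Re s - 1)) * norm (of_nat N + 1 - of_nat N :: complex) ^ Suc 1 / fact 1"
  proof (rule complex_Taylor)
    show "convex ?S"
      by (intro convex_linear_image) (auto simp: linear_iff scaleR_conv_of_real)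
    show "of_nat N \<in> ?S" by (auto intro!: image_eqI[of _ _ "real N"])
    show "of_nat N + 1 \<in> ?S" by (auto intro!: image_eqI[of _ _ "real N + 1"])
  next
    fix i :: nat and x assume x: "x \<in> ?S" "i \<le> 1"
    then have "x \<notin> \<real>\<^sub>\<le>\<^sub>0" by (auto simp: N_def)
    then have *: "((\<lambda>w. w powr r) has_field_derivative r * x powr (r - 1)) (at x within ?S)" for r
      by (rule has_field_derivative_at_within[OF has_field_derivative_powr])
    consider "i = 0" | "i = 1" using x(2) by linarith
    then show "(f i has_field_derivative f (Suc i) x) (at x within ?S)"
    proof cases
      case 1
      then show ?thesis using *[of "1 - s"] by (simp add: f_def[abs_def])
    next
      case 2
      then show ?thesis using DERIV_cmult[OF *[of "- s"], of "1 - s"] by (simp add: f_def[abs_def] mult.assoc)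
    qed
  next
    fix x assume "x \<in> ?S"
    then obtain r where r: "x = of_real r" "r \<ge> real N" by auto
    have "norm (f (Suc 1) x) = norm (s - 1) * norm s * r powr (- Re s - 1)"
      using r by (simp add: f_def norm_mult norm_powr_real_powr norm_minus_commute[of 1])
    also have "\<dots> \<le> norm (s - 1) * norm s * real N powr (- Re s - 1)"
      using assms r by (intro mult_left_mono powr_mono2') (auto simp: N_def)
    finally show "norm (f (Suc 1) x) \<le> norm (s - 1) * norm s * real N powr (- Re s - 1)" .
  qed
  moreover have "f 0 (of_nat N + 1) - (\<Sum>i\<le>1. f i (of_nat N) * (of_nat N + 1 - of_nat N) ^ i / fact i)
      = zeta_reg_term n s"
  proof -
    have *: "of_nat k powr (1 - s) = of_nat k * npow k s" if "k > 0" for k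
      using powr_add[of "of_nat k :: complex" 1 "- s"] that by simp
    have "f 0 (of_nat N + 1) = of_nat (Suc N) * npow (Suc N) s"
      using *[of "Suc N"] by (simp add: f_def add.commute)
    moreover have "f 0 (of_nat N) = of_nat N * npow N s"
      using *[of N] by (simp add: f_def N_def)
    ultimately show ?thesis
      by (simp add: zeta_reg_term_def N_def) (simp add: f_def left_diff_distrib)
  qed
  ultimately show ?thesis by (simp add: N_def)
qed

definition zeta_reg_term_deriv :: "nat \<Rightarrow> complex \<Rightarrow> complex" where
  "zeta_reg_term_deriv n s = npow (Suc n) s - (s - 1) * (of_real (ln (real (Suc n))) * npow (Suc n) s)
     + of_nat (Suc n) * of_real (ln (real (Suc n))) * npow (Suc n) s
     - of_nat (Suc (Suc n)) * of_real (ln (real (Suc (Suc n)))) * npow (Suc (Suc n)) s"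

lemma zeta_reg_has_derivative:
  assumes "Re s > 0"
  shows "(\<lambda>n. zeta_reg_term n s) sums (zeta_reg s - 1)"
    and "(\<lambda>n. zeta_reg_term_deriv n s) sums deriv zeta_reg s"
    and "zeta_reg field_differentiable at s"
proof -
  have "\<exists>g g'. \<forall>x\<in>{s. 0 < Re s}. ((\<lambda>n. zeta_reg_term n x) sums g x) \<and>
          ((\<lambda>n. zeta_reg_term_deriv n x) sums g' x) \<and> (g has_field_derivative g' x) (at x)"
  proof (rule series_and_derivative_comparison_local)
    show "open {s. 0 < Re s}" by (rule open_halfspace_Re_gt)
  next
    fix n x
    show "(zeta_reg_term n has_field_derivative zeta_reg_term_deriv n x) (at x)"
    proof -
      have *: "((\<lambda>s. (s - 1) * f s - a * f s + b * g s) has_field_derivative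
          (f x + (x - 1) * f' - a * f' + b * g')) (at x)"
        if "(f has_field_derivative f') (at x)" "(g has_field_derivative g') (at x)" for f g f' g' a b
        using that by (auto intro!: derivative_eq_intros)
      show ?thesis
        unfolding zeta_reg_term_def[abs_def]
        by (rule DERIV_cong[OF *[OF npow_has_derivative[of "Suc n" x] npow_has_derivative[of "Suc (Suc n)" x]]])
           (simp only: zeta_reg_term_deriv_def algebra_simps, simp)
    qed
  next
    fix x assume "x \<in> {s. 0 < Re s}"
    then have x: "Re x > 0" by simp
    \<comment> \<open>The radius Re x / 2 keeps Re y >= d on the ball, so that the exponent -d-1
      gives one summable majorant for all y.\<close>
    define d where "d = Re x / 2"
    define K where "K = (norm x + d + 1) * (norm x + d)"
    have d: "d > 0" using x by (simp add: d_def)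
    have "summable (\<lambda>n. K * real (Suc n) powr (- d - 1))"
      using d summable_Suc_iff[of "\<lambda>n. real n powr (- d - 1)"]
      by (intro summable_mult) (simp add: summable_real_powr_iff)
    moreover have "norm (zeta_reg_term n y) \<le> K * real (Suc n) powr (- d - 1)"
      if y: "y \<in> ball x d \<inter> {s. 0 < Re s}" for n y
    proof -
      have "dist x y < d" using y by simp
      have "norm y \<le> norm x + norm (y - x)" using norm_triangle_ineq[of x "y - x"] by simp
      then have ny: "norm y \<le> norm x + d"
        using \<open>dist x y < d\<close> by (simp add: dist_norm norm_minus_commute)
      have "norm (y - 1) \<le> norm y + 1" using norm_triangle_ineq4[of y 1] by simp
      then have ny1: "norm (y - 1) \<le> norm x + d + 1" using ny by simp
      have "\<bar>Re (x - y)\<bar> \<le> norm (x - y)" by (rule abs_Re_le_cmod)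
      then have Re: "Re y \<ge> d" using \<open>dist x y < d\<close> by (simp add: dist_norm d_def)
      have "norm (zeta_reg_term n y) \<le> norm (y - 1) * norm y * real (Suc n) powr (- Re y - 1)"
        using y by (intro norm_zeta_reg_term) auto
      also have "\<dots> \<le> K * real (Suc n) powr (- d - 1)"
        unfolding K_def using ny ny1 Re d
        by (intro mult_mono powr_mono) auto
      finally show ?thesis .
    qed
    ultimately show "\<exists>d h. 0 < d \<and> summable h \<and>
        (\<forall>\<^sub>F n in sequentially. \<forall>y\<in>ball x d \<inter> {s. 0 < Re s}. norm (zeta_reg_term n y) \<le> h n)"
      using d by (intro exI[of _ d] exI[of _ "\<lambda>n. K * real (Suc n) powr (- d - 1)"]) auto
  qed
  then obtain g g' where g: "\<And>x. Re x > 0 \<Longrightarrow> (\<lambda>n. zeta_reg_term n x) sums g x"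
      "\<And>x. Re x > 0 \<Longrightarrow> (\<lambda>n. zeta_reg_term_deriv n x) sums g' x"
      "\<And>x. Re x > 0 \<Longrightarrow> (g has_field_derivative g' x) (at x)"
    by auto
  have eq: "zeta_reg x = 1 + g x" if "Re x > 0" for x
    using sums_unique[OF g(1)[OF that]] by (simp add: zeta_reg_def)
  show "(\<lambda>n. zeta_reg_term n s) sums (zeta_reg s - 1)"
    using g(1)[OF assms] eq[OF assms] by simp
  have "((\<lambda>x. 1 + g x) has_field_derivative g' s) (at s)"
    using DERIV_add[OF DERIV_const g(3)[OF assms], of 1] by simp
  then have *: "(zeta_reg has_field_derivative g' s) (at s)"
    by (rule has_field_derivative_transform_within_open[where S = "{s. 0 < Re s}"])
       (use assms eq in \<open>auto simp: open_halfspace_Re_gt\<close>)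
  then show "zeta_reg field_differentiable at s"
    by (auto simp: field_differentiable_def)
  show "(\<lambda>n. zeta_reg_term_deriv n s) sums deriv zeta_reg s"
    using g(2)[OF assms] DERIV_imp_deriv[OF *] by simp
qed

lemma zeta_reg_holomorphic: "zeta_reg holomorphic_on {s. 0 < Re s}"
  by (rule holomorphic_onI, rule field_differentiable_at_within, rule zeta_reg_has_derivative) simp

lemma zeta_reg_1: "zeta_reg 1 = 1"
  by (simp add: zeta_reg_def zeta_reg_term_def powr_minus del: of_nat_Suc)

lemma zeta_series_sums:
  assumes "Re s > 1"
  shows "(\<lambda>n. npow (Suc n) s) sums zeta_series s"
  using summable_sums[OF summable_norm_cancel[OF summable_npow[OF assms]]]
  by (subst sums_Suc_iff) (simp add: zeta_series_def)

text \<open>The boundary terms of the telescoping sums for \<open>zeta_reg\<close> and its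
  derivative.\<close>

lemma n_ln_npow_tendsto:
  assumes "Re s > 1"
  shows "(\<lambda>n. of_nat n * of_real (ln (real n)) * npow n s) \<longlonglongrightarrow> 0"
    and "(\<lambda>n. of_nat n * npow n s) \<longlonglongrightarrow> 0"
proof -
  have *: "of_nat n * npow n s = 1 / of_nat n powr (s - 1)" for n
    by (cases "n = 0") (auto simp: powr_diff powr_minus field_simps)
  have "(\<lambda>n. 1 / of_nat n powr (s - 1)) \<longlonglongrightarrow> (0 :: complex)"
    using assms by (intro lim_1_over_complex_power) auto
  then show "(\<lambda>n. of_nat n * npow n s) \<longlonglongrightarrow> 0"
    unfolding * .
  have "(\<lambda>n. Ln (of_nat n) / of_nat n powr (s - 1)) \<longlonglongrightarrow> 0"
    using assms by (intro lim_Ln_over_power) auto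
  then show "(\<lambda>n. of_nat n * of_real (ln (real n)) * npow n s) \<longlonglongrightarrow> 0"
  proof (rule Lim_transform_eventually)
    show "\<forall>\<^sub>F n in sequentially. Ln (of_nat n) / of_nat n powr (s - 1)
        = of_nat n * of_real (ln (real n)) * npow n s"
      using eventually_gt_at_top[of 0]
    proof eventually_elim
      case (elim n)
      then show ?case using *[of n] by (simp add: field_simps Ln_of_nat)
    qed
  qed
qed

lemma zeta_reg_eq:
  assumes "Re s > 1"
  shows "zeta_reg s = (s - 1) * zeta_series s"
proof -
  have "(\<lambda>n. (s - 1) * npow (Suc n) s + (of_nat (Suc (Suc n)) * npow (Suc (Suc n)) s - of_nat (Suc n) * npow (Suc n) s))
      sums ((s - 1) * zeta_series s + (0 - of_nat (Suc 0) * npow (Suc 0) s))"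
    by (intro sums_add sums_mult zeta_series_sums assms telescope_sums
         LIMSEQ_Suc[OF n_ln_npow_tendsto(2)])
  then have "(\<lambda>n. zeta_reg_term n s) sums ((s - 1) * zeta_series s - 1)"
    by (simp only: zeta_reg_term_def algebra_simps) (simp add: add.commute)
  moreover have "(\<lambda>n. zeta_reg_term n s) sums (zeta_reg s - 1)"
    using assms by (intro zeta_reg_has_derivative) auto
  ultimately show ?thesis using sums_unique2 by fastforce
qed

text \<open>Stated as a product, because dividing by \<open>zeta_reg\<close> presupposes the
  nonvanishing that is derived from this formula. In the termwise derivative everything telescopes
  except \<open>zeta_series\<close> and the series with coefficients ln n.\<close>

lemma deriv_zeta_reg_eq:
  assumes "Re s > 1"
  shows "deriv zeta_reg s = zeta_reg s * (1 / (s - 1) - mangoldt_series s)"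
proof -
  have "(\<lambda>n. of_real (ln (real (Suc n))) * npow (Suc n) s) sums (mangoldt_series s * zeta_series s)"
    using mangoldt_series_times_zeta_series[OF assms] by (subst sums_Suc_iff) simp
  then have "(\<lambda>n. (npow (Suc n) s - (s - 1) * (of_real (ln (real (Suc n))) * npow (Suc n) s))
       - (of_nat (Suc (Suc n)) * of_real (ln (real (Suc (Suc n)))) * npow (Suc (Suc n)) s
           - of_nat (Suc n) * of_real (ln (real (Suc n))) * npow (Suc n) s))
     sums ((zeta_series s - (s - 1) * (mangoldt_series s * zeta_series s))
        - (0 - of_nat (Suc 0) * of_real (ln (real (Suc 0))) * npow (Suc 0) s))"
    by (intro sums_diff sums_mult zeta_series_sums assms telescope_sums
         LIMSEQ_Suc[OF n_ln_npow_tendsto(1)])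
  then have "(\<lambda>n. zeta_reg_term_deriv n s) sums (zeta_series s - (s - 1) * (mangoldt_series s * zeta_series s))"
    by (simp only: zeta_reg_term_deriv_def algebra_simps) simp
  moreover have "(\<lambda>n. zeta_reg_term_deriv n s) sums deriv zeta_reg s"
    using assms by (intro zeta_reg_has_derivative) auto
  ultimately have "deriv zeta_reg s = zeta_series s - (s - 1) * (mangoldt_series s * zeta_series s)"
    using sums_unique2 by blast
  moreover have "s \<noteq> 1" using assms by auto
  then have "(s - 1) * zeta_series s * (1 / (s - 1)) = zeta_series s" by simp
  ultimately show ?thesis
    by (simp only: zeta_reg_eq[OF assms] right_diff_distrib) (simp add: mult_ac)
qed

section \<open>Logarithmic derivatives and orders of zeros\<close>

text \<open>The limit n is the order of the zero at z, with 0 for a nonzero value: for f = (w-z)^n g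
  with g(z) nonzero, (w-z) f'/f = n + (w-z) g'/g.\<close>

lemma log_deriv_order:
  assumes f: "f holomorphic_on S" "open S" "connected S" and z: "z \<in> S"
    and nc: "\<not> f constant_on S"
  obtains n :: nat where "((\<lambda>w. (w - z) * deriv f w / f w) \<longlongrightarrow> of_nat n) (at z)" "f z = 0 \<Longrightarrow> n > 0"
proof (cases "f z = 0")
  case False
  have "isCont f z" "isCont (deriv f) z"
    using f z holomorphic_deriv[OF f(1,2)]
    by (auto simp: continuous_on_eq_continuous_at dest!: holomorphic_on_imp_continuous_on)
  then have "((\<lambda>w. (w - z) * deriv f w / f w) \<longlongrightarrow> (z - z) * deriv f z / f z) (at z)"
    using False unfolding isCont_def by (intro tendsto_intros)
  then show ?thesis using that[of 0] False by simp
next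
  case True
  obtain g r n where n: "0 < n" "0 < r" "ball z r \<subseteq> S" "g holomorphic_on ball z r"
    and eq: "\<And>w. w \<in> ball z r \<Longrightarrow> f w = (w - z) ^ n * g w"
    and nz: "\<And>w. w \<in> ball z r \<Longrightarrow> g w \<noteq> 0"
    using holomorphic_factor_zero_nonconstant[OF f z True nc] by metis
  have z': "z \<in> ball z r" using n by simp
  have "isCont g z" "isCont (deriv g) z"
    using n(4) z' holomorphic_deriv[OF n(4) open_ball]
    by (auto simp: continuous_on_eq_continuous_at dest!: holomorphic_on_imp_continuous_on)
  then have "((\<lambda>w. of_nat n + (w - z) * deriv g w / g w) \<longlongrightarrow> of_nat n + (z - z) * deriv g z / g z) (at z)"
    using nz[OF z'] unfolding isCont_def by (intro tendsto_intros)
  then have "((\<lambda>w. of_nat n + (w - z) * deriv g w / g w) \<longlongrightarrow> of_nat n) (at z)" by simp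
  then have "((\<lambda>w. (w - z) * deriv f w / f w) \<longlongrightarrow> of_nat n) (at z)"
  proof (rule Lim_transform_eventually)
    have "eventually (\<lambda>w. w \<in> ball z r - {z}) (at z)"
      using n by (intro eventually_at_in_open) auto
    then show "\<forall>\<^sub>F w in at z. of_nat n + (w - z) * deriv g w / g w = (w - z) * deriv f w / f w"
    proof eventually_elim
      case (elim w)
      then have w: "w \<in> ball z r" "w \<noteq> z" by auto
      have "(g has_field_derivative deriv g w) (at w)"
        using n(4) w by (auto intro: holomorphic_derivI)
      then have "((\<lambda>w. (w - z) ^ n * g w) has_field_derivative
          (of_nat n * (w - z) ^ (n - 1) * g w + (w - z) ^ n * deriv g w)) (at w)"
        by (auto intro!: derivative_eq_intros)
      then have "(f has_field_derivative (of_nat n * (w - z) ^ (n - 1) * g w + (w - z) ^ n * deriv g w)) (at w)"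
        by (rule has_field_derivative_transform_within_open[OF _ open_ball w(1)]) (simp add: eq)
      then have df: "deriv f w = of_nat n * (w - z) ^ (n - 1) * g w + (w - z) ^ n * deriv g w"
        by (rule DERIV_imp_deriv)
      define u where "u = w - z"
      obtain m where m: "n = Suc m" using n(1) gr0_implies_Suc by blast
      have "u \<noteq> 0" using w by (simp add: u_def)
      then show ?case
        using nz[OF w(1)] unfolding df eq[OF w(1)] u_def[symmetric] m
        by (simp add: field_simps del: of_nat_Suc)
    qed
  qed
  then show ?thesis using that n(1) by blast
qed

text \<open>The limit is taken along the horizontal ray to the right of z, where for Re z >= 1 the
  Dirichlet series are available.\<close>

lemma zeta_reg_log_deriv_order:
  assumes "Re z > 0"
  obtains n :: nat where
    "((\<lambda>h. of_real h * deriv zeta_reg (z + of_real h) / zeta_reg (z + of_real h)) \<longlongrightarrow> of_nat n) (at_right 0)"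
    "zeta_reg z = 0 \<Longrightarrow> n > 0"
proof -
  let ?S = "{s. 0 < Re s}"
  have lim: "((\<lambda>h. z + of_real h) \<longlongrightarrow> z) (at_right 0)"
    by (rule tendsto_eq_intros | simp)+
  have fl: "filterlim (\<lambda>h. z + of_real h) (at z) (at_right 0)"
    by (rule filterlim_atI[OF lim]) (auto simp: eventually_at_right_less eventually_at intro: exI[of _ 1])
  show ?thesis
  proof (cases "zeta_reg constant_on ?S")
    \<comment> \<open>A constant \<open>zeta_reg\<close> would equal its value 1 at the point 1, and
      the order 0 serves.\<close>
    case True
    then have eq: "zeta_reg s = 1" if "Re s > 0" for s
      using zeta_reg_1 that unfolding constant_on_def by (metis mem_Collect_eq one_complex.sel(1) zero_less_one)
    have "deriv zeta_reg s = 0" if "Re s > 0" for s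
    proof -
      have "(zeta_reg has_field_derivative 0) (at s)"
        by (rule has_field_derivative_transform_within_open[of "\<lambda>_. 1" 0 s ?S])
           (use eq that in \<open>auto simp: open_halfspace_Re_gt\<close>)
      then show ?thesis by (rule DERIV_imp_deriv)
    qed
    then have "\<forall>\<^sub>F h in at_right 0. of_real h * deriv zeta_reg (z + of_real h) / zeta_reg (z + of_real h) = 0"
      using assms by (auto simp: eventually_at intro!: exI[of _ 1])
    then have "((\<lambda>h. of_real h * deriv zeta_reg (z + of_real h) / zeta_reg (z + of_real h)) \<longlongrightarrow> of_nat 0) (at_right 0)"
      by (simp add: tendsto_eventually)
    then show ?thesis using that[of 0] eq[OF assms] by auto
  next
    case False
    obtain n :: nat where n: "((\<lambda>w. (w - z) * deriv zeta_reg w / zeta_reg w) \<longlongrightarrow> of_nat n) (at z)"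
        "zeta_reg z = 0 \<Longrightarrow> n > 0"
      by (rule log_deriv_order[OF zeta_reg_holomorphic _ _ _ False, of z])
         (use assms in \<open>auto simp: open_halfspace_Re_gt convex_connected convex_halfspace_Re_gt\<close>)
    then show ?thesis
      using that[of n] filterlim_compose[OF n(1) fl] by simp
  qed
qed

section \<open>Nonvanishing for Re s >= 1\<close>

lemma norm_mangoldt_series_le:
  assumes "1 < x" "x \<le> Re s"
  shows "norm (mangoldt_series s) \<le> (\<Sum>n. mangoldt n * real n powr (- x))"
proof -
  have *: "summable (\<lambda>n. mangoldt n * real n powr (- x))"
    using summable_mangoldt_npow[of "of_real x"] assms by (simp add: norm_mult norm_npow del: powr_minus)
  have "norm (\<Sum>n. mangoldt n * npow n s) \<le> (\<Sum>n. mangoldt n * real n powr (- x))"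
  proof (rule norm_suminf_le[OF _ *])
    fix n
    show "norm (mangoldt n * npow n s) \<le> mangoldt n * real n powr (- x)"
    proof (cases "n = 0")
      case False
      then have "real n powr (- Re s) \<le> real n powr (- x)"
        using assms by (intro powr_mono) auto
      then show ?thesis by (simp only: norm_mult norm_mangoldt norm_npow mult_left_mono mangoldt_nonneg)
    qed simp
  qed
  then show ?thesis by (simp add: mangoldt_series_def)
qed

text \<open>At a zero of f = \<open>zeta_reg\<close>, h f'/f tends to a positive order as h -> 0+;
  but by \<open>deriv_zeta_reg_eq\<close> f'/f is 1/(s-1) minus a Dirichlet series, and both are
  bounded to the right of z.\<close>

lemma zeta_reg_nonzero_Re_gt_1:
  assumes "Re z > 1"
  shows "zeta_reg z \<noteq> 0"
proof
  assume 0: "zeta_reg z = 0"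
  obtain n :: nat where
    n: "((\<lambda>h. of_real h * deriv zeta_reg (z + of_real h) / zeta_reg (z + of_real h)) \<longlongrightarrow> of_nat n) (at_right 0)"
    "n > 0"
    using zeta_reg_log_deriv_order[of z] assms 0 by auto
  define C where "C = 1 / (Re z - 1) + (\<Sum>n. mangoldt n * real n powr (- Re z))"
  have "0 \<le> (\<Sum>n. mangoldt n * real n powr (- Re z))"
    using assms norm_mangoldt_series_le[of "Re z" z] norm_ge_zero[of "mangoldt_series z"] by linarith
  then have C: "C \<ge> 0" unfolding C_def
    using assms by (intro add_nonneg_nonneg) auto
  have "norm (of_real h * deriv zeta_reg (z + of_real h) / zeta_reg (z + of_real h)) \<le> h * C"
    if h: "h > 0" for h
  \<comment> \<open>Where \<open>zeta_reg\<close> vanishes, division by 0 makes the quotient 0, so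
    the bound holds there as well.\<close>
  proof (cases "zeta_reg (z + of_real h) = 0")
    case False
    have "of_real h * deriv zeta_reg (z + of_real h) / zeta_reg (z + of_real h) =
        of_real h * (1 / (z + of_real h - 1) - mangoldt_series (z + of_real h))"
      using False assms h by (subst deriv_zeta_reg_eq) auto
    also have "norm \<dots> = h * norm (1 / (z + of_real h - 1) - mangoldt_series (z + of_real h))"
      using h by (simp add: norm_mult)
    also have "\<dots> \<le> h * (norm (1 / (z + of_real h - 1)) + norm (mangoldt_series (z + of_real h)))"
      using h by (intro mult_left_mono norm_triangle_ineq4) auto
    also have "\<dots> \<le> h * C"
    proof -
      have "Re z - 1 \<le> norm (z + of_real h - 1)"
        using complex_Re_le_cmod[of "z + of_real h - 1"] h by simp
      then have "norm (1 / (z + of_real h - 1)) \<le> 1 / (Re z - 1)"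
        using assms by (simp add: norm_divide frac_le)
      moreover have "norm (mangoldt_series (z + of_real h)) \<le> (\<Sum>n. mangoldt n * real n powr (- Re z))"
        using assms h by (intro norm_mangoldt_series_le) auto
      ultimately show ?thesis using h unfolding C_def by (intro mult_left_mono add_mono) auto
    qed
    finally show ?thesis .
  qed (use C h in auto)
  then have "\<forall>\<^sub>F h in at_right 0. norm (of_real h * deriv zeta_reg (z + of_real h) / zeta_reg (z + of_real h)) \<le> h * C"
    by (auto simp: eventually_at intro!: exI[of _ 1])
  moreover have "((\<lambda>h. h * C) \<longlongrightarrow> 0) (at_right 0)"
    by (rule tendsto_eq_intros | simp)+
  ultimately have "((\<lambda>h. of_real h * deriv zeta_reg (z + of_real h) / zeta_reg (z + of_real h)) \<longlongrightarrow> 0) (at_right 0)"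
    by (rule Lim_null_comparison)
  then have "of_nat n = (0 :: complex)"
    using n(1) tendsto_unique[OF _ n(1)] by (simp add: trivial_limit_at_right_real)
  then show False using n(2) by simp
qed

lemma Re_npow: "n > 0 \<Longrightarrow> Re (npow n (Complex x t)) = real n powr (- x) * cos (t * ln (real n))"
  by (simp only: npow_eq_exp Re_exp) (simp add: powr_def)

text \<open>Termwise 3 + 4 cos a + cos 2a = 2 (1 + cos a)^2 with a = t ln n, and the coefficients
  \<open>mangoldt n\<close> are nonnegative.\<close>

lemma mangoldt_series_341:
  assumes x: "x > 1"
  shows "3 * Re (mangoldt_series (of_real x)) + 4 * Re (mangoldt_series (Complex x t))
    + Re (mangoldt_series (Complex x (2 * t))) \<ge> 0"
proof -
  have s: "(\<lambda>n. Re (mangoldt n * npow n s)) sums Re (mangoldt_series s)" if "Re s > 1" for s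
    using summable_sums[OF summable_norm_cancel[OF summable_mangoldt_npow[OF that]]]
    by (intro sums_Re) (simp only: mangoldt_series_def)
  have "(\<lambda>n. 3 * Re (mangoldt n * npow n (of_real x)) + 4 * Re (mangoldt n * npow n (Complex x t))
      + Re (mangoldt n * npow n (Complex x (2 * t)))) sums
    (3 * Re (mangoldt_series (of_real x)) + 4 * Re (mangoldt_series (Complex x t))
    + Re (mangoldt_series (Complex x (2 * t))))"
    using x by (intro sums_add sums_mult s) auto
  moreover have "0 \<le> 3 * Re (mangoldt n * npow n (of_real x)) + 4 * Re (mangoldt n * npow n (Complex x t))
      + Re (mangoldt n * npow n (Complex x (2 * t)))" for n
  proof (cases "n = 0")
    case False
    define c where "c = cos (t * ln (real n))"
    have c2: "cos (2 * t * ln (real n)) = 2 * c\<^sup>2 - 1"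
      using cos_double_cos[of "t * ln (real n)"] by (simp add: c_def mult.assoc)
    have x0: "of_real x = Complex x 0" by (simp add: complex_eq_iff)
    have "3 * Re (mangoldt n * npow n (of_real x)) + 4 * Re (mangoldt n * npow n (Complex x t))
      + Re (mangoldt n * npow n (Complex x (2 * t)))
      = mangoldt n * real n powr (- x) * (3 + 4 * c + (2 * c\<^sup>2 - 1))"
      using False by (simp only: x0 times_complex.sel Re_mangoldt Im_mangoldt Re_npow c2 c_def[symmetric])
        (simp add: algebra_simps)
    also have "3 + 4 * c + (2 * c\<^sup>2 - 1) = 2 * (1 + c)\<^sup>2"
      by (simp add: power2_eq_square algebra_simps)
    finally show ?thesis using mangoldt_nonneg[of n] by simp
  qed simp
  ultimately show ?thesis by (rule sums_le[OF _ sums_zero, rotated])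
qed

lemma mangoldt_series_eq:
  assumes "Re s > 1"
  shows "mangoldt_series s = 1 / (s - 1) - deriv zeta_reg s / zeta_reg s"
  using deriv_zeta_reg_eq[OF assms] zeta_reg_nonzero_Re_gt_1[OF assms] by (simp add: field_simps)

text \<open>Mertens' argument: take the 3-4-1 inequality at real part 1 + h and multiply by h. As h
  -> 0+ its parts tend to 3 (1 - n1), -4 n2 and -n3, with n1, n2, n3 the orders of zeros at 1, 1+it,
  1+2it. A zero at 1+it means n2 >= 1 and a total of at most -1.\<close>

lemma zeta_reg_nonzero:
  assumes "Re z \<ge> 1"
  shows "zeta_reg z \<noteq> 0"
proof (cases "Re z = 1 \<and> Im z \<noteq> 0")
  case False
  then have "z = 1 \<or> Re z > 1" using assms by (auto simp: complex_eq_iff)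
  then show ?thesis using zeta_reg_1 zeta_reg_nonzero_Re_gt_1 by auto
next
  case True
  define t where "t = Im z"
  have t: "t \<noteq> 0" and z: "z = Complex 1 t" using True by (auto simp: t_def complex_eq_iff)
  show ?thesis
  proof
    assume 0: "zeta_reg z = 0"
    define F where "F s h = of_real h * deriv zeta_reg (s + of_real h) / zeta_reg (s + of_real h)" for s h
    obtain n1 :: nat where n1: "(F 1 \<longlongrightarrow> of_nat n1) (at_right 0)"
      using zeta_reg_log_deriv_order[of 1] unfolding F_def by auto
    obtain n2 :: nat where n2: "(F z \<longlongrightarrow> of_nat n2) (at_right 0)" "n2 > 0"
      using zeta_reg_log_deriv_order[of z] 0 True unfolding F_def by auto
    obtain n3 :: nat where n3: "(F (Complex 1 (2 * t)) \<longlongrightarrow> of_nat n3) (at_right 0)"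
      using zeta_reg_log_deriv_order[of "Complex 1 (2 * t)"] unfolding F_def by auto
    have lim0: "((\<lambda>h. of_real h / (Complex 0 c + of_real h)) \<longlongrightarrow> 0) (at_right 0)" if "c \<noteq> 0" for c
    proof -
      have "((\<lambda>h. of_real h / (Complex 0 c + of_real h)) \<longlongrightarrow> of_real 0 / (Complex 0 c + of_real 0)) (at_right 0)"
        by (intro tendsto_intros) (use that in \<open>auto simp: complex_eq_iff\<close>)
      then show ?thesis by simp
    qed
    \<comment> \<open>The explicit quotients are h / (s-1) at s = 1 + h + ic: the pole contributes 1
      for c = 0 and nothing in the limit otherwise.\<close>
    define G where "G h = 3 * Re (1 - F 1 h) + 4 * Re (of_real h / (Complex 0 t + of_real h) - F z h)
       + Re (of_real h / (Complex 0 (2 * t) + of_real h) - F (Complex 1 (2 * t)) h)" for h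
    have "(G \<longlongrightarrow> 3 * Re (1 - of_nat n1) + 4 * Re (0 - of_nat n2) + Re (0 - of_nat n3)) (at_right 0)"
      unfolding G_def using t by (intro tendsto_intros n1 n2 n3 lim0) auto
    moreover have "\<forall>\<^sub>F h in at_right 0. G h \<ge> 0"
    proof -
      have "G h \<ge> 0" if h: "h > 0" for h
      proof -
        have L: "of_real h / (Complex 0 c + of_real h) - F (Complex 1 c) h
            = of_real h * mangoldt_series (Complex (1 + h) c)" for c
        proof -
          have "Complex (1 + h) c = Complex 1 c + of_real h" by (simp add: complex_eq_iff)
          moreover have "Complex 1 c + of_real h - 1 = Complex 0 c + of_real h" by (simp add: complex_eq_iff)
          ultimately show ?thesis
            using h by (simp add: mangoldt_series_eq F_def right_diff_distrib)
        qed
        have c0: "Complex 0 0 = 0" "Complex 1 0 = 1" "Complex (1 + h) 0 = of_real (1 + h)"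
          by (simp_all add: complex_eq_iff)
        have L0: "1 - F 1 h = of_real h * mangoldt_series (of_real (1 + h))"
          using L[of 0] h unfolding c0 by simp
        have "G h = h * (3 * Re (mangoldt_series (of_real (1 + h))) + 4 * Re (mangoldt_series (Complex (1 + h) t))
            + Re (mangoldt_series (Complex (1 + h) (2 * t))))"
          unfolding G_def L0 L z by (simp add: algebra_simps)
        then show ?thesis using mangoldt_series_341[of "1 + h" t] h by simp
      qed
      then show ?thesis by (auto simp: eventually_at intro!: exI[of _ 1])
    qed
    ultimately have "3 * Re (1 - of_nat n1) + 4 * Re (0 - of_nat n2) + Re (0 - of_nat n3) \<ge> 0"
      by (rule tendsto_lowerbound) (simp add: trivial_limit_at_right_real)
    then show False using n2(2) by simp
  qed
qed

section \<open>Prime powers in short intervals\<close>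

text \<open>The Fourier transform of the triangular weight 1 - |t|/T on [-T, T], folded onto [0, T];
  the value at 0 is the continuous extension.\<close>

definition fejer :: "real \<Rightarrow> real \<Rightarrow> real" where
  "fejer T u = (if u = 0 then T else 2 * (1 - cos (T * u)) / (T * u\<^sup>2))"

lemma fejer_weight:
  fixes t :: real
  assumes "T > 0" "t \<in> {0..T}"
  shows "0 \<le> 2 * (1 - t / T)" "2 * (1 - t / T) \<le> 2"
  using assms by (auto simp: field_simps)

lemma fejer_has_integral:
  assumes "T > 0"
  shows "((\<lambda>t. 2 * (1 - t / T) * cos (t * u)) has_integral fejer T u) {0..T}"
proof (cases "u = 0")
  case True
  have "((\<lambda>t. 2 * (1 - t / T)) has_integral (2 * (T - T\<^sup>2 / (2 * T)) - 2 * (0 - 0\<^sup>2 / (2 * T)))) {0..T}"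
    using assms
    by (intro fundamental_theorem_of_calculus)
       (auto intro!: derivative_eq_intros simp flip: has_real_derivative_iff_has_vector_derivative simp: field_simps)
  then show ?thesis using True assms by (simp add: fejer_def power2_eq_square field_simps)
next
  case False
  define G where "G t = 2 * ((1 - t / T) * sin (t * u) / u - cos (t * u) / (T * u\<^sup>2))" for t
  have "((\<lambda>t. 2 * (1 - t / T) * cos (t * u)) has_integral (G T - G 0)) {0..T}"
    using assms False unfolding G_def
    by (intro fundamental_theorem_of_calculus)
       (auto intro!: derivative_eq_intros simp flip: has_real_derivative_iff_has_vector_derivative
         simp: field_simps power2_eq_square)
  moreover have "G T - G 0 = fejer T u"
    using False assms by (simp add: G_def fejer_def field_simps)
  ultimately show ?thesis by simp
qed

lemma fejer_nonneg: "T > 0 \<Longrightarrow> fejer T u \<ge> 0"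
  by (simp add: fejer_def)

lemma fejer_le:
  fixes T u :: real
  assumes "T > 0" "u \<noteq> 0"
  shows "fejer T u \<le> 4 / (T * u\<^sup>2)"
proof -
  define c where "c = cos (T * u)"
  have "- 1 \<le> c" by (simp add: c_def)
  then have "2 * (1 - cos (T * u)) \<le> 4" unfolding c_def[symmetric] by simp
  then show ?thesis using assms by (auto simp only: fejer_def if_False intro!: divide_right_mono) simp
qed

lemma fejer_le':
  fixes T u :: real
  assumes "T > 0"
  shows "fejer T u \<le> T"
proof (cases "u = 0")
  case False
  have "1 - cos (T * u) = 2 * (sin (T * u / 2))\<^sup>2"
    using cos_double_sin[of "T * u / 2"] by simp
  also have "\<dots> \<le> 2 * (T * u / 2)\<^sup>2"
    by (intro mult_left_mono iffD1[OF abs_le_square_iff] abs_sin_x_le_abs_x) simp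
  finally have "2 * (1 - cos (T * u)) \<le> T * (T * u\<^sup>2)"
    by (simp add: power2_eq_square field_simps)
  then show ?thesis using False assms by (simp add: fejer_def pos_divide_le_eq)
qed (simp add: fejer_def)

text \<open>For |u| <= 1/T every phase satisfies |t u| <= 1 <= pi/3, so the cosine stays at least
  1/2 and at least half of the value T at u = 0 survives.\<close>

lemma fejer_ge:
  assumes "T > 0" "\<bar>u\<bar> \<le> 1 / T"
  shows "fejer T u \<ge> T / 2"
proof -
  have "((\<lambda>t. 2 * (1 - t / T) * (1 / 2)) has_integral fejer T 0 * (1 / 2)) {0..T}"
    using has_integral_mult_left[OF fejer_has_integral[OF assms(1), of 0], of "1 / 2"] by simp
  then have "fejer T 0 * (1 / 2) \<le> fejer T u"
  proof (rule has_integral_le[OF _ fejer_has_integral[OF assms(1)]])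
    fix t assume t: "t \<in> {0..T}"
    have "\<bar>t * u\<bar> \<le> T * (1 / T)"
      unfolding abs_mult using t assms by (intro mult_mono) auto
    then have "\<bar>t * u\<bar> \<le> 1" using assms by simp
    also have "1 \<le> pi / 3" using pi_gt3 by simp
    finally have "cos (pi / 3) \<le> cos \<bar>t * u\<bar>" by (intro cos_monotone_0_pi_le) auto
    then have "1 / 2 \<le> cos (t * u)" by (simp add: cos_60)
    then show "2 * (1 - t / T) * (1 / 2) \<le> 2 * (1 - t / T) * cos (t * u)"
      using fejer_weight[OF assms(1) t] by (intro mult_left_mono)
  qed
  then show ?thesis by (simp add: fejer_def)
qed

text \<open>Sum and integral are interchanged by uniform convergence. This turns a sum smoothed
  around ln n = y into an integral of its Dirichlet series over 0 <= t <= T on the line Re s = x,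
  where y survives only as the frequency of \<open>cis (y * t)\<close>.\<close>

lemma fejer_transform:
  fixes a :: "nat \<Rightarrow> real"
  assumes T: "T > 0" and a: "summable (\<lambda>n. norm (a n * real n powr (- x)))"
    and D: "\<And>t. (\<lambda>n. of_real (a n) * npow n (Complex x t)) sums D t"
  shows "summable (\<lambda>n. a n * real n powr (- x) * fejer T (ln (real n) - y))"
    and "((\<lambda>t. 2 * (1 - t / T) * Re (cis (y * t) * D t)) has_integral
      (\<Sum>n. a n * real n powr (- x) * fejer T (ln (real n) - y))) {0..T}"
proof -
  define b where "b n = a n * real n powr (- x)" for n
  have *: "(\<lambda>n. b n * (2 * (1 - t / T) * cos (t * (ln (real n) - y)))) sums
      (2 * (1 - t / T) * Re (cis (y * t) * D t))" for t
  proof -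
    have "(\<lambda>n. 2 * (1 - t / T) * Re (cis (y * t) * (of_real (a n) * npow n (Complex x t)))) sums
      (2 * (1 - t / T) * Re (cis (y * t) * D t))"
      by (intro sums_mult sums_Re D)
    moreover have "Re (cis (y * t) * (of_real (a n) * npow n (Complex x t))) = b n * cos (t * (ln (real n) - y))" for n
    proof (cases "n = 0")
      case False
      have "npow n (Complex x t) = of_real (real n powr (- x)) * cis (- t * ln (real n))"
        using False by (simp only: npow_eq_exp) (simp add: complex_eq_iff Re_exp Im_exp powr_def)
      then have "cis (y * t) * (of_real (a n) * npow n (Complex x t)) = of_real (b n) * cis (t * y - t * ln (real n))"
        by (simp add: b_def cis_mult[symmetric] cis_divide[symmetric] cis_inverse divide_inverse mult_ac)
      then show ?thesis
        using cos_minus[of "t * (ln (real n) - y)"] by (simp add: right_diff_distrib)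
    qed (simp add: b_def)
    ultimately have "(\<lambda>n. 2 * (1 - t / T) * (b n * cos (t * (ln (real n) - y)))) sums
      (2 * (1 - t / T) * Re (cis (y * t) * D t))"
      by (simp only:)
    then show ?thesis by (simp only: mult.left_commute)
  qed
  have ul: "uniform_limit {0..T} (\<lambda>N t. \<Sum>n<N. b n * (2 * (1 - t / T) * cos (t * (ln (real n) - y))))
      (\<lambda>t. \<Sum>n. b n * (2 * (1 - t / T) * cos (t * (ln (real n) - y)))) sequentially"
  proof (rule Weierstrass_m_test)
    fix n t assume t: "t \<in> {0..T}"
    have "\<bar>2 * (1 - t / T)\<bar> * \<bar>cos (t * (ln (real n) - y))\<bar> \<le> 2 * 1"
      using fejer_weight[OF T t] by (intro mult_mono abs_cos_le_one) linarith+
    then have "\<bar>2 * (1 - t / T) * cos (t * (ln (real n) - y))\<bar> \<le> 2"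
      by (simp only: abs_mult)
    then show "norm (b n * (2 * (1 - t / T) * cos (t * (ln (real n) - y)))) \<le> norm (b n) * 2"
      unfolding norm_mult[of "b n"] by (intro mult_left_mono) auto
  next
    show "summable (\<lambda>n. norm (b n) * 2)" using a unfolding b_def by (rule summable_mult2)
  qed
  have int: "((\<lambda>t. \<Sum>n<N. b n * (2 * (1 - t / T) * cos (t * (ln (real n) - y)))) has_integral
     (\<Sum>n<N. b n * fejer T (ln (real n) - y))) {0..T}" for N
    by (intro has_integral_sum has_integral_mult_right fejer_has_integral T) auto
  obtain I J where I: "\<And>N. ((\<lambda>t. \<Sum>n<N. b n * (2 * (1 - t / T) * cos (t * (ln (real n) - y)))) has_integral I N) {0..T}"
    and J: "((\<lambda>t. \<Sum>n. b n * (2 * (1 - t / T) * cos (t * (ln (real n) - y)))) has_integral J) {0..T}"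
    and IJ: "I \<longlonglongrightarrow> J"
    by (rule uniform_limit_integral[OF ul]) (use T in \<open>auto intro!: continuous_intros\<close>)
  have "I = (\<lambda>N. \<Sum>n<N. b n * fejer T (ln (real n) - y))"
    using has_integral_unique[OF I int] by blast
  then have s: "(\<lambda>n. b n * fejer T (ln (real n) - y)) sums J"
    using IJ by (simp add: sums_def)
  show "summable (\<lambda>n. a n * real n powr (- x) * fejer T (ln (real n) - y))"
    using s unfolding b_def by (rule sums_summable)
  show "((\<lambda>t. 2 * (1 - t / T) * Re (cis (y * t) * D t)) has_integral
      (\<Sum>n. a n * real n powr (- x) * fejer T (ln (real n) - y))) {0..T}"
    using J sums_unique[OF s] sums_unique[OF *] by (simp add: b_def)
qed

text \<open>The poles of \<open>mangoldt_series\<close> and of the zeta function at \<open>1\<close> cancel.\<close>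

lemma mangoldt_minus_zeta_extends:
  obtains W H where "open W" "{s. Re s \<ge> 1} \<subseteq> W" "H holomorphic_on W"
    "\<forall>s. Re s > 1 \<longrightarrow> H s = mangoldt_series s - zeta_series s"
proof
  define W where "W = {s. 0 < Re s} \<inter> {s. zeta_reg s \<noteq> 0}"
  define H where "H s = - (deriv zeta_reg s / zeta_reg s)
      - (if s = 1 then deriv zeta_reg 1 else (zeta_reg s - zeta_reg 1) / (s - 1))" for s
  have "W = {s. 0 < Re s} \<inter> zeta_reg -` (- {0})" by (auto simp: W_def)
  moreover have "open \<dots>"
    using holomorphic_on_imp_continuous_on[OF zeta_reg_holomorphic]
    by (rule continuous_open_preimage) (auto simp: open_halfspace_Re_gt)
  ultimately show "open W" by simp
  show "{s. Re s \<ge> 1} \<subseteq> W" using zeta_reg_nonzero by (auto simp: W_def)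
  have W: "W \<subseteq> {s. 0 < Re s}" by (auto simp: W_def)
  have z: "zeta_reg holomorphic_on W" using zeta_reg_holomorphic W by (rule holomorphic_on_subset)
  show "H holomorphic_on W"
    unfolding H_def
    by (intro holomorphic_intros pole_lemma_open z holomorphic_deriv[OF z] \<open>open W\<close>) (auto simp: W_def)
  show "\<forall>s. Re s > 1 \<longrightarrow> H s = mangoldt_series s - zeta_series s"
  proof (intro allI impI)
    fix s :: complex assume s: "Re s > 1"
    have "s \<noteq> 1" using s by auto
    then have "zeta_series s = zeta_reg s / (s - 1)" using zeta_reg_eq[OF s] by simp
    then show "H s = mangoldt_series s - zeta_series s"
      using \<open>s \<noteq> 1\<close> mangoldt_series_eq[OF s] by (simp add: H_def zeta_reg_1 diff_divide_distrib)
  qed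
qed

section \<open>Decay of the smoothed difference of the two series\<close>

text \<open>A quantitative Riemann-Lebesgue estimate. The bound involves x only through
  \<open>B\<close>, so that x can later approach 1.\<close>

lemma oscillatory_integral_bound:
  assumes T: "T > 0" and y: "y > 0"
    and H: "\<And>t. t \<in> {0..T} \<Longrightarrow> (H has_field_derivative H' (Complex x t)) (at (Complex x t))"
    and cont: "continuous_on {0..T} (\<lambda>t. H (Complex x t))" "continuous_on {0..T} (\<lambda>t. H' (Complex x t))"
    and B: "\<And>t. t \<in> {0..T} \<Longrightarrow> norm (H (Complex x t)) \<le> B" "\<And>t. t \<in> {0..T} \<Longrightarrow> norm (H' (Complex x t)) \<le> B"
    and int: "((\<lambda>t. 2 * (1 - t / T) * Re (cis (y * t) * H (Complex x t))) has_integral I) {0..T}"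
  shows "\<bar>I\<bar> \<le> (4 + 2 * T) * B / y"
proof -
  have B0: "B \<ge> 0" using order.trans[OF norm_ge_zero B(1)[of 0]] T by simp
  define c where "c t = complex_of_real (2 * (1 - t / T))" for t
  \<comment> \<open>Integration by parts: the derivative of \<open>G\<close> is the integrand plus
    \<open>R\<close>, and both \<open>G\<close> and \<open>R\<close> carry a factor 1/y. At T the
    weight and hence \<open>G\<close> vanish.\<close>
  define G where "G t = cis (y * t) * (c t * H (Complex x t)) / (\<i> * of_real y)" for t
  define R where "R t = cis (y * t) * (- of_real (2 / T) * H (Complex x t) + c t * \<i> * H' (Complex x t)) / (\<i> * of_real y)" for t
  have G': "(G has_vector_derivative (cis (y * t) * (c t * H (Complex x t)) + R t)) (at t within {0..T})"
    if t: "t \<in> {0..T}" for t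
  proof -
    have 1: "((\<lambda>t. Complex x t) has_vector_derivative \<i>) (at t within {0..T})"
    proof -
      have "Complex x = (\<lambda>t. of_real x + \<i> * of_real t)" by (auto simp: complex_eq_iff)
      moreover have "((\<lambda>t. of_real x + \<i> * of_real t) has_vector_derivative (0 + \<i> * of_real 1)) (at t within {0..T})"
        by (intro derivative_intros)
      ultimately show ?thesis by simp
    qed
    have 2: "((\<lambda>t. H (Complex x t)) has_vector_derivative (\<i> * H' (Complex x t))) (at t within {0..T})"
      using field_vector_diff_chain_within[OF 1 has_field_derivative_at_within[OF H[OF t]]]
      by (simp add: o_def)
    have 3: "(c has_vector_derivative (- of_real (2 / T))) (at t within {0..T})"
    proof -
      have "((\<lambda>t. 2 * (1 - t / T)) has_real_derivative (- (2 / T))) (at t within {0..T})"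
        using T by (auto intro!: derivative_eq_intros)
      from has_vector_derivative_of_real[OF this] show ?thesis by (simp only: c_def[abs_def] of_real_minus)
    qed
    have 4: "((\<lambda>t. cis (y * t)) has_vector_derivative (\<i> * of_real y * cis (y * t))) (at t within {0..T})"
    proof -
      have "((\<lambda>z. exp (\<i> * of_real y * z)) has_field_derivative (\<i> * of_real y * exp (\<i> * of_real y * of_real t))) (at (of_real t))"
        by (auto intro!: derivative_eq_intros)
      from has_vector_derivative_real_field[OF this] show ?thesis
        by (simp add: cis_conv_exp mult_ac)
    qed
    have "((\<lambda>t. cis (y * t) * (c t * H (Complex x t))) has_vector_derivative
       (cis (y * t) * (c t * (\<i> * H' (Complex x t)) + (- of_real (2 / T)) * H (Complex x t)) +
       \<i> * of_real y * cis (y * t) * (c t * H (Complex x t)))) (at t within {0..T})"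
      by (rule has_vector_derivative_mult[OF 4 has_vector_derivative_mult[OF 3 2]])
    from has_vector_derivative_mult_left[OF this, of "1 / (\<i> * of_real y)"]
    have "(G has_vector_derivative ((cis (y * t) * (c t * (\<i> * H' (Complex x t)) + (- of_real (2 / T)) * H (Complex x t)) +
       \<i> * of_real y * cis (y * t) * (c t * H (Complex x t))) * (1 / (\<i> * of_real y)))) (at t within {0..T})"
      by (simp only: G_def[abs_def] times_divide_eq_right mult_1_right)
    moreover have "(C * (c1 + c2) + \<i> * of_real y * C * e) * (1 / (\<i> * of_real y)) =
        C * e + C * (c2 + c1) / (\<i> * of_real y)" for C c1 c2 e :: complex
      using y by (simp add: field_simps)
    note this[of "cis (y * t)" "c t * (\<i> * H' (Complex x t))" "(- of_real (2 / T)) * H (Complex x t)" "c t * H (Complex x t)"]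
    ultimately show ?thesis
      unfolding R_def by (simp only: mult.assoc[of "c t"])
  qed
  have FTC: "((\<lambda>t. cis (y * t) * (c t * H (Complex x t)) + R t) has_integral (G T - G 0)) {0..T}"
    using T by (intro fundamental_theorem_of_calculus G') auto
  have "R integrable_on {0..T}"
    unfolding R_def c_def using y T by (intro integrable_continuous_real continuous_intros cont) auto
  then have intR: "(R has_integral integral {0..T} R) {0..T}" by (rule integrable_integral)
  have "norm (R t) \<le> (2 / T * B + 2 * B) / y" if t: "t \<in> {0..T}" for t
  proof -
    have nc: "norm (c t) \<le> 2" using fejer_weight[OF T t] unfolding c_def norm_of_real by linarith
    have "norm (- of_real (2 / T) * H (Complex x t) + c t * \<i> * H' (Complex x t)) \<le> 2 / T * B + 2 * B"
    proof (rule norm_triangle_mono)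
      show "norm (- of_real (2 / T) * H (Complex x t)) \<le> 2 / T * B"
        unfolding norm_mult using T B(1)[OF t] by (simp add: norm_divide divide_right_mono)
      show "norm (c t * \<i> * H' (Complex x t)) \<le> 2 * B"
        unfolding norm_mult using mult_mono[OF nc B(2)[OF t]] by simp
    qed
    then show ?thesis using y by (simp add: R_def norm_mult norm_divide divide_right_mono)
  qed
  then have nR: "norm (integral {0..T} R) \<le> (2 / T * B + 2 * B) / y * T"
    using has_integral_bound[of "(2 / T * B + 2 * B) / y" R _ 0 T] intR T y B0 by simp
  have "((\<lambda>t. Re (cis (y * t) * (c t * H (Complex x t)) + R t - R t)) has_integral
      Re (G T - G 0 - integral {0..T} R)) {0..T}"
    by (rule has_integral_Re[OF has_integral_diff[OF FTC intR]])
  then have "((\<lambda>t. Re (cis (y * t) * (c t * H (Complex x t)))) has_integral Re (G T - G 0 - integral {0..T} R)) {0..T}"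
    by (simp only: add_diff_cancel_right')
  moreover have "Re (cis (y * t) * (c t * H (Complex x t))) = 2 * (1 - t / T) * Re (cis (y * t) * H (Complex x t))" for t
  proof -
    have "Re (z * (of_real r * w)) = r * Re (z * w)" for r z w by (simp add: algebra_simps)
    then show ?thesis unfolding c_def .
  qed
  ultimately have "I = Re (G T - G 0 - integral {0..T} R)"
    using int by (simp add: has_integral_unique)
  also have "\<bar>\<dots>\<bar> \<le> norm (G T - G 0 - integral {0..T} R)" by (rule abs_Re_le_cmod)
  also have "\<dots> \<le> norm (G T) + norm (G 0) + norm (integral {0..T} R)"
    using norm_triangle_ineq4[of "G T - G 0" "integral {0..T} R"] norm_triangle_ineq4[of "G T" "G 0"] by linarith
  also have "G T = 0" using T by (simp add: G_def c_def)
  also have "norm (G 0) \<le> 2 * B / y"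
    using B(1)[of 0] T y by (simp add: G_def c_def norm_mult norm_divide divide_right_mono)
  also note nR
  finally have "\<bar>I\<bar> \<le> 2 * B / y + (2 / T * B + 2 * B) / y * T" by simp
  also have "(2 / T * B + 2 * B) / y * T = (2 * B + 2 * B * T) / y" using T y by (simp add: field_simps)
  also have "2 * B / y + (2 * B + 2 * B * T) / y = (4 + 2 * T) * B / y"
    unfolding add_divide_distrib[symmetric] by (rule arg_cong[where f = "\<lambda>x. x / y"]) (simp add: algebra_simps)
  finally show ?thesis .
qed

lemma summable_norm_mangoldt_powr:
  assumes "x > 1"
  shows "summable (\<lambda>n. norm (mangoldt n * real n powr (- x)))"
  using summable_mangoldt_npow[of "of_real x"] assms
  by (simp add: norm_mult norm_npow abs_mult mangoldt_nonneg del: powr_minus)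

lemma mangoldt_series_sums:
  assumes "Re s > 1"
  shows "(\<lambda>n. of_real (mangoldt n) * npow n s) sums mangoldt_series s"
  using summable_sums[OF summable_norm_cancel[OF summable_mangoldt_npow[OF assms]]]
  by (simp only: mangoldt_series_def of_real_mangoldt)

lemma zeta_series_sums_of_real:
  assumes "Re s > 1"
  shows "(\<lambda>n. of_real 1 * npow n s) sums zeta_series s"
  using summable_sums[OF summable_norm_cancel[OF summable_npow[OF assms]]]
  by (simp add: zeta_series_def)

lemma summable_mangoldt_fejer:
  assumes "T > 0" "x > 1"
  shows "summable (\<lambda>n. mangoldt n * real n powr (- x) * fejer T (ln (real n) - y))"
  using assms
  by (intro fejer_transform(1)[where D = "\<lambda>t. mangoldt_series (Complex x t)"]
        summable_norm_mangoldt_powr mangoldt_series_sums) auto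

lemma summable_powr_fejer:
  assumes "T > 0" "x > 1"
  shows "summable (\<lambda>n. real n powr (- x) * fejer T (ln (real n) - y))"
proof -
  have "summable (\<lambda>n. 1 * real n powr (- x) * fejer T (ln (real n) - y))"
    using assms by (intro fejer_transform(1)[where D = "\<lambda>t. zeta_series (Complex x t)"] zeta_series_sums_of_real)
      (auto simp: summable_real_powr_iff)
  then show ?thesis by simp
qed

text \<open>\<open>M\<close> depends on \<open>T\<close> only. Uniformity down to x = 1 comes from
  the compact rectangle \<open>K\<close>, whose left edge lies on Re s = 1: there the difference of
  the two series extends holomorphically because \<open>zeta_reg\<close> has no zero.\<close>

lemma mangoldt_fejer_bound:
  assumes T: "T > 0"
  shows "\<exists>M\<ge>0. \<forall>x y. 1 < x \<longrightarrow> x \<le> 2 \<longrightarrow> y > 0 \<longrightarrow>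
    \<bar>(\<Sum>n. mangoldt n * real n powr (- x) * fejer T (ln (real n) - y))
     - (\<Sum>n. real n powr (- x) * fejer T (ln (real n) - y))\<bar> \<le> M / y"
proof -
  obtain W H where W: "open W" "{s. Re s \<ge> 1} \<subseteq> W" "H holomorphic_on W"
    and H': "\<forall>s. Re s > 1 \<longrightarrow> H s = mangoldt_series s - zeta_series s"
    by (rule mangoldt_minus_zeta_extends)
  note H = H'[rule_format]
  define K where "K = cbox (Complex 1 0) (Complex 2 T)"
  have K: "K \<subseteq> W" using W(2) by (auto simp: K_def in_cbox_complex_iff)
  have dW: "deriv H holomorphic_on W" by (rule holomorphic_deriv[OF W(3,1)])
  have cont: "continuous_on K H" "continuous_on K (deriv H)"
    using holomorphic_on_imp_continuous_on[OF W(3)] holomorphic_on_imp_continuous_on[OF dW] K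
    by (auto intro: continuous_on_subset)
  have "bounded (H ` K)" "bounded (deriv H ` K)"
    using cont by (auto intro!: compact_imp_bounded compact_continuous_image simp: K_def)
  then obtain B1 B2 where B12: "\<And>s. s \<in> K \<Longrightarrow> norm (H s) \<le> B1" "\<And>s. s \<in> K \<Longrightarrow> norm (deriv H s) \<le> B2"
    by (auto simp: bounded_iff)
  define B where "B = max 0 (max B1 B2)"
  have B: "norm (H s) \<le> B" "norm (deriv H s) \<le> B" if "s \<in> K" for s
    using B12[OF that] by (auto simp: B_def)
  note sM = summable_norm_mangoldt_powr
  have s1: "summable (\<lambda>n. norm (1 * real n powr (- x)))" if "x > 1" for x
    using that by (simp add: summable_real_powr_iff)
  have sM1: "summable (\<lambda>n. norm ((mangoldt n - 1) * real n powr (- x)))" if "x > 1" for x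
    by (rule summable_comparison_test'[OF summable_add[OF sM[OF that] s1[OF that]], of 0])
       (auto simp: left_diff_distrib abs_mult intro!: order.trans[OF abs_triangle_ineq4])
  have LM1: "(\<lambda>n. of_real (mangoldt n - 1) * npow n s) sums H s" if "Re s > 1" for s
    using sums_diff[OF mangoldt_series_sums[OF that] zeta_series_sums_of_real[OF that]] H[OF that] by (simp only: of_real_diff left_diff_distrib)
  show ?thesis
  proof (intro exI[of _ "(4 + 2 * T) * B"] conjI allI impI)
    show "(4 + 2 * T) * B \<ge> 0" using T by (simp add: B_def)
    fix x y :: real assume x: "1 < x" "x \<le> 2" and y: "0 < y"
    have inK: "Complex x t \<in> K" if "t \<in> {0..T}" for t
      using that x by (auto simp: K_def in_cbox_complex_iff)
    have cC: "continuous_on {0..T} (Complex x)"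
    proof -
      have "Complex x = (\<lambda>t. of_real x + \<i> * of_real t)" by (auto simp: complex_eq_iff)
      moreover have "continuous_on {0..T} (\<lambda>t. of_real x + \<i> * of_real t)" by (intro continuous_intros)
      ultimately show ?thesis by simp
    qed
    have "\<bar>(\<Sum>n. (mangoldt n - 1) * real n powr (- x) * fejer T (ln (real n) - y))\<bar> \<le> (4 + 2 * T) * B / y"
    proof (rule oscillatory_integral_bound[OF T y, where H = H and H' = "deriv H" and x = x])
      show "((\<lambda>t. 2 * (1 - t / T) * Re (cis (y * t) * H (Complex x t))) has_integral
         (\<Sum>n. (mangoldt n - 1) * real n powr (- x) * fejer T (ln (real n) - y))) {0..T}"
        using x by (intro fejer_transform(2)[where D = "\<lambda>t. H (Complex x t)"] T sM1 LM1) auto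
      show "continuous_on {0..T} (\<lambda>t. H (Complex x t))"
        by (rule continuous_on_compose2[OF cont(1) cC]) (use inK in auto)
      show "continuous_on {0..T} (\<lambda>t. deriv H (Complex x t))"
        by (rule continuous_on_compose2[OF cont(2) cC]) (use inK in auto)
      fix t assume t: "t \<in> {0..T}"
      show "(H has_field_derivative deriv H (Complex x t)) (at (Complex x t))"
        using W(1,3) inK[OF t] K by (auto intro: holomorphic_derivI)
      show "norm (H (Complex x t)) \<le> B" "norm (deriv H (Complex x t)) \<le> B"
        using B[OF inK[OF t]] by auto
    qed
    also have "(\<Sum>n. (mangoldt n - 1) * real n powr (- x) * fejer T (ln (real n) - y)) =
        (\<Sum>n. mangoldt n * real n powr (- x) * fejer T (ln (real n) - y))
     - (\<Sum>n. real n powr (- x) * fejer T (ln (real n) - y))"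
      using suminf_diff[OF summable_mangoldt_fejer[OF T x(1)] summable_powr_fejer[OF T x(1)], of y y] by (simp add: left_diff_distrib)
    finally show "\<bar>(\<Sum>n. mangoldt n * real n powr (- x) * fejer T (ln (real n) - y))
     - (\<Sum>n. real n powr (- x) * fejer T (ln (real n) - y))\<bar> \<le> (4 + 2 * T) * B / y" .
  qed
qed

section \<open>Total mass and tails of the kernel\<close>

text \<open>The majorant is a multiple of the derivative of \<open>arctan\<close>, so that sums over
  n can telescope. At u^2 = 4 the bounds 1 and 4/u^2 both equal 5/(1+u^2), which fixes the constant
  5.\<close>

lemma fejer_1_le: "fejer 1 u \<le> 5 / (1 + u\<^sup>2)"
proof (cases "u\<^sup>2 \<le> 4")
  case True
  have "fejer 1 u \<le> 1" using fejer_le'[of 1 u] by simp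
  also have "1 \<le> 5 / (1 + u\<^sup>2)" using True by (simp add: pos_le_divide_eq add_pos_nonneg)
  finally show ?thesis .
next
  case False
  then have "u \<noteq> 0" by auto
  then have "fejer 1 u \<le> 4 / u\<^sup>2" using fejer_le[of 1 u] by simp
  also have "\<dots> \<le> 5 / (1 + u\<^sup>2)" using False \<open>u \<noteq> 0\<close> by (simp add: divide_simps add_pos_nonneg)
  finally show ?thesis .
qed

text \<open>The step from ln n to ln (n+1) is at least 1/(2n) and at most 1, and moving by at most 1
  increases 1 + u^2 by a factor of at most 3; whence 6.\<close>

lemma arctan_increment:
  assumes "n > (0 :: nat)"
  shows "1 / (real n * (1 + (ln (real n) - y)\<^sup>2)) \<le> 6 * (arctan (ln (real (Suc n)) - y) - arctan (ln (real n) - y))"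
proof -
  define u where "u = ln (real n) - y"
  define v where "v = ln (real (Suc n)) - y"
  have "1 + 1 / real n = real (Suc n) / real n" using assms by (simp add: field_simps)
  then have vu: "v - u = ln (1 + 1 / real n)"
    using assms ln_div[of "real (Suc n)" "real n"] by (simp add: u_def v_def)
  have "1 / (2 * real n) \<le> 1 / (real n + 1)" using assms by (intro divide_left_mono) auto
  also have "\<dots> \<le> ln (1 + 1 / real n)"
    using ln_add_one_self_le_self2[of "- (1 / (real n + 1))"] assms ln_inverse[of "1 + 1 / real n"]
    by (simp add: field_simps)
  finally have d1: "1 / (2 * real n) \<le> v - u" using vu by simp
  have d0: "0 < v - u" using d1 assms by (intro less_le_trans[OF _ d1]) auto
  have "ln (1 + 1 / real n) \<le> 1 / real n" using assms by (intro ln_add_one_self_le_self) auto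
  also have "\<dots> \<le> 1" using assms by simp
  finally have d2: "v - u \<le> 1" using vu by simp
  obtain \<xi> where \<xi>: "u < \<xi>" "\<xi> < v" "arctan v - arctan u = (v - u) * (1 / (1 + \<xi>\<^sup>2))"
    using MVT2[of u v arctan "\<lambda>x. 1 / (1 + x\<^sup>2)"] d0 DERIV_arctan by (auto simp: inverse_eq_divide)
  have "1 + \<xi>\<^sup>2 \<le> 3 * (1 + u\<^sup>2)"
  proof -
    have "\<bar>\<xi>\<bar> \<le> \<bar>u\<bar> + 1" using \<xi> d2 by linarith
    then have "\<xi>\<^sup>2 \<le> (\<bar>u\<bar> + 1)\<^sup>2" by (metis abs_ge_zero power2_abs power_mono)
    also have "(\<bar>u\<bar> + 1)\<^sup>2 = u\<^sup>2 + 2 * \<bar>u\<bar> + 1" by (simp add: power2_sum)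
    also have "2 * \<bar>u\<bar> \<le> u\<^sup>2 + 1"
      using zero_le_power2[of "\<bar>u\<bar> - 1"] by (simp add: power2_diff)
    finally have "\<xi>\<^sup>2 \<le> 2 * u\<^sup>2 + 2" by simp
    moreover have "0 \<le> u\<^sup>2" by simp
    ultimately show ?thesis by (simp only: distrib_left)
  qed
  then have "1 / (3 * (1 + u\<^sup>2)) \<le> 1 / (1 + \<xi>\<^sup>2)"
    by (intro divide_left_mono) (auto intro!: mult_pos_pos add_pos_nonneg)
  then have "1 / (2 * real n) * (1 / (3 * (1 + u\<^sup>2))) \<le> (v - u) * (1 / (1 + \<xi>\<^sup>2))"
    using d1 d0 by (intro mult_mono) (auto intro!: divide_nonneg_nonneg add_nonneg_nonneg)
  then have "6 * (1 / (2 * real n) * (1 / (3 * (1 + u\<^sup>2)))) \<le> 6 * (arctan v - arctan u)"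
    unfolding \<xi>(3) by (rule mult_left_mono) simp
  moreover have "6 * (1 / (2 * a) * (1 / (3 * w))) = 1 / (a * w)" for a w :: real by simp
  ultimately show ?thesis by (simp only: u_def v_def)
qed

text \<open>Uniform in x and y: 30 = 5 * 6 from the two preceding estimates, and pi is the length of
  the range of \<open>arctan\<close>.\<close>

lemma sum_fejer_bound:
  assumes x: "x > 1"
  shows "(\<Sum>n. real n powr (- x) * fejer 1 (ln (real n) - y)) \<le> 30 * pi"
proof -
  show ?thesis
  proof (rule suminf_le_const[OF summable_powr_fejer[OF zero_less_one x]])
    fix N :: nat
    have *: "(\<Sum>n<Suc N. real n powr (- x) * fejer 1 (ln (real n) - y)) \<le> 30 * (arctan (ln (real (Suc N)) - y) + pi / 2)"
      for N
    proof (induction N)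
      case 0
      then show ?case using arctan_lbound[of "- y"] by simp
    next
      case (Suc N)
      let ?u = "ln (real (Suc N)) - y"
      have "real (Suc N) powr (- x) \<le> real (Suc N) powr (- 1)"
        using x by (intro powr_mono) auto
      then have "real (Suc N) powr (- x) \<le> 1 / real (Suc N)" by (simp add: powr_minus_divide)
      then have "real (Suc N) powr (- x) * fejer 1 ?u \<le> 1 / real (Suc N) * (5 / (1 + ?u\<^sup>2))"
        by (intro mult_mono fejer_1_le fejer_nonneg) auto
      also have "\<dots> = 5 * (1 / (real (Suc N) * (1 + ?u\<^sup>2)))" by simp
      also have "\<dots> \<le> 5 * (6 * (arctan (ln (real (Suc (Suc N))) - y) - arctan ?u))"
        by (intro mult_left_mono arctan_increment) auto
      finally show ?case using Suc.IH by (simp add: sum.lessThan_Suc[of _ "Suc N"] algebra_simps del: of_nat_Suc sum.lessThan_Suc)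
    qed
    show "(\<Sum>n<N. real n powr (- x) * fejer 1 (ln (real n) - y)) \<le> 30 * pi"
    proof (cases N)
      case (Suc m)
      have "30 * (arctan (ln (real (Suc m)) - y) + pi / 2) \<le> 30 * pi"
        using arctan_ubound[of "ln (real (Suc m)) - y"] by simp
      then show ?thesis using *[of m] Suc by simp
    qed simp
  qed
qed

text \<open>The zeros of \<open>fejer 1\<close> and of its translate by \<open>pi\<close> are disjoint.\<close>

lemma fejer_le_shifts:
  fixes T u \<eta> :: real
  assumes T: "T > 0" and \<eta>: "\<eta> > 0" and u: "\<bar>u\<bar> \<ge> \<eta>"
  shows "fejer T u \<le> (1 + pi / \<eta>)\<^sup>2 / T * (fejer 1 u + fejer 1 (u - pi))"
proof -
  \<comment> \<open>\<open>K\<close> is chosen so that (u - pi)^2 <= K u^2 for |u| >=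
    \<open>\<eta>\<close>. The lower bounds of the two kernels then share the denominator K u^2, and
    their numerators 2 (1 - cos u) and 2 (1 + cos u) add up to 4.\<close>
  define K where "K = (1 + pi / \<eta>)\<^sup>2"
  have u0: "u \<noteq> 0" "u\<^sup>2 > 0" using u \<eta> by auto
  have K1: "K \<ge> 1" unfolding K_def using \<eta> by (intro one_le_power) auto
  have "2 * (1 - cos u) / (u\<^sup>2 * K) \<le> 2 * (1 - cos u) / u\<^sup>2"
    using K1 u0 by (intro divide_left_mono) auto
  then have 1: "2 * (1 - cos u) / (u\<^sup>2 * K) \<le> fejer 1 u" using u0 by (simp add: fejer_def)
  have 2: "2 * (1 + cos u) / (u\<^sup>2 * K) \<le> fejer 1 (u - pi)"
  proof (cases "u = pi")
    case False
    have "\<bar>u - pi\<bar> \<le> \<bar>u\<bar> + pi" using pi_gt_zero by linarith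
    also have "pi \<le> \<bar>u\<bar> * (pi / \<eta>)"
      using mult_right_mono[OF u, of "pi / \<eta>"] \<eta> by simp
    finally have "\<bar>u - pi\<bar> \<le> \<bar>u\<bar> * (1 + pi / \<eta>)" by (simp add: algebra_simps)
    then have "\<bar>u - pi\<bar>\<^sup>2 \<le> (\<bar>u\<bar> * (1 + pi / \<eta>))\<^sup>2" by (intro power_mono) auto
    then have "(u - pi)\<^sup>2 \<le> u\<^sup>2 * K" by (simp add: K_def power_mult_distrib)
    moreover have "1 + cos u \<ge> 0" using cos_ge_minus_one[of u] by linarith
    ultimately have "2 * (1 + cos u) / (u\<^sup>2 * K) \<le> 2 * (1 + cos u) / (u - pi)\<^sup>2"
      using False u0 K1 by (intro divide_left_mono) auto
    then show ?thesis using False by (simp add: fejer_def cos_diff)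
  qed (simp add: fejer_def)
  have "4 / (u\<^sup>2 * K) = 2 * (1 - cos u) / (u\<^sup>2 * K) + 2 * (1 + cos u) / (u\<^sup>2 * K)"
    by (simp flip: add_divide_distrib)
  with 1 2 have "4 / (u\<^sup>2 * K) \<le> fejer 1 u + fejer 1 (u - pi)" by simp
  then have "K / T * (4 / (u\<^sup>2 * K)) \<le> K / T * (fejer 1 u + fejer 1 (u - pi))"
    using K1 T by (intro mult_left_mono) auto
  moreover have "K / T * (4 / (u\<^sup>2 * K)) = 4 / (T * u\<^sup>2)" using K1 by simp
  ultimately show ?thesis using fejer_le[OF T u0(1)] by (simp add: K_def)
qed

section \<open>Mass at the centre against mass in the tails\<close>

lemma card_nat_between: "real (card {nat \<lceil>a\<rceil>..nat \<lfloor>b\<rfloor>}) \<ge> b - a - 1" if "a > 0"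
  using that by (simp add: of_nat_diff) linarith

text \<open>Counting the integers in the window and bounding each term by the smallest gives 1 - exp
  (-2/T) up to a rounding loss of at most exp (-y); T >= 2 makes the former at least 1/T.\<close>

lemma inverse_sum_ge:
  assumes T: "T \<ge> 2"
  defines "I \<equiv> \<lambda>y. {nat \<lceil>exp (y - 1 / T)\<rceil>..nat \<lfloor>exp (y + 1 / T)\<rfloor>}"
  shows "(\<Sum>n\<in>I y. 1 / real n) \<ge> 1 / T - exp (- y)"
    and "n \<in> I y \<Longrightarrow> n > 0 \<and> \<bar>ln (real n) - y\<bar> \<le> 1 / T"
proof -
  have I: "n > 0" "real n \<le> exp (y + 1 / T)" "exp (y - 1 / T) \<le> real n" if "n \<in> I y" for n
  proof -
    have "exp (y - 1 / T) > 0" by simp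
    moreover show "exp (y - 1 / T) \<le> real n" "real n \<le> exp (y + 1 / T)"
      using that unfolding I_def by (auto simp: nat_le_iff le_nat_iff le_floor_iff ceiling_le_iff)
    ultimately show "n > 0" by linarith
  qed
  show "n > 0 \<and> \<bar>ln (real n) - y\<bar> \<le> 1 / T" if "n \<in> I y" for n
  proof -
    have "ln (real n) \<le> y + 1 / T" using ln_mono[OF I(2)[OF that]] I(1)[OF that] by simp
    moreover have "y - 1 / T \<le> ln (real n)" using I(1,3)[OF that] by (simp add: ln_ge_iff)
    ultimately show ?thesis using I(1)[OF that] by auto
  qed
  have "1 / T - exp (- y) \<le> (exp (y + 1 / T) - exp (y - 1 / T) - 1) * exp (- (y + 1 / T))"
  proof -
    have "(exp (y + 1 / T) - exp (y - 1 / T) - 1) * exp (- (y + 1 / T)) = 1 - exp (- (2 / T)) - exp (- (y + 1 / T))"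
      by (simp add: left_diff_distrib flip: exp_add)
    moreover have "exp (- (y + 1 / T)) \<le> exp (- y)" using T by simp
    moreover have "exp (- (2 / T)) \<le> 1 - 1 / T"
    proof -
      have "1 + 2 / T \<le> exp (2 / T)" by (rule exp_ge_add_one_self)
      then have "exp (- (2 / T)) \<le> 1 / (1 + 2 / T)"
        using T unfolding exp_minus inverse_eq_divide
        by (intro divide_left_mono mult_pos_pos add_pos_nonneg) auto
      also have "\<dots> \<le> 1 - 1 / T" using T by (simp add: field_simps)
      finally show ?thesis .
    qed
    ultimately show ?thesis by linarith
  qed
  also have "\<dots> \<le> real (card (I y)) * exp (- (y + 1 / T))"
    unfolding I_def by (intro mult_right_mono card_nat_between) auto
  also have "\<dots> = (\<Sum>n\<in>I y. exp (- (y + 1 / T)))" by simp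
  also have "\<dots> \<le> (\<Sum>n\<in>I y. 1 / real n)"
  proof (rule sum_mono)
    fix n assume "n \<in> I y"
    then show "exp (- (y + 1 / T)) \<le> 1 / real n"
      using I[of n] by (simp only: exp_minus inverse_eq_divide) (intro divide_left_mono, auto)
  qed
  finally show "(\<Sum>n\<in>I y. 1 / real n) \<ge> 1 / T - exp (- y)" .
qed

text \<open>Without a prime power within \<open>\<eta>\<close> of y on the logarithmic scale, only
  the tails of the kernel of height T act on \<open>mangoldt\<close>; they weigh O(1/T), since the
  kernels of height 1 have bounded mass. The constant coefficients keep a mass of nearly 1/2 or more
  at the centre, yet \<open>mangoldt_fejer_bound\<close> equates the two masses up to M/y.\<close>

lemma primepow_near_exp:
  fixes \<eta> :: real
  assumes \<eta>: "\<eta> > 0"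
  shows "\<exists>Y. \<forall>y\<ge>Y. \<exists>n. primepow n \<and> \<bar>ln (real n) - y\<bar> < \<eta>"
proof -
  define S where "S T x y = (\<Sum>n. mangoldt n * real n powr (- x) * fejer T (ln (real n) - y))" for T x y
  define S1 where "S1 T x y = (\<Sum>n. real n powr (- x) * fejer T (ln (real n) - y))" for T x y
  obtain M1 where "M1 \<ge> 0 \<and> (\<forall>x y. 1 < x \<longrightarrow> x \<le> 2 \<longrightarrow> y > 0 \<longrightarrow> \<bar>S 1 x y - S1 1 x y\<bar> \<le> M1 / y)"
    unfolding S_def S1_def using mangoldt_fejer_bound[OF zero_less_one] ..
  then have M1: "M1 \<ge> 0" "\<And>x y. 1 < x \<Longrightarrow> x \<le> 2 \<Longrightarrow> y > 0 \<Longrightarrow> \<bar>S 1 x y - S1 1 x y\<bar> \<le> M1 / y"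
    by auto
  note sum1 = summable_mangoldt_fejer[OF zero_less_one]
  \<comment> \<open>The factor 2 accounts for the two kernels centred at y and y + pi.\<close>
  define B where "B = 2 * (30 * pi + M1)"
  have SB: "S 1 x y \<le> 30 * pi + M1" if "1 < x" "x \<le> 2" "y \<ge> 1" for x y
  proof -
    have "M1 / y \<le> M1 / 1" using that M1(1) by (intro divide_left_mono) auto
    then show ?thesis
      using M1(2)[of x y] that sum_fejer_bound[of x y] by (simp add: S1_def[symmetric])
  qed
  define K where "K = (1 + pi / \<eta>)\<^sup>2"
  \<comment> \<open>Makes the tails weigh at most 1/8; the maximum with 2 is for
    \<open>inverse_sum_ge\<close>.\<close>
  define T where "T = max 2 (8 * K * B)"
  have T2: "T \<ge> 2" "T > 0" by (auto simp: T_def)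
  have KBT: "K * B / T \<le> 1 / 8" using T2 by (simp add: pos_divide_le_eq) (simp add: T_def)
  obtain M where "M \<ge> 0 \<and> (\<forall>x y. 1 < x \<longrightarrow> x \<le> 2 \<longrightarrow> y > 0 \<longrightarrow> \<bar>S T x y - S1 T x y\<bar> \<le> M / y)"
    unfolding S_def S1_def using mangoldt_fejer_bound[OF T2(2)] ..
  then have M: "M \<ge> 0" "\<And>x y. 1 < x \<Longrightarrow> x \<le> 2 \<Longrightarrow> y > 0 \<Longrightarrow> \<bar>S T x y - S1 T x y\<bar> \<le> M / y"
    by auto
  note sumT = summable_mangoldt_fejer[OF T2(2)]
  note sumT1 = summable_powr_fejer[OF T2(2)]
  show ?thesis
  \<comment> \<open>The thresholds give y >= 1, M/y <= 1/16 and T exp (-y) / 2 <= 1/16, so that a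
    central mass of at least 7/16 faces a bound of 3/16.\<close>
  proof (intro exI[of _ "Max {1, 16 * M, 8 * T}"] allI impI, rule ccontr)
    fix y assume "Max {1, 16 * M, 8 * T} \<le> y" and no: "\<not> (\<exists>n. primepow n \<and> \<bar>ln (real n) - y\<bar> < \<eta>)"
    then have y: "y \<ge> 1" "16 * M \<le> y" "8 * T \<le> y" by auto
    have STB: "S T x y \<le> 1 / 8" if x: "1 < x" "x \<le> 2" for x
    proof -
      have "S T x y \<le> (\<Sum>n. K / T * (mangoldt n * real n powr (- x) * fejer 1 (ln (real n) - y)
          + mangoldt n * real n powr (- x) * fejer 1 (ln (real n) - (y + pi))))"
        unfolding S_def
      proof (rule suminf_le)
        fix n
        show "mangoldt n * real n powr (- x) * fejer T (ln (real n) - y) \<le>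
          K / T * (mangoldt n * real n powr (- x) * fejer 1 (ln (real n) - y)
          + mangoldt n * real n powr (- x) * fejer 1 (ln (real n) - (y + pi)))"
        proof (cases "primepow n")
          case True
          then have "\<bar>ln (real n) - y\<bar> \<ge> \<eta>" using no by force
          then have "fejer T (ln (real n) - y) \<le> K / T * (fejer 1 (ln (real n) - y) + fejer 1 (ln (real n) - y - pi))"
            unfolding K_def by (intro fejer_le_shifts T2 \<eta>)
          then have "mangoldt n * real n powr (- x) * fejer T (ln (real n) - y) \<le>
            mangoldt n * real n powr (- x) * (K / T * (fejer 1 (ln (real n) - y) + fejer 1 (ln (real n) - y - pi)))"
            by (intro mult_left_mono mult_nonneg_nonneg mangoldt_nonneg) auto
          then show ?thesis by (simp add: algebra_simps)
        qed (simp add: mangoldt_def)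
      qed (use x in \<open>auto intro!: sumT summable_mult summable_add sum1\<close>)
      also have "\<dots> = K / T * (S 1 x y + S 1 x (y + pi))"
        unfolding S_def suminf_add[OF sum1[OF x(1)] sum1[OF x(1)]]
        by (rule suminf_mult[OF summable_add[OF sum1[OF x(1)] sum1[OF x(1)]]])
      also have "\<dots> \<le> K / T * B"
        using SB[OF x, of y] SB[OF x, of "y + pi"] y T2 pi_gt_zero
        by (intro mult_left_mono) (auto simp: B_def K_def)
      also have "\<dots> \<le> 1 / 8" using KBT by simp
      finally show ?thesis .
    qed
    define I where "I = {nat \<lceil>exp (y - 1 / T)\<rceil>..nat \<lfloor>exp (y + 1 / T)\<rfloor>}"
    note I = inverse_sum_ge[OF T2(1), where y = y, folded I_def]
    have "T / 2 * (\<Sum>n\<in>I. real n powr (- x)) \<le> 1 / 8 + M / y" if x: "1 < x" "x \<le> 2" for x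
    proof -
      have "T / 2 * (\<Sum>n\<in>I. real n powr (- x)) = (\<Sum>n\<in>I. real n powr (- x) * (T / 2))"
        by (simp add: sum_distrib_left mult.commute)
      also have "\<dots> \<le> (\<Sum>n\<in>I. real n powr (- x) * fejer T (ln (real n) - y))"
        using I(2) T2 by (intro sum_mono mult_left_mono fejer_ge) auto
      also have "\<dots> \<le> S1 T x y"
        unfolding S1_def using T2 by (intro sum_le_suminf sumT1 x) (auto simp: I_def intro!: mult_nonneg_nonneg fejer_nonneg)
      also have "\<dots> \<le> 1 / 8 + M / y" using M(2)[of x y] STB[OF x] x y by auto
      finally show ?thesis .
    qed
    \<comment> \<open>Only a finite sum is left on the left-hand side, so x can tend to 1.\<close>
    then have "\<forall>\<^sub>F x in at_right 1. T / 2 * (\<Sum>n\<in>I. real n powr (- x)) \<le> 1 / 8 + M / y"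
      by (auto simp: eventually_at dist_real_def intro!: exI[of _ 1])
    moreover have "((\<lambda>x. T / 2 * (\<Sum>n\<in>I. real n powr (- x))) \<longlongrightarrow> T / 2 * (\<Sum>n\<in>I. real n powr (- 1))) (at_right 1)"
      using I(2) by (intro tendsto_intros) auto
    ultimately have "T / 2 * (\<Sum>n\<in>I. real n powr (- 1)) \<le> 1 / 8 + M / y"
      by (intro tendsto_upperbound[where F = "at_right (1::real)"]) (auto simp: trivial_limit_at_right_real)
    also have "(\<Sum>n\<in>I. real n powr (- 1)) = (\<Sum>n\<in>I. 1 / real n)"
      by (intro sum.cong) (auto simp: powr_minus_divide)
    also have "M / y \<le> 1 / 16" using y by (simp add: pos_divide_le_eq)
    finally have *: "T / 2 * (\<Sum>n\<in>I. 1 / real n) \<le> 3 / 16" by simp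
    have "T / 2 * (1 / T - exp (- y)) \<le> T / 2 * (\<Sum>n\<in>I. 1 / real n)"
      using I(1) T2 by (intro mult_left_mono) auto
    moreover have "exp (- y) \<le> 1 / y"
      unfolding exp_minus inverse_eq_divide
      using y exp_ge_add_one_self[of y] by (intro divide_left_mono mult_pos_pos) linarith+
    then have "T / 2 * exp (- y) \<le> T / 2 * (1 / y)" using T2 by (intro mult_left_mono) auto
    moreover have "T / 2 * (1 / y) \<le> 1 / 16" using y by (simp add: pos_divide_le_eq)
    ultimately show False using * T2 by (simp add: right_diff_distrib)
  qed
qed

theorem primepow_between:
  fixes \<epsilon> :: real
  assumes "\<epsilon> > 0"
  shows "\<exists>X. \<forall>x\<ge>X. \<exists>q. primepow q \<and> x < real q \<and> real q \<le> (1 + \<epsilon>) * x"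
proof -
  define \<eta> where "\<eta> = ln (1 + \<epsilon>) / 2"
  have \<eta>: "\<eta> > 0" using assms by (simp add: \<eta>_def)
  obtain Y where Y: "\<And>y. y \<ge> Y \<Longrightarrow> \<exists>n. primepow n \<and> \<bar>ln (real n) - y\<bar> < \<eta>"
    using primepow_near_exp[OF \<eta>] by blast
  show ?thesis
  proof (intro exI[of _ "max 1 (exp Y)"] allI impI)
    fix x assume x: "max 1 (exp Y) \<le> x"
    then have "ln x \<ge> Y" by (simp add: ln_ge_iff)
    then obtain n where n: "primepow n" "\<bar>ln (real n) - (ln x + \<eta>)\<bar> < \<eta>" using Y[of "ln x + \<eta>"] \<eta> by auto
    have n0: "real n > 0" using n(1) primepow_gt_0_nat by simp
    have "ln x < ln (real n)" "ln (real n) < ln x + 2 * \<eta>" using n(2) by linarith+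
    moreover have "ln x + 2 * \<eta> = ln ((1 + \<epsilon>) * x)" using assms x by (simp add: \<eta>_def ln_mult)
    ultimately have "x < real n" "real n < (1 + \<epsilon>) * x"
      using n0 x assms by (simp_all add: ln_less_cancel_iff)
    then show "\<exists>q. primepow q \<and> x < real q \<and> real q \<le> (1 + \<epsilon>) * x" using n(1) by force
  qed
qed

section \<open>The Frankl--Wilson bound for ternary vectors\<close>

definition tern :: "nat \<Rightarrow> nat \<Rightarrow> (nat \<Rightarrow> int) set" where
  "tern m b = {v \<in> {..<m} \<rightarrow>\<^sub>E {-1, 0, 1}. card {i \<in> {..<m}. v i \<noteq> 0} = b}"

definition agree :: "nat \<Rightarrow> (nat \<Rightarrow> int) \<Rightarrow> (nat \<Rightarrow> int) \<Rightarrow> nat" where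
  "agree m v w = card {i \<in> {..<m}. v i = w i \<and> v i \<noteq> 0}"

lemma finite_tern: "finite (tern m b)"
  unfolding tern_def by (rule finite_subset[of _ "{..<m} \<rightarrow>\<^sub>E {-1, 0, 1}"]) (auto intro: finite_PiE)

lemma tern_mem: "v \<in> tern m b \<Longrightarrow> i < m \<Longrightarrow> v i \<in> {-1, 0, 1}"
  unfolding tern_def using PiE_mem[of v "{..<m}" "\<lambda>_. {-1, 0, 1}" i] by simp

lemma tern_outside: "v \<in> tern m b \<Longrightarrow> \<not> i < m \<Longrightarrow> v i = undefined"
  unfolding tern_def using PiE_arb[of v "{..<m}" "\<lambda>_. {-1, 0, 1}" i] by simp

lemma card_tern: "card (tern m b) = (m choose b) * 2 ^ b"
proof -
  define P :: "nat set \<Rightarrow> (nat \<Rightarrow> int) set" where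
    "P S = PiE {..<m} (\<lambda>i. if i \<in> S then {-1, 1} else {0})" for S
  define \<S> where "\<S> = {S. S \<subseteq> {..<m} \<and> card S = b}"
  have supp: "{i \<in> {..<m}. v i \<noteq> 0} = S" if "v \<in> P S" "S \<subseteq> {..<m}" for v S
  proof -
    have mem: "v i \<in> (if i \<in> S then {-1, 1} else {0})" if "i < m" for i
      using PiE_mem[OF \<open>v \<in> P S\<close>[unfolded P_def], of i] that by simp
    have "v i \<noteq> 0 \<longleftrightarrow> i \<in> S" if "i < m" for i
      using mem[OF that] by (auto split: if_splits)
    then show ?thesis using that(2) by auto
  qed
  have "tern m b = (\<Union>S\<in>\<S>. P S)"
  proof (intro equalityI subsetI)
    fix v assume v: "v \<in> tern m b"
    define S where "S = {i \<in> {..<m}. v i \<noteq> 0}"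
    note v3 = tern_mem[OF v]
    have "v \<in> P S"
      unfolding P_def
    proof (rule PiE_I)
      fix i assume "i \<in> {..<m}"
      then show "v i \<in> (if i \<in> S then {-1, 1} else {0})" using v3[of i] by (auto simp: S_def)
    next
      fix i assume "i \<notin> {..<m}"
      then show "v i = undefined" using tern_outside[OF v] by simp
    qed
    moreover have "S \<in> \<S>" using v by (auto simp: S_def \<S>_def tern_def)
    ultimately show "v \<in> (\<Union>S\<in>\<S>. P S)" by blast
  next
    fix v assume "v \<in> (\<Union>S\<in>\<S>. P S)"
    then obtain S where S: "S \<subseteq> {..<m}" "card S = b" "v \<in> P S" by (auto simp: \<S>_def)
    have "v \<in> {..<m} \<rightarrow>\<^sub>E {-1, 0, 1}"
    proof (rule PiE_I)
      fix i assume "i \<in> {..<m}"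
      then have "v i \<in> (if i \<in> S then {-1, 1} else {0})" using S(3) unfolding P_def by (rule PiE_mem[rotated])
      then show "v i \<in> {-1, 0, 1}" by (simp split: if_splits) blast
    next
      fix i assume "i \<notin> {..<m}"
      then show "v i = undefined" using PiE_arb[OF S(3)[unfolded P_def], of i] by simp
    qed
    then show "v \<in> tern m b" using supp[OF S(3,1)] S(2) by (simp add: tern_def)
  qed
  also have "card (\<Union>S\<in>\<S>. P S) = (\<Sum>S\<in>\<S>. card (P S))"
  proof (rule card_UN_disjoint)
    show "finite \<S>" by (simp add: \<S>_def)
    show "\<forall>S\<in>\<S>. finite (P S)" by (auto simp: P_def intro!: finite_PiE)
    show "\<forall>S\<in>\<S>. \<forall>S'\<in>\<S>. S \<noteq> S' \<longrightarrow> P S \<inter> P S' = {}"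
    proof (intro ballI impI)
      fix S S' assume SS: "S \<in> \<S>" "S' \<in> \<S>" "S \<noteq> S'"
      have "v \<notin> P S'" if "v \<in> P S" for v
        using supp[OF that] supp[of v S'] SS unfolding \<S>_def by auto
      then show "P S \<inter> P S' = {}" by auto
    qed
  qed
  also have "\<dots> = (\<Sum>S\<in>\<S>. 2 ^ b)"
  proof (rule sum.cong)
    fix S assume S: "S \<in> \<S>"
    have "card (P S) = (\<Prod>i<m. if i \<in> S then 2 else 1)"
      unfolding P_def by (subst card_PiE) (auto intro!: prod.cong)
    also have "\<dots> = (\<Prod>i\<in>S. 2)"
      using S by (intro prod.mono_neutral_cong_right) (auto simp: \<S>_def)
    finally show "card (P S) = 2 ^ b" using S by (simp add: \<S>_def)
  qed simp
  also have "\<dots> = card \<S> * 2 ^ b" by simp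
  also have "card \<S> = m choose b" unfolding \<S>_def using n_subsets[of "{..<m}" b] by simp
  finally show ?thesis .
qed

section \<open>The matrix of binomials and its rank modulo a prime\<close>

definition restricts :: "nat \<Rightarrow> (nat \<Rightarrow> int) \<Rightarrow> (nat \<Rightarrow> int) \<Rightarrow> bool" where
  "restricts m u v \<longleftrightarrow> (\<forall>i<m. u i \<noteq> 0 \<longrightarrow> u i = v i)"

text \<open>A common restriction with k nonzero entries amounts to a k-subset of the places where v
  and w agree and are nonzero. Hence the matrix of these binomials factors through
  \<open>tern m k\<close>.\<close>

lemma card_common_restrictions:
  assumes "v \<in> tern m b" "w \<in> tern m b"
  shows "card {u \<in> tern m k. restricts m u v \<and> restricts m u w} = agree m v w choose k"
proof -
  define A where "A = {i \<in> {..<m}. v i = w i \<and> v i \<noteq> 0}"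
  define f where "f S = (\<lambda>i\<in>{..<m}. if i \<in> S then v i else 0)" for S
  note vm = tern_mem[OF assms(1)]
  have "bij_betw f {S. S \<subseteq> A \<and> card S = k} {u \<in> tern m k. restricts m u v \<and> restricts m u w}"
  proof (rule bij_betwI[where g = "\<lambda>u. {i \<in> {..<m}. u i \<noteq> 0}"])
    show "f \<in> {S. S \<subseteq> A \<and> card S = k} \<rightarrow> {u \<in> tern m k. restricts m u v \<and> restricts m u w}"
    proof (rule funcsetI)
      fix S assume S: "S \<in> {S. S \<subseteq> A \<and> card S = k}"
      have "{i \<in> {..<m}. f S i \<noteq> 0} = S" using S by (auto simp: f_def A_def)
      moreover have "f S \<in> {..<m} \<rightarrow>\<^sub>E {-1, 0, 1}"
        unfolding f_def using vm by (intro restrict_PiE_iff[THEN iffD2]) simp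
      ultimately have "f S \<in> tern m k" using S by (simp add: tern_def)
      then show "f S \<in> {u \<in> tern m k. restricts m u v \<and> restricts m u w}"
        using S by (auto simp: restricts_def f_def A_def)
    qed
  next
    show "(\<lambda>u. {i \<in> {..<m}. u i \<noteq> 0}) \<in> {u \<in> tern m k. restricts m u v \<and> restricts m u w} \<rightarrow> {S. S \<subseteq> A \<and> card S = k}"
    proof (rule funcsetI)
      fix u assume u: "u \<in> {u \<in> tern m k. restricts m u v \<and> restricts m u w}"
      then have "{i \<in> {..<m}. u i \<noteq> 0} \<subseteq> A" unfolding restricts_def A_def by fastforce
      then show "{i \<in> {..<m}. u i \<noteq> 0} \<in> {S. S \<subseteq> A \<and> card S = k}"
        using u by (simp add: tern_def)
    qed
  next
    fix S assume "S \<in> {S. S \<subseteq> A \<and> card S = k}"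
    then show "{i \<in> {..<m}. f S i \<noteq> 0} = S" by (auto simp: f_def A_def)
  next
    fix u assume u: "u \<in> {u \<in> tern m k. restricts m u v \<and> restricts m u w}"
    then have "u i = undefined" if "\<not> i < m" for i using tern_outside[OF _ that] by blast
    then show "f {i \<in> {..<m}. u i \<noteq> 0} = u"
      using u unfolding f_def restricts_def by (intro ext) (auto simp: restrict_def)
  qed
  then have "card {S. S \<subseteq> A \<and> card S = k} = card {u \<in> tern m k. restricts m u v \<and> restricts m u w}"
    by (rule bij_betw_same_card)
  then show ?thesis using n_subsets[of A k] by (simp add: A_def agree_def)
qed

text \<open>The rank bound for a matrix that is diagonal modulo \<open>p\<close>, by counting vectors modulo \<open>p\<close>.\<close>

lemma diagonal_mod_prime_card_le:
  fixes A :: "'v \<Rightarrow> 'd \<Rightarrow> int" and B :: "'d \<Rightarrow> 'v \<Rightarrow> int" and p :: nat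
  assumes fin: "finite W" "finite D" and p: "prime p"
    and diag: "\<And>v. v \<in> W \<Longrightarrow> \<not> int p dvd (\<Sum>d\<in>D. A v d * B d v)"
    and off: "\<And>v w. v \<in> W \<Longrightarrow> w \<in> W \<Longrightarrow> v \<noteq> w \<Longrightarrow> int p dvd (\<Sum>d\<in>D. A v d * B d w)"
  shows "card W \<le> card D"
proof (rule ccontr)
  assume "\<not> card W \<le> card D"
  then have less: "card D < card W" by simp
  have p1: "p > 1" using p by (rule prime_gt_1_nat)
  define F where "F x = (\<lambda>d\<in>D. (\<Sum>v\<in>W. x v * A v d) mod int p)" for x
  let ?X = "W \<rightarrow>\<^sub>E {0..<int p}"
  have "card ?X = p ^ card W" "card (D \<rightarrow>\<^sub>E {0..<int p}) = p ^ card D"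
    using fin by (simp_all add: card_PiE)
  then have "card (D \<rightarrow>\<^sub>E {0..<int p}) < card ?X"
    using less p1 by (simp add: power_strict_increasing)
  moreover have "F ` ?X \<subseteq> D \<rightarrow>\<^sub>E {0..<int p}" using p1 by (auto simp: F_def)
  moreover have "finite (D \<rightarrow>\<^sub>E {0..<int p})" using fin by (auto intro!: finite_PiE)
  \<comment> \<open>There are more coefficient vectors than value vectors, so two collide; the
    difference z of colliding x and y combines the rows of \<open>A\<close> to 0 modulo p.\<close>
  ultimately have "\<not> inj_on F ?X" using card_inj_on_le[of F ?X] by (meson not_less)
  then obtain x y where xy: "x \<in> ?X" "y \<in> ?X" "F x = F y" "x \<noteq> y" by (auto simp: inj_on_def)
  define z where "z v = x v - y v" for v
  have z: "int p dvd (\<Sum>v\<in>W. z v * A v d)" if "d \<in> D" for d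
  proof -
    have "F x d = F y d" using xy by simp
    then have "(\<Sum>v\<in>W. x v * A v d) mod int p = (\<Sum>v\<in>W. y v * A v d) mod int p"
      using that by (simp add: F_def)
    then have "int p dvd (\<Sum>v\<in>W. x v * A v d) - (\<Sum>v\<in>W. y v * A v d)" by (simp add: mod_eq_dvd_iff)
    then show ?thesis by (simp add: z_def left_diff_distrib sum_subtractf)
  qed
  have "x w = y w" if w: "w \<in> W" for w
  proof -
    \<comment> \<open>Multiplying the relation by column w of \<open>B\<close> leaves modulo p only
      the diagonal term, which forces p to divide z w; as |z w| < p, it is 0.\<close>
    define M where "M v = (\<Sum>d\<in>D. A v d * B d w)" for v
    have "(\<Sum>v\<in>W. z v * M v) = (\<Sum>d\<in>D. (\<Sum>v\<in>W. z v * A v d) * B d w)"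
      unfolding M_def sum_distrib_left sum_distrib_right by (subst sum.swap) (simp add: mult.assoc)
    then have "int p dvd (\<Sum>v\<in>W. z v * M v)" using z by (auto intro!: dvd_sum)
    also have "(\<Sum>v\<in>W. z v * M v) = z w * M w + (\<Sum>v\<in>W - {w}. z v * M v)"
      using fin w by (simp add: sum.remove)
    finally have "int p dvd z w * M w + (\<Sum>v\<in>W - {w}. z v * M v)" .
    moreover have "int p dvd (\<Sum>v\<in>W - {w}. z v * M v)"
    proof (rule dvd_sum)
      fix v assume "v \<in> W - {w}"
      then have "int p dvd M v" using off[of v w] w by (simp add: M_def)
      then show "int p dvd z v * M v" by (rule dvd_mult)
    qed
    ultimately have "int p dvd z w * M w" by (simp add: dvd_add_left_iff)
    moreover have "\<not> int p dvd M w" using diag[OF w] by (simp add: M_def)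
    ultimately have "int p dvd z w" using p by (simp add: prime_dvd_mult_iff)
    moreover have "\<bar>z w\<bar> < int p" using PiE_mem[OF xy(1) w] PiE_mem[OF xy(2) w] by (auto simp: z_def)
    ultimately show ?thesis using zdvd_imp_le[of "int p" "\<bar>z w\<bar>"] by (auto simp: z_def)
  qed
  then have "x = y" using xy by (auto intro: PiE_ext)
  then show False using xy by simp
qed

section \<open>Binomials modulo p and sets without the critical distance\<close>

text \<open>Otherwise i C(q,i) = q C(q-1,i-1) with q = p^e would force q to divide the smaller
  number i.\<close>

lemma prime_dvd_prime_power_choose:
  fixes p :: nat
  assumes "prime p" "0 < i" "i < p ^ e"
  shows "p dvd (p ^ e choose i)"
proof (rule ccontr)
  assume "\<not> p dvd (p ^ e choose i)"
  then have cop: "coprime (p ^ e) (p ^ e choose i)"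
    using assms(1) by (simp add: prime_imp_coprime)
  have "i * (p ^ e choose i) = p ^ e * ((p ^ e - 1) choose (i - 1))"
    using times_binomial_minus1_eq[of i "p ^ e"] assms by simp
  then have "p ^ e dvd i * (p ^ e choose i)" by simp
  then have "p ^ e dvd i" using cop by (simp add: coprime_dvd_mult_left_iff)
  then show False using assms by (auto dest: dvd_imp_le)
qed

text \<open>So C(t, q-1) has period q in t modulo p. In Vandermonde's sum only k = 0 survives; k =
  q, the other index not killed by p, is out of range because the lower index is q-1.\<close>

lemma choose_add_prime_power_cong:
  fixes p :: nat
  assumes "prime p" "q = p ^ e"
  shows "(q + r choose (q - 1)) mod p = (r choose (q - 1)) mod p"
proof -
  have q: "q \<ge> 1" using assms by (simp add: Suc_le_eq prime_gt_0_nat)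
  have "q + r choose (q - 1) = (\<Sum>k\<le>q - 1. (q choose k) * (r choose (q - 1 - k)))"
    by (rule vandermonde[symmetric])
  also have "\<dots> = (r choose (q - 1)) + (\<Sum>k\<in>{..q - 1} - {0}. (q choose k) * (r choose (q - 1 - k)))"
    by (subst sum.remove[of _ 0]) auto
  finally have eq: "q + r choose (q - 1) = (r choose (q - 1)) + (\<Sum>k\<in>{..q - 1} - {0}. (q choose k) * (r choose (q - 1 - k)))" .
  have "p dvd (\<Sum>k\<in>{..q - 1} - {0}. (q choose k) * (r choose (q - 1 - k)))"
  proof (rule dvd_sum)
    fix k assume k: "k \<in> {..q - 1} - {0}"
    then have "0 < k" "k < q" using q by auto
    then have "p dvd (q choose k)" using assms prime_dvd_prime_power_choose by simp
    then show "p dvd (q choose k) * (r choose (q - 1 - k))" by simp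
  qed
  then show ?thesis unfolding eq by (auto elim!: dvdE)
qed

lemma agree_self: "v \<in> tern m b \<Longrightarrow> agree m v v = b"
  by (simp add: agree_def tern_def)

lemma agree_less:
  assumes "v \<in> tern m b" "w \<in> tern m b" "v \<noteq> w"
  shows "agree m v w < b"
proof (rule ccontr)
  let ?A = "{i \<in> {..<m}. v i = w i \<and> v i \<noteq> 0}"
  assume "\<not> agree m v w < b"
  then have ge: "card ?A \<ge> b" by (simp add: agree_def)
  have 1: "?A = {i \<in> {..<m}. v i \<noteq> 0}"
  proof (rule card_seteq)
    show "card {i \<in> {..<m}. v i \<noteq> 0} \<le> card ?A" using ge assms(1) by (simp add: tern_def)
  qed auto
  have 2: "?A = {i \<in> {..<m}. w i \<noteq> 0}"
  proof (rule card_seteq)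
    show "card {i \<in> {..<m}. w i \<noteq> 0} \<le> card ?A" using ge assms(2) by (simp add: tern_def)
  qed auto
  have "v i = w i" if "i < m" for i
  proof (cases "i \<in> ?A")
    case False
    then have "v i = 0" "w i = 0" using 1 2 that by blast+
    then show ?thesis by simp
  qed simp
  then have "v i = w i" for i
    using tern_outside[OF assms(1), of i] tern_outside[OF assms(2), of i] by (cases "i < m") auto
  then have "v = w" by blast
  then show False using assms by simp
qed

text \<open>By periodicity, for t <= 2q-1 the entry C(t, q-1) is nonzero modulo p only at t = q-1,
  excluded by hypothesis, and at t = 2q-1, the diagonal.\<close>

theorem tern_independent_card_le:
  assumes q: "primepow q" and W: "W \<subseteq> tern m (2 * q - 1)"
    and ind: "\<And>v w. v \<in> W \<Longrightarrow> w \<in> W \<Longrightarrow> agree m v w \<noteq> q - 1"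
  shows "card W \<le> card (tern m (q - 1))"
proof -
  obtain p e where pe: "prime p" "e > 0" "q = p ^ e" using q by (auto simp: primepow_def)
  have p1: "p > 1" using pe(1) by (rule prime_gt_1_nat)
  have q2: "q \<ge> 1" using pe by (simp add: Suc_le_eq prime_gt_0_nat)
  define A where "A v u = (if restricts m u v then 1 else 0 :: int)" for v u
  have M: "(\<Sum>u\<in>tern m (q - 1). A v u * A w u) = int (agree m v w choose (q - 1))"
    if "v \<in> W" "w \<in> W" for v w
  proof -
    have "(\<Sum>u\<in>tern m (q - 1). A v u * A w u) = (\<Sum>u\<in>tern m (q - 1). if restricts m u v \<and> restricts m u w then 1 else 0)"
      by (intro sum.cong) (auto simp: A_def)
    also have "\<dots> = int (card {u \<in> tern m (q - 1). restricts m u v \<and> restricts m u w})"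
      using finite_tern by (simp add: sum.inter_filter[symmetric])
    also have "\<dots> = int (agree m v w choose (q - 1))"
      using that W card_common_restrictions[of v m "2 * q - 1" w "q - 1"] by auto
    finally show ?thesis .
  qed
  show ?thesis
  proof (rule diagonal_mod_prime_card_le[where p = p and A = A and B = "\<lambda>u w. A w u"])
    show "finite W" using W finite_tern by (rule finite_subset)
    show "finite (tern m (q - 1))" by (rule finite_tern)
    show "prime p" by fact
  next
    fix v assume v: "v \<in> W"
    have "agree m v v = q + (q - 1)" using agree_self[of v m] v W q2 by auto
    then have "(agree m v v choose (q - 1)) mod p = 1"
      using choose_add_prime_power_cong[OF pe(1,3), of "q - 1"] p1 by simp
    then have "\<not> p dvd (agree m v v choose (q - 1))" by (simp add: dvd_eq_mod_eq_0)
    then show "\<not> int p dvd (\<Sum>d\<in>tern m (q - 1). A v d * A v d)" unfolding M[OF v v] by simp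
  next
    fix v w assume vw: "v \<in> W" "w \<in> W" "v \<noteq> w"
    define t where "t = agree m v w"
    have t: "t < 2 * q - 1" "t \<noteq> q - 1" using agree_less[of v m] vw W ind by (auto simp: t_def)
    have "p dvd (t choose (q - 1))"
    proof (cases "t < q - 1")
      case False
      then have "q + (t - q) = t" "t - q < q - 1" using t by auto
      then have "(t choose (q - 1)) mod p = 0"
        using choose_add_prime_power_cong[OF pe(1,3), of "t - q"] by (simp add: binomial_eq_0)
      then show ?thesis by (simp add: dvd_eq_mod_eq_0)
    qed (simp add: binomial_eq_0)
    then show "int p dvd (\<Sum>d\<in>tern m (q - 1). A v d * A w d)" unfolding M[OF vw(1,2)] t_def by simp
  qed
qed

text \<open>For entries in {-1,0,1} the distance |a-b| is the number of nonzero ones among a, b,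
  minus 2 if they agree and are nonzero; opposite signs thus count like disjoint supports.\<close>

lemma tern_l1_dist:
  assumes "v \<in> tern m b" "w \<in> tern m b"
  shows "(\<Sum>i<m. \<bar>v i - w i\<bar>) = 2 * (int b - int (agree m v w))"
proof -
  have card: "(\<Sum>i<m. if P i then 1 else 0) = int (card {i \<in> {..<m}. P i})" for P
    by (simp add: sum.inter_filter[symmetric])
  have "(\<Sum>i<m. \<bar>v i - w i\<bar>) = (\<Sum>i<m. (if v i \<noteq> 0 then 1 else 0) + (if w i \<noteq> 0 then 1 else 0)
      - 2 * (if v i = w i \<and> v i \<noteq> 0 then 1 else 0))"
  proof (rule sum.cong)
    fix i assume "i \<in> {..<m}"
    then have "v i \<in> {-1, 0, 1}" "w i \<in> {-1, 0, 1}" using tern_mem assms by blast+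
    then show "\<bar>v i - w i\<bar> = (if v i \<noteq> 0 then 1 else 0) + (if w i \<noteq> 0 then 1 else 0)
      - 2 * (if v i = w i \<and> v i \<noteq> 0 then 1 else 0)" by auto
  qed simp
  also have "\<dots> = int b + int b - 2 * int (agree m v w)"
    unfolding sum_subtractf sum.distrib sum_distrib_left[symmetric] card
    using assms by (simp add: tern_def agree_def)
  finally show ?thesis by simp
qed

section \<open>Stars and chains in products\<close>

text \<open>\<open>E\<close> stands for the critical distance and \<open>a\<close> for a bound on
  its independent sets; the combinatorics of products uses nothing else about ternary
  vectors.\<close>

locale independence_bound =
  fixes V :: "'v set" and E :: "'v \<Rightarrow> 'v \<Rightarrow> bool" and a :: nat
  assumes finite_V: "finite V"
    and indep: "\<And>U. U \<subseteq> V \<Longrightarrow> (\<And>v w. v \<in> U \<Longrightarrow> w \<in> U \<Longrightarrow> \<not> E v w) \<Longrightarrow> card U \<le> a"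
begin

definition stuck :: "nat \<Rightarrow> (nat \<Rightarrow> 'v) set \<Rightarrow> (nat \<Rightarrow> 'v) set" where
  "stuck i W = {X \<in> W. \<forall>b\<in>V. E (X i) b \<longrightarrow> X(i := b) \<notin> W}"

text \<open>Fix all coordinates except i: if two stuck points had \<open>E\<close>-related entries
  at i, the first could move to the second inside W. These entries thus form an independent set, of
  size at most \<open>a\<close> for each choice of the rest.\<close>

lemma card_stuck_le:
  assumes W: "W \<subseteq> {..<K} \<rightarrow>\<^sub>E V" and i: "i < K"
  shows "card (stuck i W) \<le> a * card V ^ (K - 1)"
proof -
  \<comment> \<open>Forgetting coordinate i by writing \<open>undefined\<close> keeps the result
    extensional on the remaining indices.\<close>
  define r where "r X = X(i := undefined)" for X :: "nat \<Rightarrow> 'v"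
  have finW: "finite W" using W by (rule finite_subset) (simp add: finite_PiE finite_V)
  have fin: "finite (stuck i W)" using finW by (simp add: stuck_def)
  have sub: "r ` stuck i W \<subseteq> ({..<K} - {i}) \<rightarrow>\<^sub>E V"
  proof (rule image_subsetI)
    fix X assume "X \<in> stuck i W"
    then have X: "X \<in> {..<K} \<rightarrow>\<^sub>E V" using W by (auto simp: stuck_def)
    show "r X \<in> ({..<K} - {i}) \<rightarrow>\<^sub>E V"
    proof (rule PiE_I)
      fix j assume "j \<in> {..<K} - {i}"
      then show "r X j \<in> V" using PiE_mem[OF X, of j] by (simp add: r_def)
    next
      fix j assume "j \<notin> {..<K} - {i}"
      then show "r X j = undefined" using PiE_arb[OF X, of j] by (cases "j = i") (auto simp: r_def)
    qed
  qed
  have fib: "card {X \<in> stuck i W. r X = Y} \<le> a" for Y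
  proof -
    let ?F = "{X \<in> stuck i W. r X = Y}"
    have upd: "X(i := X' i) = X'" if "X \<in> ?F" "X' \<in> ?F" for X X'
    proof -
      have "r X = r X'" using that by simp
      then have "X(i := undefined, i := X' i) = X'(i := undefined, i := X' i)" unfolding r_def by (rule arg_cong)
      then show ?thesis by simp
    qed
    have VI: "X i \<in> V" if "X \<in> ?F" for X
    proof -
      have "X \<in> {..<K} \<rightarrow>\<^sub>E V" using that W by (auto simp: stuck_def)
      from PiE_mem[OF this, of i] show ?thesis using i by simp
    qed
    have "inj_on (\<lambda>X. X i) ?F"
    proof (rule inj_onI)
      fix X X' assume X: "X \<in> ?F" "X' \<in> ?F" "X i = X' i"
      have "X = X(i := X' i)" using X(3) by (metis fun_upd_triv)
      then show "X = X'" using upd[OF X(1,2)] by simp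
    qed
    then have "card ?F = card ((\<lambda>X. X i) ` ?F)" by (simp add: card_image)
    also have "\<dots> \<le> a"
    proof (rule indep)
      show "(\<lambda>X. X i) ` ?F \<subseteq> V" using VI by blast
      fix v w assume "v \<in> (\<lambda>X. X i) ` ?F" "w \<in> (\<lambda>X. X i) ` ?F"
      then obtain X X' where X: "X \<in> ?F" "v = X i" and X': "X' \<in> ?F" "w = X' i" by blast
      have "X(i := X' i) \<in> W" using upd[OF X(1) X'(1)] X'(1) by (simp add: stuck_def)
      then show "\<not> E v w" using X X' VI[OF X'(1)] by (auto simp: stuck_def)
    qed
    finally show ?thesis .
  qed
  have "stuck i W = (\<Union>Y\<in>r ` stuck i W. {X \<in> stuck i W. r X = Y})" by auto
  then have "card (stuck i W) = card (\<Union>Y\<in>r ` stuck i W. {X \<in> stuck i W. r X = Y})" by simp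
  also have "\<dots> \<le> (\<Sum>Y\<in>r ` stuck i W. card {X \<in> stuck i W. r X = Y})"
    using fin by (intro card_UN_le) simp
  also have "\<dots> \<le> (\<Sum>Y\<in>r ` stuck i W. a)" by (intro sum_mono fib)
  also have "\<dots> = card (r ` stuck i W) * a" by simp
  also have "card (r ` stuck i W) \<le> card (({..<K} - {i}) \<rightarrow>\<^sub>E V)"
    using sub by (intro card_mono) (simp_all add: finite_PiE finite_V)
  also have "card (({..<K} - {i}) \<rightarrow>\<^sub>E V) = card V ^ (K - 1)"
    using i by (subst card_PiE) auto
  finally show ?thesis by (simp add: mult.commute)
qed

text \<open>The stuck sets of the K coordinates together cannot cover W; a point outside all of them
  is the centre.\<close>

lemma star_exists:
  assumes W: "W \<subseteq> {..<K} \<rightarrow>\<^sub>E V" and card: "card W > K * (a * card V ^ (K - 1))"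
  obtains X where "X \<in> W" "\<forall>i<K. \<exists>b\<in>V. E (X i) b \<and> X(i := b) \<in> W"
proof -
  have finW: "finite W" using W by (rule finite_subset) (simp add: finite_PiE finite_V)
  have "card (\<Union>i<K. stuck i W) \<le> (\<Sum>i<K. card (stuck i W))" by (intro card_UN_le) simp
  also have "\<dots> \<le> (\<Sum>i<K. a * card V ^ (K - 1))" using W by (intro sum_mono card_stuck_le) auto
  also have "\<dots> < card W" using card by simp
  finally have "\<not> W \<subseteq> (\<Union>i<K. stuck i W)"
    using finW card_mono[of "\<Union>i<K. stuck i W" W] by (auto simp: stuck_def)
  then obtain X where X: "X \<in> W" "\<forall>i<K. X \<notin> stuck i W" by auto
  then have "\<forall>i<K. \<exists>b\<in>V. E (X i) b \<and> X(i := b) \<in> W" by (auto simp: stuck_def)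
  with X(1) show ?thesis by (rule that)
qed

text \<open>Coordinates are treated from the last to the first: remove the points stuck at the last
  one, find the shorter chain in the rest, and its end can still move. The induction therefore
  ranges over all W.\<close>

lemma chain_exists:
  assumes W: "W \<subseteq> {..<K} \<rightarrow>\<^sub>E V" and "L \<le> K" and "card W > L * (a * card V ^ (K - 1))"
  shows "\<exists>X. (\<forall>l\<le>L. X l \<in> W) \<and> (\<forall>l<L. \<exists>b\<in>V. E (X l l) b \<and> X (Suc l) = (X l)(l := b))"
  using assms
proof (induction L arbitrary: W)
  case 0
  then obtain X where "X \<in> W" by fastforce
  then show ?case by (intro exI[of _ "\<lambda>_. X"]) auto
next
  case (Suc L)
  have finW: "finite W" using Suc.prems(1) by (rule finite_subset) (simp add: finite_PiE finite_V)
  define W' where "W' = W - stuck L W"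
  have "card W \<le> card W' + card (stuck L W)"
    using finW by (simp add: W'_def card_Diff_subset stuck_def)
  moreover have "card (stuck L W) \<le> a * card V ^ (K - 1)"
    using Suc.prems by (intro card_stuck_le) auto
  ultimately have "card W' > L * (a * card V ^ (K - 1))" using Suc.prems(3) by simp
  moreover have "W' \<subseteq> {..<K} \<rightarrow>\<^sub>E V" using Suc.prems(1) by (auto simp: W'_def)
  ultimately have "\<exists>X. (\<forall>l\<le>L. X l \<in> W') \<and> (\<forall>l<L. \<exists>b\<in>V. E (X l l) b \<and> X (Suc l) = (X l)(l := b))"
    using Suc.IH[of W'] Suc.prems(2) by (simp only: Suc_leD)
  then obtain X where X: "\<forall>l\<le>L. X l \<in> W'" "\<forall>l<L. \<exists>b\<in>V. E (X l l) b \<and> X (Suc l) = (X l)(l := b)"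
    by blast
  have "X L \<in> W - stuck L W" using X(1) by (simp add: W'_def)
  then obtain b where b: "b \<in> V" "E (X L L) b" "(X L)(L := b) \<in> W" by (auto simp: stuck_def)
  define Y where "Y = X(Suc L := (X L)(L := b))"
  have "Y l \<in> W" if "l \<le> Suc L" for l
    using that X(1) b by (cases "l = Suc L") (auto simp: Y_def W'_def)
  moreover have "\<exists>b\<in>V. E (Y l l) b \<and> Y (Suc l) = (Y l)(l := b)" if "l < Suc L" for l
    using that X(2) b by (cases "l = L") (auto simp: Y_def)
  ultimately show ?case by blast
qed

end

lemma tern_independence_bound:
  assumes "primepow q"
  shows "independence_bound (tern m (2 * q - 1)) (\<lambda>v w. agree m v w = q - 1) (card (tern m (q - 1)))"
proof
  show "finite (tern m (2 * q - 1))" by (rule finite_tern)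
  fix U assume "U \<subseteq> tern m (2 * q - 1)" "\<And>v w. v \<in> U \<Longrightarrow> w \<in> U \<Longrightarrow> agree m v w \<noteq> q - 1"
  then show "card U \<le> card (tern m (q - 1))" by (rule tern_independent_card_le[OF assms])
qed

section \<open>Embedding products into R^n and dense colour classes\<close>

text \<open>Block j is scaled so that the critical distance 2q becomes s j; the coordinates from K m
  on are padding, which allows any n >= K m.\<close>

definition block_embed :: "nat \<Rightarrow> nat \<Rightarrow> nat \<Rightarrow> (nat \<Rightarrow> real) \<Rightarrow> nat \<Rightarrow> (nat \<Rightarrow> nat \<Rightarrow> int) \<Rightarrow> nat \<Rightarrow> real" where
  "block_embed K m q s n X = (\<lambda>i\<in>{..<n}.
     if i < K * m then s (i div m) / (2 * real q) * of_int (X (i div m) (i mod m)) else 0)"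

lemma block_embed_in_Rn: "block_embed K m q s n X \<in> Rn n"
  unfolding block_embed_def Rn_def by (rule restrict_PiE_iff[THEN iffD2]) simp

lemma l1_dist_block_embed:
  assumes n: "K * m \<le> n" and s: "\<And>j. j < K \<Longrightarrow> s j \<ge> 0"
  shows "l1_dist n (block_embed K m q s n X) (block_embed K m q s n Y) =
    (\<Sum>j<K. s j * (of_int (\<Sum>i<m. \<bar>X j i - Y j i\<bar>) / (2 * real q)))"
proof -
  define g where "g i = s (i div m) / (2 * real q) * of_int \<bar>X (i div m) (i mod m) - Y (i div m) (i mod m)\<bar>" for i
  have "l1_dist n (block_embed K m q s n X) (block_embed K m q s n Y) = (\<Sum>i<n. if i < K * m then g i else 0)"
    unfolding l1_dist_def
  proof (rule sum.cong)
    fix i assume i: "i \<in> {..<n}"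
    show "\<bar>block_embed K m q s n X i - block_embed K m q s n Y i\<bar> = (if i < K * m then g i else 0)"
    proof (cases "i < K * m")
      case True
      then have "i div m < K" by (simp add: less_mult_imp_div_less)
      then have nn: "0 \<le> s (i div m) / (2 * real q)" using s by simp
      have "\<bar>a * x - a * y\<bar> = a * \<bar>x - y\<bar>" if "0 \<le> a" for a x y :: real
        using that by (simp add: abs_mult flip: right_diff_distrib)
      from this[OF nn] show ?thesis using True i
        by (simp only: block_embed_def g_def restrict_apply lessThan_iff if_True of_int_abs of_int_diff)
    qed (use i in \<open>simp add: block_embed_def\<close>)
  qed simp
  also have "\<dots> = (\<Sum>i<K * m. g i)"
    using n by (intro sum.mono_neutral_cong_right) auto
  also have "\<dots> = (\<Sum>j<K. sum g {j * m..<j * m + m})" by (rule sum.nat_group[symmetric])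
  also have "\<dots> = (\<Sum>j<K. s j * (of_int (\<Sum>i<m. \<bar>X j i - Y j i\<bar>) / (2 * real q)))"
  proof (rule sum.cong)
    fix j
    have "sum g {j * m..<j * m + m} = (\<Sum>i<m. g (i + j * m))"
      using sum.shift_bounds_nat_ivl[of g 0 "j * m" m] by (simp add: add.commute atLeast0LessThan)
    also have "\<dots> = (\<Sum>i<m. s j / (2 * real q) * of_int \<bar>X j i - Y j i\<bar>)"
      by (intro sum.cong) (auto simp: g_def)
    finally show "sum g {j * m..<j * m + m} = s j * (of_int (\<Sum>i<m. \<bar>X j i - Y j i\<bar>) / (2 * real q))"
      unfolding sum_distrib_left[symmetric] of_int_sum by simp
  qed simp
  finally show ?thesis .
qed

lemma le_chi:
  assumes "\<And>r c. good_coloring n d M r c \<Longrightarrow> B \<le> real r"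
  shows "ereal B \<le> ereal_of_enat (chi n d M)"
proof (cases "{enat r | r. \<exists>c. good_coloring n d M r c} = {}")
  case True
  then show ?thesis by (simp add: chi_def Inf_enat_def)
next
  case False
  let ?A = "{enat r | r. \<exists>c. good_coloring n d M r c}"
  have "(LEAST x. x \<in> ?A) \<in> ?A" by (rule LeastI_ex) (use False in blast)
  then have "chi n d M \<in> ?A" using False by (simp only: chi_def Inf_enat_def if_False)
  then obtain r c where "chi n d M = enat r" "good_coloring n d M r c" by blast
  then show ?thesis using assms[of r c] by simp
qed

lemma good_coloring_class:
  assumes c: "c \<in> Rn n \<rightarrow> {..<r}" and P: "finite P" "\<phi> ` P \<subseteq> Rn n" and r: "r * N < card P"
  obtains j where "card {X \<in> P. c (\<phi> X) = j} > N"
proof (rule ccontr)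
  assume "\<not> thesis"
  then have le: "card {X \<in> P. c (\<phi> X) = j} \<le> N" for j using that by (meson not_less)
  have "P = (\<Union>j<r. {X \<in> P. c (\<phi> X) = j})" using c P(2) by (auto simp: Pi_iff image_subset_iff)
  then have "card P = card (\<Union>j<r. {X \<in> P. c (\<phi> X) = j})" by simp
  also have "\<dots> \<le> (\<Sum>j<r. card {X \<in> P. c (\<phi> X) = j})" by (intro card_UN_le) simp
  also have "\<dots> \<le> (\<Sum>j<r. N)" by (intro sum_mono le)
  finally show False using r by simp
qed

lemma l1_dist_eq_0_iff:
  assumes "x \<in> Rn d" "y \<in> Rn d"
  shows "l1_dist d x y = 0 \<longleftrightarrow> x = y"
proof
  assume "l1_dist d x y = 0"
  then have "\<forall>i\<in>{..<d}. \<bar>x i - y i\<bar> = 0" unfolding l1_dist_def by (subst (asm) sum_nonneg_eq_0_iff) auto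
  then show "x = y" using assms unfolding Rn_def by (intro PiE_ext[of x _ _ y]) auto
qed (simp add: l1_dist_def)

text \<open>Indexing both sets by I spares an explicit isometry. \<open>g\<close> is injective
  because coinciding images have distance 0; hence so do the originals, which then coincide in
  \<open>Rn d\<close>.\<close>

lemma isometric_copyI:
  assumes z: "bij_betw z I M" "M \<subseteq> Rn d" and g: "\<And>i. i \<in> I \<Longrightarrow> g i \<in> Rn n"
    and dist: "\<And>i j. i \<in> I \<Longrightarrow> j \<in> I \<Longrightarrow> l1_dist d (z i) (z j) = l1_dist n (g i) (g j)"
  shows "l1_isometric_copy d M n (g ` I)"
proof -
  define h where "h = inv_into I z"
  have h: "h x \<in> I" "z (h x) = x" if "x \<in> M" for x
    using that z(1) unfolding h_def by (auto simp: bij_betw_def inv_into_into f_inv_into_f)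
  have "inj_on g I"
  proof (rule inj_onI)
    fix i j assume ij: "i \<in> I" "j \<in> I" "g i = g j"
    then have "l1_dist n (g i) (g j) = 0" by (simp add: l1_dist_def)
    then have "z i = z j" using dist ij z l1_dist_eq_0_iff[of "z i" d "z j"] by (auto simp: bij_betw_def)
    then show "i = j" using ij z(1) by (auto simp: bij_betw_def dest: inj_onD)
  qed
  then have "bij_betw g I (g ` I)" by (simp add: bij_betw_def)
  moreover have "bij_betw h M I" unfolding h_def by (rule bij_betw_inv_into[OF z(1)])
  ultimately have "bij_betw (g \<circ> h) M (g ` I)" by (rule bij_betw_trans[rotated])
  moreover have "l1_dist d x y = l1_dist n ((g \<circ> h) x) ((g \<circ> h) y)" if "x \<in> M" "y \<in> M" for x y
    using dist[of "h x" "h y"] h that by simp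
  ultimately show ?thesis
    unfolding l1_isometric_copy_def using z(2) g by blast
qed

lemma l1_dist_commute: "l1_dist n x y = l1_dist n y x"
  by (simp add: l1_dist_def abs_minus_commute)

lemma tern_dist_adjacent:
  assumes "v \<in> tern m (2 * q - 1)" "w \<in> tern m (2 * q - 1)" "agree m v w = q - 1" "q \<ge> 1"
  shows "of_int (\<Sum>i<m. \<bar>v i - w i\<bar>) / (2 * real q) = 1" "of_int (\<Sum>i<m. \<bar>w i - v i\<bar>) / (2 * real q) = 1"
proof -
  have "(\<Sum>i<m. \<bar>v i - w i\<bar>) = 2 * int q"
    using tern_l1_dist[OF assms(1,2)] assms(3,4) by (simp add: of_nat_diff)
  then show 1: "of_int (\<Sum>i<m. \<bar>v i - w i\<bar>) / (2 * real q) = 1" using assms(4) by simp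
  have "(\<Sum>i<m. \<bar>w i - v i\<bar>) = (\<Sum>i<m. \<bar>v i - w i\<bar>)" by (intro sum.cong refl) (rule abs_minus_commute)
  then show "of_int (\<Sum>i<m. \<bar>w i - v i\<bar>) / (2 * real q) = 1" using 1 by simp
qed

text \<open>Let V and a be the two cardinalities. With fewer than V / (K a) colours, some colour
  class on the V^K product points exceeds K a V^(K-1), the threshold of \<open>star_exists\<close>
  and of \<open>chain_exists\<close> at length K.\<close>

lemma dense_class_le_chi:
  assumes n: "K * m \<le> n" and K: "K \<ge> 1"
    and copy: "\<And>W. W \<subseteq> {..<K} \<rightarrow>\<^sub>E tern m (2 * q - 1) \<Longrightarrow>
        card W > K * (card (tern m (q - 1)) * card (tern m (2 * q - 1)) ^ (K - 1)) \<Longrightarrow>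
        \<exists>M' \<subseteq> block_embed K m q s n ` W. l1_isometric_copy d M n M'"
  shows "ereal (real (card (tern m (2 * q - 1))) / (real K * real (card (tern m (q - 1))))) \<le> ereal_of_enat (chi n d M)"
proof (rule le_chi)
  fix r c assume good: "good_coloring n d M r c"
  define V where "V = card (tern m (2 * q - 1))"
  define a where "a = card (tern m (q - 1))"
  let ?P = "{..<K} \<rightarrow>\<^sub>E tern m (2 * q - 1)"
  show "real (card (tern m (2 * q - 1))) / (real K * real (card (tern m (q - 1)))) \<le> real r"
  proof (rule ccontr)
    assume "\<not> real (card (tern m (2 * q - 1))) / (real K * real (card (tern m (q - 1)))) \<le> real r"
    then have less: "real r < real V / (real K * real a)" by (simp add: V_def a_def)
    \<comment> \<open>With \<open>a\<close> = 0 the right-hand side would be V / 0 = 0, and no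
      natural number r lies below it.\<close>
    then have "a > 0" by (cases "a = 0") auto
    then have "real (r * (K * a)) < real V" using less K by (simp add: pos_less_divide_eq)
    then have lt: "r * (K * a) < V" by (simp only: of_nat_less_iff)
    then have "r * (K * a) * V ^ (K - 1) < V * V ^ (K - 1)" by (intro mult_strict_right_mono) auto
    also have "V * V ^ (K - 1) = V ^ K" using K by (cases K) simp_all
    also have "V ^ K = card ?P" by (simp add: card_PiE V_def)
    finally have lt': "r * (K * (a * V ^ (K - 1))) < card ?P" by (simp only: mult.assoc)
    have fin: "finite ?P" by (simp add: finite_PiE finite_tern)
    have sub: "block_embed K m q s n ` ?P \<subseteq> Rn n" using block_embed_in_Rn by blast
    have c: "c \<in> Rn n \<rightarrow> {..<r}" using good by (simp add: good_coloring_def)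
    obtain j where j: "card {X \<in> ?P. c (block_embed K m q s n X) = j} > K * (a * V ^ (K - 1))"
      by (rule good_coloring_class[OF c fin sub lt'])
    have "\<exists>M' \<subseteq> block_embed K m q s n ` {X \<in> ?P. c (block_embed K m q s n X) = j}. l1_isometric_copy d M n M'"
      by (rule copy) (use j in \<open>auto simp only: a_def V_def\<close>)
    then obtain M' where M': "M' \<subseteq> block_embed K m q s n ` {X \<in> ?P. c (block_embed K m q s n X) = j}"
        "l1_isometric_copy d M n M'"
      by blast
    have "\<forall>x\<in>M'. c x = j" using M'(1) by blast
    then show False using good M'(2) unfolding good_coloring_def by blast
  qed
qed

section \<open>Stars and chains as isometric copies\<close>

text \<open>The copy consists of the leaves of a star, without its centre: leaves i and j differ
  only in blocks i and j, at distances s i and s j.\<close>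

lemma star_le_chi:
  assumes q: "primepow q" and n: "K * m \<le> n" and K: "K \<ge> 1" and s: "\<And>j. j < K \<Longrightarrow> s j \<ge> 0"
    and z: "bij_betw z {..<K} M" "M \<subseteq> Rn d"
    and dist: "\<And>i j. i < K \<Longrightarrow> j < K \<Longrightarrow> i \<noteq> j \<Longrightarrow> l1_dist d (z i) (z j) = s i + s j"
  shows "ereal (real (card (tern m (2 * q - 1))) / (real K * real (card (tern m (q - 1))))) \<le> ereal_of_enat (chi n d M)"
proof (rule dense_class_le_chi[OF n K, where s = s])
  fix W assume W: "W \<subseteq> {..<K} \<rightarrow>\<^sub>E tern m (2 * q - 1)"
    and card: "card W > K * (card (tern m (q - 1)) * card (tern m (2 * q - 1)) ^ (K - 1))"
  have q1: "q \<ge> 1" using primepow_gt_0_nat[OF q] by simp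
  interpret independence_bound "tern m (2 * q - 1)" "\<lambda>v w. agree m v w = q - 1" "card (tern m (q - 1))"
    by (rule tern_independence_bound[OF q])
  obtain X where X: "X \<in> W" "\<forall>i<K. \<exists>b\<in>tern m (2 * q - 1). agree m (X i) b = q - 1 \<and> X(i := b) \<in> W"
    using star_exists[OF W card] .
  from X(2) have "\<forall>i\<in>{..<K}. \<exists>b. b \<in> tern m (2 * q - 1) \<and> agree m (X i) b = q - 1 \<and> X(i := b) \<in> W"
    by blast
  from bchoice[OF this] obtain b where "\<forall>i\<in>{..<K}. b i \<in> tern m (2 * q - 1) \<and> agree m (X i) (b i) = q - 1 \<and> X(i := b i) \<in> W"
    by blast
  then have b: "b i \<in> tern m (2 * q - 1)" "agree m (X i) (b i) = q - 1" "X(i := b i) \<in> W" if "i < K" for i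
    using that by blast+
  have Xi: "X i \<in> tern m (2 * q - 1)" if "i < K" for i
    using PiE_mem[OF subsetD[OF W X(1)], of i] that by simp
  have block_dist: "l1_dist n (block_embed K m q s n X) (block_embed K m q s n Y) =
    (\<Sum>j<K. s j * (of_int (\<Sum>i<m. \<bar>X j i - Y j i\<bar>) / (2 * real q)))" for X Y
    by (rule l1_dist_block_embed[OF n]) (rule s)
  define g where "g i = block_embed K m q s n (X(i := b i))" for i
  have "l1_isometric_copy d M n (g ` {..<K})"
  proof (rule isometric_copyI[OF z])
    show "g i \<in> Rn n" for i unfolding g_def by (rule block_embed_in_Rn)
    fix i j assume "i \<in> {..<K}" "j \<in> {..<K}"
    then have ij: "i < K" "j < K" by auto
    show "l1_dist d (z i) (z j) = l1_dist n (g i) (g j)"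
    proof (cases "i = j")
      case False
      have "l1_dist n (g i) (g j) = (\<Sum>l<K. (if l = i then s i else 0) + (if l = j then s j else 0))"
        unfolding g_def block_dist
      proof (rule sum.cong)
        fix l assume "l \<in> {..<K}"
        consider "l = i" | "l = j" "l \<noteq> i" | "l \<noteq> i" "l \<noteq> j" by blast
        then show "s l * (of_int (\<Sum>t<m. \<bar>(X(i := b i)) l t - (X(j := b j)) l t\<bar>) / (2 * real q)) =
            (if l = i then s i else 0) + (if l = j then s j else 0)"
        proof cases
          case 1
          then show ?thesis
            using tern_dist_adjacent(2)[OF Xi[OF ij(1)] b(1,2)[OF ij(1)] q1] False by (simp del: of_int_sum)
        next
          case 2
          then show ?thesis
            using tern_dist_adjacent(1)[OF Xi[OF ij(2)] b(1,2)[OF ij(2)] q1] False by (simp del: of_int_sum)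
        qed simp
      qed simp
      also have "\<dots> = s i + s j" using ij by (simp add: sum.distrib)
      finally show ?thesis using dist[OF ij False] by simp
    qed (simp add: l1_dist_def)
  qed
  moreover have "g ` {..<K} \<subseteq> block_embed K m q s n ` W" using b(3) by (auto simp: g_def)
  ultimately show "\<exists>M' \<subseteq> block_embed K m q s n ` W. l1_isometric_copy d M n M'" by blast
qed

text \<open>Block l changes only in step l of the chain, so points i and j differ exactly in the
  blocks from i to j-1, each by its critical distance.\<close>

lemma chain_le_chi:
  assumes q: "primepow q" and n: "K * m \<le> n" and K: "K \<ge> 1" and s: "\<And>j. j < K \<Longrightarrow> s j \<ge> 0"
    and z: "bij_betw z {..K} M" "M \<subseteq> Rn d"
    and dist: "\<And>i j. i \<le> j \<Longrightarrow> j \<le> K \<Longrightarrow> l1_dist d (z i) (z j) = sum s {i..<j}"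
  shows "ereal (real (card (tern m (2 * q - 1))) / (real K * real (card (tern m (q - 1))))) \<le> ereal_of_enat (chi n d M)"
proof (rule dense_class_le_chi[OF n K, where s = s])
  fix W assume W: "W \<subseteq> {..<K} \<rightarrow>\<^sub>E tern m (2 * q - 1)"
    and card: "card W > K * (card (tern m (q - 1)) * card (tern m (2 * q - 1)) ^ (K - 1))"
  have q1: "q \<ge> 1" using primepow_gt_0_nat[OF q] by simp
  interpret independence_bound "tern m (2 * q - 1)" "\<lambda>v w. agree m v w = q - 1" "card (tern m (q - 1))"
    by (rule tern_independence_bound[OF q])
  obtain X where X: "\<forall>l\<le>K. X l \<in> W"
    "\<forall>l<K. \<exists>b\<in>tern m (2 * q - 1). agree m (X l l) b = q - 1 \<and> X (Suc l) = (X l)(l := b)"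
    using chain_exists[OF W order_refl card] by blast
  from X(2) have "\<forall>l\<in>{..<K}. \<exists>b. b \<in> tern m (2 * q - 1) \<and> agree m (X l l) b = q - 1 \<and> X (Suc l) = (X l)(l := b)"
    by blast
  from bchoice[OF this] obtain b where "\<forall>l\<in>{..<K}. b l \<in> tern m (2 * q - 1) \<and> agree m (X l l) (b l) = q - 1 \<and> X (Suc l) = (X l)(l := b l)"
    by blast
  then have b: "b l \<in> tern m (2 * q - 1)" "agree m (X l l) (b l) = q - 1" "X (Suc l) = (X l)(l := b l)" if "l < K" for l
    using that by blast+
  have XV: "X i l \<in> tern m (2 * q - 1)" if "i \<le> K" "l < K" for i l
    using PiE_mem[OF subsetD[OF W], of "X i" l] X(1) that by simp
  have later: "X j l = (if i \<le> l \<and> l < j then b l else X i l)" if "i \<le> j" "j \<le> K" for i j l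
    using that
  proof (induction j rule: dec_induct)
    case (step j)
    then show ?case using b(3)[of j] by auto
  qed auto
  have block_dist: "l1_dist n (block_embed K m q s n X) (block_embed K m q s n Y) =
    (\<Sum>j<K. s j * (of_int (\<Sum>i<m. \<bar>X j i - Y j i\<bar>) / (2 * real q)))" for X Y
    by (rule l1_dist_block_embed[OF n]) (rule s)
  define g where "g i = block_embed K m q s n (X i)" for i
  have le: "l1_dist d (z i) (z j) = l1_dist n (g i) (g j)" if ij: "i \<le> j" "j \<le> K" for i j
  proof -
    have "l1_dist n (g i) (g j) = (\<Sum>l<K. if l \<in> {i..<j} then s l else 0)"
      unfolding g_def block_dist
    proof (rule sum.cong)
      fix l assume "l \<in> {..<K}"
      then have l: "l < K" by simp
      show "s l * (of_int (\<Sum>t<m. \<bar>X i l t - X j l t\<bar>) / (2 * real q)) = (if l \<in> {i..<j} then s l else 0)"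
      proof (cases "l \<in> {i..<j}")
        case True
        then have "X j l = b l" "X l l = X i l" using later[OF ij, of l] later[of i l l] l by auto
        then show ?thesis
          using tern_dist_adjacent(1)[OF XV[of l l] b(1,2)[OF l] q1] l True by (simp del: of_int_sum)
      next
        case False
        then have "X j l = X i l" using later[OF ij, of l] by auto
        then show ?thesis using False by (auto simp del: of_int_sum)
      qed
    qed simp
    also have "\<dots> = sum s ({..<K} \<inter> {i..<j})" by (subst sum.inter_restrict) auto
    also have "{..<K} \<inter> {i..<j} = {i..<j}" using ij by auto
    finally show ?thesis using dist[OF ij] by simp
  qed
  have "l1_isometric_copy d M n (g ` {..K})"
  proof (rule isometric_copyI[OF z])
    show "g i \<in> Rn n" for i unfolding g_def by (rule block_embed_in_Rn)
    fix i j assume "i \<in> {..K}" "j \<in> {..K}"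
    then show "l1_dist d (z i) (z j) = l1_dist n (g i) (g j)"
      using le[of i j] le[of j i] l1_dist_commute[of d "z i" "z j"] l1_dist_commute[of n "g i" "g j"]
      by (cases "i \<le> j") auto
  qed
  moreover have "g ` {..K} \<subseteq> block_embed K m q s n ` W" using X(1) by (auto simp: g_def)
  ultimately show "\<exists>M' \<subseteq> block_embed K m q s n ` W. l1_isometric_copy d M n M'" by blast
qed

section \<open>Asymptotics\<close>

text \<open>The ratio of the terms i+1 and i is (m-i) z / (i+1). The two hypotheses place its
  passage through 1 at j, so the j-th of the m+1 terms is the largest.\<close>

lemma max_binomial_term:
  fixes z :: real
  assumes z: "z > 0" and j: "j \<le> m" "real j \<le> (real m - real j + 1) * z" "(real m - real j) * z \<le> real j + 1"
  shows "(1 + z) ^ m \<le> (real m + 1) * (real (m choose j) * z ^ j)"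
proof -
  define T where "T i = real (m choose i) * z ^ i" for i
  have T0: "T i \<ge> 0" for i using z by (simp add: T_def)
  have rec: "T (Suc i) * (real i + 1) = T i * ((real m - real i) * z)" if "i < m" for i
  proof -
    have "Suc i * (m choose Suc i) = (m choose i) * (m - i)"
      using binomial_absorb_comp[of m i] binomial_absorption[of i m] by (simp add: mult.commute)
    then have "real (Suc i * (m choose Suc i)) = real ((m choose i) * (m - i))" by (rule arg_cong)
    then have "real (Suc i) * real (m choose Suc i) = real (m choose i) * (real m - real i)"
      using that by (simp only: of_nat_mult of_nat_diff less_imp_le)
    then have "real (Suc i) * real (m choose Suc i) * (z ^ i * z) = real (m choose i) * (real m - real i) * (z ^ i * z)"
      by simp
    then show ?thesis by (simp add: T_def mult_ac add.commute)
  qed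
  have up: "T i \<le> T (Suc i)" if i: "i < j" for i
  proof -
    have "real i + 1 \<le> real j" using i by simp
    also have "\<dots> \<le> (real m - real j + 1) * z" by (rule j(2))
    also have "\<dots> \<le> (real m - real i) * z" using i z by (intro mult_right_mono) auto
    finally have "T i * (real i + 1) \<le> T i * ((real m - real i) * z)" using T0 by (intro mult_left_mono)
    also have "\<dots> = T (Suc i) * (real i + 1)" using rec[of i] i j(1) by simp
    finally show ?thesis by (rule mult_right_le_imp_le) simp
  qed
  have down: "T (Suc i) \<le> T i" if i: "j \<le> i" "i < m" for i
  proof -
    have "T (Suc i) * (real i + 1) = T i * ((real m - real i) * z)" using rec i by simp
    also have "(real m - real i) * z \<le> (real m - real j) * z" using i z by (intro mult_right_mono) auto
    also have "\<dots> \<le> real j + 1" by (rule j(3))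
    also have "\<dots> \<le> real i + 1" using i by simp
    finally have "T (Suc i) * (real i + 1) \<le> T i * (real i + 1)" using T0 by (simp add: mult_left_mono)
    then show ?thesis by (rule mult_right_le_imp_le) simp
  qed
  have "T i \<le> T j" if "i \<le> m" for i
  proof (cases "i \<le> j")
    case True
    then show ?thesis
    proof (induction i rule: inc_induct)
      case (step i)
      then show ?case using up[of i] by linarith
    qed simp
  next
    case False
    then have "j \<le> i" by simp
    then show ?thesis using that
    proof (induction i rule: dec_induct)
      case (step i)
      then show ?case using down[of i] by simp
    qed simp
  qed
  then have "(\<Sum>i\<le>m. T i) \<le> (\<Sum>i\<le>m. T j)" by (intro sum_mono) simp
  moreover have "(1 + z) ^ m = (\<Sum>i\<le>m. T i)"
    using binomial_ring[of z 1 m] by (simp add: T_def add.commute)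
  ultimately show ?thesis by (simp add: T_def add.commute)
qed

definition psi_root :: real where
  "psi_root = (sqrt 3 - 1) / 2"

text \<open>\<open>psi_root\<close> maximises \<open>(1 + 2y) / (1 + 2y\<^sup>2)\<close>, and \<open>psi1\<close> is the maximum.\<close>

lemma psi_root: "0 < psi_root" "psi_root < 1" "psi1 * (1 + 2 * psi_root\<^sup>2) = 1 + 2 * psi_root"
proof -
  have s: "sqrt 3 * sqrt 3 = (3 :: real)" by simp
  have "1 < sqrt (3 :: real)" "sqrt (3 :: real) < 2" by (auto intro!: real_less_lsqrt real_less_rsqrt)
  then show "0 < psi_root" "psi_root < 1" by (auto simp: psi_root_def)
  have "(sqrt 3 - 1)\<^sup>2 = 4 - 2 * sqrt (3 :: real)" by (simp add: power2_eq_square algebra_simps)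
  then have 2: "2 * psi_root\<^sup>2 = 2 - sqrt 3" by (simp add: psi_root_def power_divide)
  have "(1 + sqrt 3) * (1 + (2 - sqrt 3)) = 2 * sqrt (3 :: real)" by (simp add: algebra_simps)
  then have "psi1 * (1 + (2 - sqrt 3)) = sqrt 3" by (simp add: psi1_def)
  also have "sqrt 3 = 1 + 2 * psi_root" unfolding psi_root_def by (simp add: diff_divide_distrib)
  finally have "psi1 * (1 + (2 - sqrt 3)) = 1 + 2 * psi_root" .
  then show "psi1 * (1 + 2 * psi_root\<^sup>2) = 1 + 2 * psi_root" unfolding 2 .
qed

lemma psi1_gt_1: "psi1 > 1"
  unfolding psi1_def by (simp add: real_less_rsqrt)

text \<open>With y = \<open>psi_root\<close>, m puts the largest term of (1+2y)^m at index 2q-1;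
  that term is the size of \<open>tern m (2 * q - 1)\<close> times y^(2q-1). The size of
  \<open>tern m (q - 1)\<close> times y^(2q-2) is one term of (1+2y^2)^m.\<close>

lemma tern_ratio:
  assumes q: "q \<ge> 1"
    and m: "m = nat \<lfloor>(real (2 * q - 1)) + (real (2 * q - 1) + 1) / (2 * psi_root)\<rfloor>"
  shows "psi1 ^ m * real (card (tern m (q - 1))) \<le> (real m + 1) * real (card (tern m (2 * q - 1)))"
    and "card (tern m (q - 1)) > 0"
proof -
  define j where "j = 2 * q - 1"
  define y where "y = psi_root"
  have y: "0 < y" "y < 1" using psi_root by (auto simp: y_def)
  define R where "R = real j + (real j + 1) / (2 * y)"
  have mR: "m = nat \<lfloor>R\<rfloor>" using m by (simp add: R_def j_def y_def)
  have "R \<ge> real j" using y by (simp add: R_def)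
  then have jm: "j \<le> m" unfolding mR by (simp add: le_nat_iff le_floor_iff)
  have m1: "real m \<le> R" "R < real m + 1"
    unfolding mR using \<open>R \<ge> real j\<close> by linarith+
  have Ry: "(R - real j) * (2 * y) = real j + 1" using y by (simp add: R_def)
  have "(real m - real j) * (2 * y) \<le> (R - real j) * (2 * y)"
    using m1 y by (intro mult_right_mono) auto
  then have c1: "(real m - real j) * (2 * y) \<le> real j + 1" using Ry by simp
  have "(R - real j) * (2 * y) \<le> (real m - real j + 1) * (2 * y)"
    using m1 y by (intro mult_right_mono) auto
  then have c2: "real j \<le> (real m - real j + 1) * (2 * y)" using Ry by simp
  have big: "(1 + 2 * y) ^ m \<le> (real m + 1) * (real (m choose j) * (2 * y) ^ j)"
    using max_binomial_term[of "2 * y" j m] jm c1 c2 y by simp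
  have small: "real (m choose (q - 1)) * (2 * y\<^sup>2) ^ (q - 1) \<le> (1 + 2 * y\<^sup>2) ^ m"
  proof (cases "q - 1 \<le> m")
    case True
    have "real (m choose (q - 1)) * (2 * y\<^sup>2) ^ (q - 1) \<le> (\<Sum>i\<le>m. real (m choose i) * (2 * y\<^sup>2) ^ i)"
      using True y by (intro member_le_sum) auto
    also have "\<dots> = (1 + 2 * y\<^sup>2) ^ m" using binomial_ring[of "2 * y\<^sup>2" 1 m] by (simp add: add.commute)
    finally show ?thesis .
  next
    case False
    then show ?thesis using y by (simp add: binomial_eq_0)
  qed
  define V where "V = real (card (tern m j))"
  define D where "D = real (card (tern m (q - 1)))"
  have "psi1 ^ m * D * y ^ (2 * (q - 1)) = psi1 ^ m * (real (m choose (q - 1)) * (2 * y\<^sup>2) ^ (q - 1))"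
    by (simp add: D_def card_tern power_mult_distrib power_mult mult_ac)
  also have "\<dots> \<le> psi1 ^ m * (1 + 2 * y\<^sup>2) ^ m"
    using small psi1_gt_1 by (intro mult_left_mono) auto
  also have "\<dots> = (1 + 2 * y) ^ m"
    using psi_root(3) by (simp add: y_def power_mult_distrib[symmetric])
  also have "\<dots> \<le> (real m + 1) * (real (m choose j) * (2 * y) ^ j)" by (rule big)
  also have "\<dots> = (real m + 1) * V * y ^ j"
    by (simp add: V_def card_tern power_mult_distrib mult_ac)
  \<comment> \<open>The powers of y differ by one factor y < 1, in the favourable direction.\<close>
  also have "y ^ j \<le> y ^ (2 * (q - 1))"
    using y q by (intro power_decreasing) (auto simp: j_def)
  then have "(real m + 1) * V * y ^ j \<le> (real m + 1) * V * y ^ (2 * (q - 1))"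
    by (intro mult_left_mono) (auto simp: V_def)
  finally have "psi1 ^ m * D \<le> (real m + 1) * V"
    by (rule mult_right_le_imp_le) (use y in simp)
  then show "psi1 ^ m * real (card (tern m (q - 1))) \<le> (real m + 1) * real (card (tern m (2 * q - 1)))"
    by (simp add: V_def D_def j_def)
  show "card (tern m (q - 1)) > 0" using jm q by (simp add: card_tern j_def)
qed

text \<open>Here prime powers in short intervals become a statement for every large n: K m falls
  short of n only by a factor close to 1.\<close>

lemma good_parameters:
  fixes \<epsilon> :: real
  assumes \<epsilon>: "\<epsilon> > 0" and K: "K \<ge> 1"
  shows "\<forall>\<^sub>F n in sequentially. \<exists>q m. primepow q \<and> K * m \<le> n \<and> (1 - \<epsilon>) * real n / real K \<le> real m \<and>
    card (tern m (q - 1)) > 0 \<and> psi1 ^ m * real (card (tern m (q - 1))) \<le> (real m + 1) * real (card (tern m (2 * q - 1)))"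
proof -
  define \<eta> where "\<eta> = \<epsilon> / 2"
  have \<eta>: "\<eta> > 0" using \<epsilon> by (simp add: \<eta>_def)
  define y where "y = psi_root"
  have y: "0 < y" "y < 1" using psi_root by (auto simp: y_def)
  \<comment> \<open>The limiting ratio m/q at the optimum: \<open>R\<close> will be
    \<open>\<gamma>\<close> q - 1.\<close>
  define \<gamma> where "\<gamma> = 2 * (1 + 1 / (2 * y))"
  have \<gamma>: "\<gamma> > 2" using y by (simp add: \<gamma>_def)
  obtain X where X: "\<And>x. x \<ge> X \<Longrightarrow> \<exists>q. primepow q \<and> x < real q \<and> real q \<le> (1 + \<eta>) * x"
    using primepow_between[OF \<eta>] by blast
  \<comment> \<open>Even the largest q that \<open>primepow_between\<close> may return for n/c
    satisfies K m <= n.\<close>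
  define c where "c = real K * \<gamma> * (1 + \<eta>)"
  have c: "c > 0" using K \<gamma> \<eta> by (simp add: c_def)
  show ?thesis
  \<comment> \<open>The first threshold brings n/c up to \<open>X\<close>; the second makes
    \<open>\<eta>\<close> n / K at least 2, which covers the rounding of m.\<close>
  proof (rule eventually_sequentiallyI[of "nat \<lceil>max (X * c) (2 * real K / \<eta>)\<rceil>"])
    fix n assume "nat \<lceil>max (X * c) (2 * real K / \<eta>)\<rceil> \<le> n"
    then have "max (X * c) (2 * real K / \<eta>) \<le> real n" by linarith
    then have n: "X * c \<le> real n" "2 * real K / \<eta> \<le> real n" by auto
    then have "X \<le> real n / c" using c by (simp add: pos_le_divide_eq)
    then obtain q where q: "primepow q" "real n / c < real q" "real q \<le> (1 + \<eta>) * (real n / c)"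
      using X by blast
    have q1: "q \<ge> 1" using primepow_gt_0_nat[OF q(1)] by simp
    define R where "R = real (2 * q - 1) + (real (2 * q - 1) + 1) / (2 * y)"
    define m where "m = nat \<lfloor>R\<rfloor>"
    have q2: "real (2 * q - 1) = 2 * real q - 1" using q1 by (simp add: of_nat_diff)
    have R: "R = \<gamma> * real q - 1" unfolding R_def \<gamma>_def q2 using y by (simp add: field_simps)
    have "\<gamma> * real q \<ge> 2 * 1" using \<gamma> q1 by (intro mult_mono) auto
    then have "R \<ge> 0" using R by simp
    then have m: "real m \<le> R" "R < real m + 1" unfolding m_def by linarith+
    have "real K * real m \<le> real K * (\<gamma> * real q)" using m R by (intro mult_left_mono) auto
    also have "\<dots> \<le> real K * (\<gamma> * ((1 + \<eta>) * (real n / c)))"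
      using q(3) \<gamma> by (intro mult_left_mono) auto
    also have "\<dots> = c * (real n / c)" by (simp add: c_def)
    also have "\<dots> = real n" using c by simp
    finally have Km: "K * m \<le> n" by (simp flip: of_nat_mult)
    have "(1 - \<eta>) * (real n / real K) \<le> 1 / (1 + \<eta>) * (real n / real K)"
    proof (rule mult_right_mono)
      have "(1 - \<eta>) * (1 + \<eta>) \<le> 1" by (simp add: algebra_simps)
      then show "1 - \<eta> \<le> 1 / (1 + \<eta>)" using \<eta> by (simp add: pos_le_divide_eq)
    qed simp
    also have "\<dots> = \<gamma> * (real n / c)" using \<gamma> by (simp add: c_def)
    also have "\<dots> < \<gamma> * real q" using q(2) \<gamma> by (intro mult_strict_left_mono) auto
    also have "\<gamma> * real q < real m + 2" using m R by simp
    finally have "(1 - \<eta>) * (real n / real K) < real m + 2" .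
    moreover have "2 \<le> \<eta> * (real n / real K)"
    proof -
      have "2 * real K \<le> real n * \<eta>" using n(2) \<eta> by (simp add: pos_divide_le_eq)
      then have "2 \<le> real n * \<eta> / real K" using K by (simp add: pos_le_divide_eq)
      then show ?thesis by (simp add: mult.commute)
    qed
    ultimately have "(1 - \<eta>) * (real n / real K) - \<eta> * (real n / real K) \<le> real m" by linarith
    moreover have "(1 - \<epsilon>) * real n / real K = (1 - \<eta>) * (real n / real K) - \<eta> * (real n / real K)"
    proof -
      have "(1 - \<epsilon>) * t = (1 - \<eta>) * t - \<eta> * t" for t by (simp add: \<eta>_def algebra_simps)
      from this[of "real n / real K"] show ?thesis by simp
    qed
    ultimately have "(1 - \<epsilon>) * real n / real K \<le> real m" by simp
    moreover note q(1) Km tern_ratio[OF q1 m_def[unfolded R_def y_def]]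
    ultimately show "\<exists>q m. primepow q \<and> K * m \<le> n \<and> (1 - \<epsilon>) * real n / real K \<le> real m \<and>
      card (tern m (q - 1)) > 0 \<and> psi1 ^ m * real (card (tern m (q - 1))) \<le> (real m + 1) * real (card (tern m (2 * q - 1)))"
      by (intro exI[of _ q] exI[of _ m] conjI)
  qed
qed

section \<open>From exponential bounds to the form (b + o(1))^n\<close>

lemma exp_lower_boundI:
  assumes b: "b > 0"
    and ev: "\<And>c. 0 < c \<Longrightarrow> c < b \<Longrightarrow> \<forall>\<^sub>F n in sequentially. ereal (c ^ n) \<le> ereal_of_enat (X n)"
  shows "exp_lower_bound X b"
proof -
  \<comment> \<open>\<open>err\<close> is 0 where X n >= b^n, in particular for infinite X n;
    elsewhere it makes (b + err n)^n equal to X n for n >= 1, so only its convergence calls for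
    \<open>ev\<close>.\<close>
  define err where "err n = (if ereal (b ^ n) \<le> ereal_of_enat (X n) then 0
     else root n (real (the_enat (X n))) - b)" for n
  have fin: "\<exists>k. X n = enat k \<and> real k < b ^ n \<and> err n = root n (real k) - b"
    if "\<not> ereal (b ^ n) \<le> ereal_of_enat (X n)" for n
    using that by (cases "X n") (auto simp: err_def)
  have "ereal ((b + err n) ^ n) \<le> ereal_of_enat (X n)" if n: "n \<ge> 1" for n
  proof (cases "ereal (b ^ n) \<le> ereal_of_enat (X n)")
    case False
    then obtain k where "X n = enat k" "err n = root n (real k) - b" using fin by blast
    then show ?thesis using n by simp
  qed (simp add: err_def)
  moreover have "err \<longlonglongrightarrow> 0"
  proof (rule tendstoI)
    fix e :: real assume e: "e > 0"
    define c where "c = max (b / 2) (b - e / 2)"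
    have c: "0 < c" "c < b" "b - e < c" using b e by (auto simp: c_def)
    show "\<forall>\<^sub>F n in sequentially. dist (err n) 0 < e"
      using ev[OF c(1,2)] eventually_ge_at_top[of 1]
    proof eventually_elim
      case (elim n)
      show ?case
      proof (cases "ereal (b ^ n) \<le> ereal_of_enat (X n)")
        case False
        then obtain k where k: "X n = enat k" "real k < b ^ n" "err n = root n (real k) - b" using fin by blast
        have "c ^ n \<le> real k" using elim k by simp
        then have "root n (c ^ n) \<le> root n (real k)" using elim by simp
        then have "c \<le> root n (real k)" using elim c by (simp add: real_root_power_cancel)
        moreover have "root n (real k) < root n (b ^ n)" using k elim by simp
        then have "root n (real k) < b" using elim b by (simp add: real_root_power_cancel)
        ultimately show ?thesis using c k by (simp add: dist_real_def)
      qed (use e in \<open>simp add: err_def\<close>)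
    qed
  qed
  then have "err \<in> o(\<lambda>_. 1)" by (intro smalloI_tendsto) auto
  ultimately show ?thesis unfolding exp_lower_bound_def by blast
qed

lemma exp_lower_bound_chi:
  assumes K: "K \<ge> 1"
    and chi: "\<And>q m n. primepow q \<Longrightarrow> K * m \<le> n \<Longrightarrow>
      ereal (real (card (tern m (2 * q - 1))) / (real K * real (card (tern m (q - 1))))) \<le> ereal_of_enat (chi n d M)"
  shows "exp_lower_bound (\<lambda>n. chi n d M) (psi1 powr (1 / real K))"
proof (rule exp_lower_boundI)
  show "psi1 powr (1 / real K) > 0" using psi1_gt_1 by simp
  fix c assume c: "0 < c" "c < psi1 powr (1 / real K)"
  define L where "L = ln psi1 / real K"
  have L: "L > 0" using psi1_gt_1 K by (simp add: L_def)
  have "ln c < ln (psi1 powr (1 / real K))" using c by (subst ln_less_cancel_iff) auto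
  then have lc: "ln c < L" using psi1_gt_1 by (simp add: L_def ln_powr)
  \<comment> \<open>\<open>\<epsilon>\<close> uses up half of the gap between ln c and L; the other
    half is the rate \<open>\<delta>\<close>, which absorbs the factor K (n+1).\<close>
  define \<epsilon> where "\<epsilon> = (L - ln c) / (2 * L)"
  have \<epsilon>: "\<epsilon> > 0" using lc L by (simp add: \<epsilon>_def)
  define \<delta> where "\<delta> = (1 - \<epsilon>) * L - ln c"
  have "\<epsilon> * L = (L - ln c) / 2" using L by (simp add: \<epsilon>_def)
  then have \<delta>: "\<delta> > 0" using lc by (simp add: \<delta>_def left_diff_distrib)
  have "\<forall>\<^sub>F n in sequentially. real K * (real n + 1) \<le> exp (\<delta> * real n)"
    using \<delta> by real_asymp
  then show "\<forall>\<^sub>F n in sequentially. ereal (c ^ n) \<le> ereal_of_enat (chi n d M)"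
    using good_parameters[OF \<epsilon> K]
  proof eventually_elim
    case (elim n)
    then obtain q m where qm: "primepow q" "K * m \<le> n" "(1 - \<epsilon>) * real n / real K \<le> real m"
      "card (tern m (q - 1)) > 0"
      "psi1 ^ m * real (card (tern m (q - 1))) \<le> (real m + 1) * real (card (tern m (2 * q - 1)))" by blast
    define V where "V = real (card (tern m (2 * q - 1)))"
    define D where "D = real (card (tern m (q - 1)))"
    have "c ^ n = exp (ln c * real n)" using c by (simp add: exp_of_nat2_mult)
    also have "\<dots> = exp ((1 - \<epsilon>) * L * real n) / exp (\<delta> * real n)"
      by (simp add: \<delta>_def left_diff_distrib flip: exp_diff)
    also have "\<dots> \<le> exp ((1 - \<epsilon>) * L * real n) / (real K * (real n + 1))"
      using elim(1) K by (intro divide_left_mono mult_pos_pos) auto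
    also have "exp ((1 - \<epsilon>) * L * real n) \<le> psi1 ^ m"
    proof -
      have "(1 - \<epsilon>) * L * real n = ln psi1 * ((1 - \<epsilon>) * real n / real K)" by (simp add: L_def)
      also have "\<dots> \<le> ln psi1 * real m" using qm(3) psi1_gt_1 by (intro mult_left_mono) auto
      finally have "exp ((1 - \<epsilon>) * L * real n) \<le> exp (ln psi1 * real m)" by simp
      also have "\<dots> = psi1 ^ m" using psi1_gt_1 by (simp add: exp_of_nat2_mult)
      finally show ?thesis .
    qed
    then have "exp ((1 - \<epsilon>) * L * real n) / (real K * (real n + 1)) \<le> psi1 ^ m / (real K * (real n + 1))"
      by (intro divide_right_mono) auto
    also have "\<dots> \<le> psi1 ^ m / (real K * (real m + 1))"
    proof (rule divide_left_mono)
      have "m \<le> K * m" using K by simp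
      then have "m \<le> n" using qm(2) by linarith
      then show "real K * (real m + 1) \<le> real K * (real n + 1)" by (intro mult_left_mono) auto
    qed (use K psi1_gt_1 in auto)
    also have "\<dots> \<le> V / (real K * D)"
    proof -
      have "psi1 ^ m > 0" using psi1_gt_1 by simp
      moreover have "psi1 ^ m * D \<le> (real m + 1) * V" "D > 0" using qm(5,4) by (simp_all add: V_def D_def)
      ultimately have "psi1 ^ m / (real m + 1) \<le> V / D"
        by (simp add: pos_le_divide_eq pos_divide_le_eq times_divide_eq_left mult.commute)
      then have "psi1 ^ m / (real m + 1) / real K \<le> V / D / real K" by (rule divide_right_mono) simp
      then show ?thesis by (simp only: divide_divide_eq_left mult.commute)
    qed
    finally have "c ^ n \<le> V / (real K * D)" .
    then have "ereal (c ^ n) \<le> ereal (V / (real K * D))" by simp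
    also have "\<dots> \<le> ereal_of_enat (chi n d M)" unfolding V_def D_def by (rule chi[OF qm(1,2)])
    finally show ?case .
  qed
qed

text \<open>Five decimals are for the roots: 1.0811^4 exceeds \<open>psi1\<close> by only about
  0.000015.\<close>

lemma psi1_bounds: "1.366 \<le> psi1" "psi1 < 1.367" "1.36602 < psi1" "psi1 < 1.36603"
proof -
  have "1.73204 < sqrt (3 :: real)" by (rule real_less_rsqrt) (simp add: power2_eq_square)
  moreover have "sqrt (3 :: real) < 1.73206" by (rule real_less_lsqrt) (simp_all add: power2_eq_square)
  ultimately show "1.366 \<le> psi1" "psi1 < 1.367" "1.36602 < psi1" "psi1 < 1.36603"
    by (simp_all add: psi1_def)
qed

lemma powr_inverse_nat_bounds:
  fixes x :: real
  assumes "k \<ge> 1" "0 \<le> a" "0 \<le> b" "0 < x"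
  shows "a ^ k \<le> x \<Longrightarrow> a \<le> x powr (1 / real k)" "x < b ^ k \<Longrightarrow> x powr (1 / real k) < b"
proof -
  have r: "x powr (1 / real k) = root k x" using assms by (simp add: root_powr_inverse)
  show "a \<le> x powr (1 / real k)" if "a ^ k \<le> x"
  proof -
    have "root k (a ^ k) \<le> root k x" using that assms by simp
    then show ?thesis using assms by (simp add: r real_root_power_cancel)
  qed
  show "x powr (1 / real k) < b" if "x < b ^ k"
  proof -
    have "root k x < root k (b ^ k)" using that assms by simp
    then show ?thesis using assms by (simp add: r real_root_power_cancel)
  qed
qed

section \<open>Batons, simplices and triangles\<close>

lemma baton_lower_bound:
  assumes k: "k \<ge> 1" and lam: "\<forall>i\<in>{1..k}. lam i > (0 :: real)"
  shows "exp_lower_bound (\<lambda>n. chi n 1 (baton k lam)) (psi1 powr (1 / real k))"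
proof (rule exp_lower_bound_chi[OF k])
  fix q m n :: nat assume q: "primepow q" and n: "k * m \<le> n"
  define z where "z j = (\<lambda>i\<in>{..<1 :: nat}. \<Sum>m=1..j. lam m)" for j
  \<comment> \<open>The steps of the baton are numbered from 1 and the blocks from 0, hence
    \<open>Suc l\<close>.\<close>
  have dist: "l1_dist 1 (z i) (z j) = (\<Sum>l\<in>{i..<j}. lam (Suc l))" if ij: "i \<le> j" "j \<le> k" for i j
  proof -
    have "(\<Sum>m=1..j. lam m) = (\<Sum>m=1..i. lam m) + (\<Sum>m\<in>{Suc i..j}. lam m)"
      using ij sum.ub_add_nat[of 1 i lam "j - i"] by simp
    moreover have "(\<Sum>m\<in>{Suc i..j}. lam m) = (\<Sum>l\<in>{i..<j}. lam (Suc l))"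
      using sum.shift_bounds_Suc_ivl[of lam i j] by (simp add: atLeastLessThanSuc_atLeastAtMost)
    moreover have "(\<Sum>l\<in>{i..<j}. lam (Suc l)) \<ge> 0"
      using lam ij by (intro sum_nonneg) (auto intro!: less_imp_le)
    ultimately show ?thesis by (simp add: l1_dist_def z_def)
  qed
  have ne: "z i \<noteq> z j" if "i < j" "j \<le> k" for i j
  proof
    assume "z i = z j"
    then have "l1_dist 1 (z i) (z j) = 0" by (simp add: l1_dist_def)
    then have "(\<Sum>l\<in>{i..<j}. lam (Suc l)) = 0" using dist[of i j] that by simp
    moreover have "(\<Sum>l\<in>{i..<j}. lam (Suc l)) > 0"
      using lam that by (intro sum_pos) auto
    ultimately show False by simp
  qed
  have "inj_on z {..k}"
  proof (rule inj_onI)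
    fix i j assume "i \<in> {..k}" "j \<in> {..k}" "z i = z j"
    then show "i = j" using ne[of i j] ne[of j i] by (cases i j rule: linorder_cases) auto
  qed
  moreover have "baton k lam = z ` {..k}"
    unfolding baton_def z_def atLeast0AtMost ..
  ultimately have bij: "bij_betw z {..k} (baton k lam)" by (simp add: bij_betw_def)
  have sub: "baton k lam \<subseteq> Rn 1"
    unfolding baton_def Rn_def by (rule image_subsetI) (rule restrict_PiE_iff[THEN iffD2], simp)
  show "ereal (real (card (tern m (2 * q - 1))) / (real k * real (card (tern m (q - 1))))) \<le> ereal_of_enat (chi n 1 (baton k lam))"
    by (rule chain_le_chi[OF q n k, where s = "\<lambda>l. lam (Suc l)" and z = z, OF _ bij sub dist])
       (use lam in \<open>auto intro!: less_imp_le\<close>)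
qed

lemma simplex_lower_bound:
  assumes S: "unit_simplex d k S"
  shows "exp_lower_bound (\<lambda>n. chi n d S) (psi1 powr (1 / (real k + 1)))"
proof -
  have K: "k + 1 \<ge> 1" by simp
  have S': "S \<subseteq> Rn d" "card S = k + 1" "\<And>x y. x \<in> S \<Longrightarrow> y \<in> S \<Longrightarrow> x \<noteq> y \<Longrightarrow> l1_dist d x y = 1"
    using S by (auto simp: unit_simplex_def)
  have "finite S" using S'(2) by (intro card_ge_0_finite) simp
  then obtain z where z: "bij_betw z {..<k + 1} S"
    using ex_bij_betw_nat_finite[of S] S'(2) by (auto simp: atLeast0LessThan)
  have "exp_lower_bound (\<lambda>n. chi n d S) (psi1 powr (1 / real (k + 1)))"
  proof (rule exp_lower_bound_chi[OF K])
    fix q m n :: nat assume q: "primepow q" and n: "(k + 1) * m \<le> n"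
    \<comment> \<open>Arms of length 1/2 to an imagined centre realise the k+1 vertices as a
      star.\<close>
    have dist: "l1_dist d (z i) (z j) = 1 / 2 + 1 / 2" if "i < k + 1" "j < k + 1" "i \<noteq> j" for i j
    proof -
      have "z i \<in> S" "z j \<in> S" "z i \<noteq> z j"
        using z that by (auto simp: bij_betw_def inj_on_def)
      then show ?thesis using S'(3) by simp
    qed
    show "ereal (real (card (tern m (2 * q - 1))) / (real (k + 1) * real (card (tern m (q - 1))))) \<le> ereal_of_enat (chi n d S)"
      by (rule star_le_chi[OF q n K, where s = "\<lambda>_. 1 / 2", OF _ z S'(1) dist]) simp
  qed
  then show ?thesis by (simp add: add.commute)
qed

lemma l1_dist_triangle: "l1_dist d x z \<le> l1_dist d x y + l1_dist d y z"
  unfolding l1_dist_def sum.distrib[symmetric] by (intro sum_mono) linarith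

lemma triangle_lower_bound:
  assumes T: "T \<subseteq> Rn d" "card T = 3"
  shows "exp_lower_bound (\<lambda>n. chi n d T) (psi1 powr (1 / 3))"
proof -
  have "finite T" using T(2) by (intro card_ge_0_finite) simp
  then obtain z where z: "bij_betw z {..<3 :: nat} T"
    using ex_bij_betw_nat_finite[of T] T(2) by (auto simp: atLeast0LessThan)
  define D where "D i j = l1_dist d (z i) (z j)" for i j
  have D: "D i j = D j i" "D i j \<le> D i l + D l j" for i j l
    unfolding D_def by (rule l1_dist_commute, rule l1_dist_triangle)
  \<comment> \<open>The Gromov products, which solve s i + s j = D i j; the triangle inequality is
    their nonnegativity.\<close>
  define s where "s i = (if i = 0 then (D 0 1 + D 0 2 - D 1 2) / 2 else
     if i = 1 then (D 0 1 + D 1 2 - D 0 2) / 2 else (D 0 2 + D 1 2 - D 0 1) / 2)" for i :: nat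
  have "exp_lower_bound (\<lambda>n. chi n d T) (psi1 powr (1 / real 3))"
  proof (rule exp_lower_bound_chi)
    fix q m n :: nat assume q: "primepow q" and n: "3 * m \<le> n"
    show "ereal (real (card (tern m (2 * q - 1))) / (real 3 * real (card (tern m (q - 1))))) \<le> ereal_of_enat (chi n d T)"
    proof (rule star_le_chi[OF q n _ _ z T(1), where s = s])
      show "s j \<ge> 0" for j
        using D(2)[of 1 2 0] D(2)[of 0 2 1] D(2)[of 0 1 2] D(1)[of 1 0] D(1)[of 2 1] by (auto simp: s_def)
      fix i j :: nat assume "i < 3" "j < 3" "i \<noteq> j"
      then have "(i, j) \<in> {(0, 1), (0, 2), (1, 0), (1, 2), (2, 0), (2, 1)}" by auto
      then have "D i j = s i + s j"
        using D(1)[of 1 0] D(1)[of 2 1] D(1)[of 2 0] by (auto simp: s_def field_simps)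
      then show "l1_dist d (z i) (z j) = s i + s j" by (simp add: D_def)
    qed simp
  qed simp
  then show ?thesis by simp
qed

theorem theorem11:
  shows
    "(1.366 \<le> psi1 \<and> psi1 < 1.367) \<and>
     (\<forall>(k::nat) (lam :: nat \<Rightarrow> real). k \<ge> 1 \<longrightarrow> (\<forall>i\<in>{1..k}. lam i > 0) \<longrightarrow>
        exp_lower_bound (\<lambda>n. chi n 1 (baton k lam)) (psi1 powr (1 / real k))) \<and>
     (\<forall>(k::nat) d S. k \<ge> 1 \<longrightarrow> unit_simplex d k S \<longrightarrow>
        exp_lower_bound (\<lambda>n. chi n d S) (psi1 powr (1 / (real k + 1)))) \<and>
     (1.1095 \<le> psi1 powr (1 / 3) \<and> psi1 powr (1 / 3) < 1.1096) \<and>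
     (\<forall>d S. unit_simplex d 2 S \<longrightarrow>
        exp_lower_bound (\<lambda>n. chi n d S) (psi1 powr (1 / 3))) \<and>
     (1.0810 \<le> psi1 powr (1 / 4) \<and> psi1 powr (1 / 4) < 1.0811) \<and>
     (\<forall>d S. unit_simplex d 3 S \<longrightarrow>
        exp_lower_bound (\<lambda>n. chi n d S) (psi1 powr (1 / 4))) \<and>
     (\<forall>d T. triangle_vertices d T \<longrightarrow>
        exp_lower_bound (\<lambda>n. chi n d T) (psi1 powr (1 / 3)))"
proof -
  have p: "psi1 > 0" using psi1_gt_1 by simp
  have n3: "1.1095 \<le> psi1 powr (1 / 3)" "psi1 powr (1 / 3) < 1.1096"
    using powr_inverse_nat_bounds[of 3 "1.1095" "1.1096" psi1] p psi1_bounds(3,4)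
    by (simp_all add: power3_eq_cube)
  have n4: "1.0810 \<le> psi1 powr (1 / 4)" "psi1 powr (1 / 4) < 1.0811"
    using powr_inverse_nat_bounds[of 4 "1.0810" "1.0811" psi1] p psi1_bounds(3,4)
    by (simp_all add: power4_eq_xxxx)
  have s2: "exp_lower_bound (\<lambda>n. chi n d S) (psi1 powr (1 / 3))" if "unit_simplex d 2 S" for d S
    using simplex_lower_bound[OF that] by simp
  have s3: "exp_lower_bound (\<lambda>n. chi n d S) (psi1 powr (1 / 4))" if "unit_simplex d 3 S" for d S
    using simplex_lower_bound[OF that] by simp
  show ?thesis
  proof (intro conjI allI impI)
    show "exp_lower_bound (\<lambda>n. chi n 1 (baton k lam)) (psi1 powr (1 / real k))"
      if "1 \<le> k" "\<forall>i\<in>{1..k}. 0 < lam i" for k and lam :: "nat \<Rightarrow> real"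
      using that by (rule baton_lower_bound)
    show "exp_lower_bound (\<lambda>n. chi n d S) (psi1 powr (1 / (real k + 1)))"
      if "unit_simplex d k S" for k d S
      using that by (rule simplex_lower_bound)
    show "exp_lower_bound (\<lambda>n. chi n d T) (psi1 powr (1 / 3))" if "triangle_vertices d T" for d T
      using that triangle_lower_bound by (simp add: triangle_vertices_def)
  qed (fact psi1_bounds n3 n4 s2 s3)+
qed

end
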